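(* Let $1/2<\delta<1$. For each integer $\ell\ge0$, and all $x\in\mathbb R$, $y>0$, $\theta\in[0,\pi)$, $$\phi_{\pm\ell}(n_xa_yk_\theta)=e^{\pm2\ell i\theta}\,\frac{\sqrt{\Gamma(\delta+\ell)\Gamma(1-\delta)}}{\sqrt{\Gamma(\delta)\Gamma(1-\delta+\ell)}}\int_{\mathbb R}\left(\frac{(u^2+1)y}{(x-u)^2+y^2}\right)^\delta\left(\frac{(x-u)\mp iy}{(x-u)\pm iy}\right)^\ell d\nu_i(u),$$ where $\Gamma(\cdot)$ in the prefactor denotes the Gamma function.
   Context: Let $G=\mathrm{PSL}_2(\mathbb R)$, with $n_x=\begin{pmatrix}1&x\\0&1\end{pmatrix}$, $a_y=\begin{pmatrix}\sqrt y&0\\0&1/\sqrt y\end{pmatrix}$, $k_\theta=\begin{pmatrix}\cos\theta&\sin\theta\\-\sin\theta&\cos\theta\end{pmatrix}$; every $g\in G$ is uniquely $n_xa_yk_\theta$ with $x\in\mathbb R$, $y>0$, $\theta\in[0,\pi)$. $K=\{k_\theta\}$. $\Gamma<G$ is a torsion-free, discrete, finitely generated subgroup, not virtually cyclic, with critical exponent $\delta$. Haar measure: $dg=y^{-2}dx\,dy\,dk$ for $g=n_xa_yk$, $dk$ the invariant probability measure on $K$; $\|\cdot\|_2$ is the norm of $L^2(\Gamma\backslash G,dg)$. $\nu_i$ is the Patterson measure: the finite measure on the limit set $\Lambda(\Gamma)\subset\mathbb R\cup\{\infty\}$ which, up to scaling, is the weak limit as $s\to\delta^+$ of $\frac{1}{\sum_\gamma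 e^{-s\,d(i,\gamma i)}}\sum_{\gamma\in\Gamma}e^{-s\,d(i,\gamma i)}\delta_{\gamma i}$ ($\delta_{\gamma i}$ the Dirac mass). It is scaled so that the $K$-invariant function $\phi_0(n_xa_yk_\theta)=\int_{\mathbb R}\left(\frac{(u^2+1)y}{(x-u)^2+y^2}\right)^\delta d\nu_i(u)$, which is the positive eigenfunction of $-y^2(\partial_x^2+\partial_y^2)$ in $L^2(\Gamma\backslash\mathbb H^2)$ with eigenvalue $\delta(1-\delta)$, satisfies $\|\phi_0\|_2=1$. Raising and lowering operators: $\mathcal R=e^{2i\theta}\left(iy\frac{\partial}{\partial x}+y\frac{\partial}{\partial y}+\frac1{2i}\frac{\partial}{\partial\theta}\right)$ and $\mathcal L=e^{-2i\theta}\left(-iy\frac{\partial}{\partial x}+y\frac{\partial}{\partial y}-\frac1{2i}\frac{\partial}{\partial\theta}\right)$. For $\ell\ge0$ set $\phi_\ell=\mathcal R^\ell\phi_0/\|\mathcal R^\ell\phi_0\|_2$ and $\phi_{-\ell}=\mathcal L^\ell\phi_0/\|\mathcal L^\ell\phi_0\|_2$. (These are unit vectors spanning the irreducible subrepresentation of $L^2(\Gamma\backslash G)$ on which the Casimir operator acts by $\delta(1-\delta)$, with $\phi_\ell(gk_\theta)=e^{2\ell i\theta}\phi_\ell(g)$ for all $\ell\in\mathbb Z$.) *)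

theory Defs
  imports
    "HOL-Analysis.Analysis"
    "HOL-Algebra.Generated_Groups"
    "HOL-Algebra.Elementary_Groups"
begin

text \<open>\<open>borel_of T\<close> is the Borel \<open>\<sigma>\<close>-algebra of an abstract topology, and \<open>converges_weakly\<close> is
  convergence of finite Borel measures tested on continuous real functions; it is only used
  for a compact space, where such functions are bounded.\<close>

definition borel_of :: "'a topology \<Rightarrow> 'a measure" where
  "borel_of T = sigma (topspace T) {U. openin T U}"

definition converges_weakly ::
    "'a topology \<Rightarrow> ('b \<Rightarrow> 'a measure) \<Rightarrow> 'a measure \<Rightarrow> 'b filter \<Rightarrow> bool" where
  "converges_weakly T M N F \<longleftrightarrow>
     (\<forall>f. continuous_map T euclideanreal f \<longrightarrow>
        ((\<lambda>s. integral\<^sup>L (M s) f) \<longlongrightarrow> integral\<^sup>L N f) F)"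


section \<open>Group-theoretic hypotheses\<close>

definition torsion_free :: "('a, 'b) monoid_scheme \<Rightarrow> bool" where
  "torsion_free G \<longleftrightarrow>
     (\<forall>g\<in>carrier G. g \<noteq> \<one>\<^bsub>G\<^esub> \<longrightarrow> (\<forall>n::nat. 0 < n \<longrightarrow> g [^]\<^bsub>G\<^esub> n \<noteq> \<one>\<^bsub>G\<^esub>))"

definition finitely_generated :: "('a, 'b) monoid_scheme \<Rightarrow> bool" where
  "finitely_generated G \<longleftrightarrow> (\<exists>S. finite S \<and> S \<subseteq> carrier G \<and> generate G S = carrier G)"

definition virtually_cyclic :: "('a, 'b) monoid_scheme \<Rightarrow> bool" where
  "virtually_cyclic G \<longleftrightarrow>
     (\<exists>H. subgroup H G \<and> cyclic_group (G\<lparr>carrier := H\<rparr>) \<and> finite (rcosets\<^bsub>G\<^esub> H))"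


section \<open>The group \<open>PSL\<^sub>2(\<real>)\<close>\<close>

definition SL2 :: "(real^2^2) monoid" where
  "SL2 = \<lparr>carrier = {A. det A = 1}, mult = (**), one = mat 1\<rparr>"

text \<open>An element of \<open>PSL2\<close> is a coset, i.e. a two-element set \<open>{A, - A}\<close> of matrices.\<close>

definition PSL2 :: "(real^2^2) set monoid" where
  "PSL2 = SL2 Mod {mat 1, - mat 1}"

definition psl :: "real^2^2 \<Rightarrow> (real^2^2) set" where
  "psl A = {mat 1, - mat 1} #>\<^bsub>SL2\<^esub> A"

definition PSL2_topology :: "(real^2^2) set topology" where
  "PSL2_topology = topology (\<lambda>U. U \<subseteq> carrier PSL2 \<and>
     openin (top_of_set (carrier SL2)) {A \<in> carrier SL2. psl A \<in> U})"

lemma carrier_PSL2: "carrier PSL2 = psl ` carrier SL2"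
  by (auto simp: PSL2_def FactGroup_def RCOSETS_def psl_def)

lemma openin_PSL2_topology:
  "openin PSL2_topology U \<longleftrightarrow> U \<subseteq> carrier PSL2 \<and>
     openin (top_of_set (carrier SL2)) {A \<in> carrier SL2. psl A \<in> U}"
proof -
  have "istopology (\<lambda>U. U \<subseteq> carrier PSL2 \<and>
     openin (top_of_set (carrier SL2)) {A \<in> carrier SL2. psl A \<in> U})"
    unfolding istopology_def
  proof (intro conjI allI impI)
    fix S T
    assume "S \<subseteq> carrier PSL2 \<and> openin (top_of_set (carrier SL2)) {A \<in> carrier SL2. psl A \<in> S}"
      and "T \<subseteq> carrier PSL2 \<and> openin (top_of_set (carrier SL2)) {A \<in> carrier SL2. psl A \<in> T}"
    then have "openin (top_of_set (carrier SL2))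
        ({A \<in> carrier SL2. psl A \<in> S} \<inter> {A \<in> carrier SL2. psl A \<in> T})"
      by (intro openin_Int) auto
    then show "openin (top_of_set (carrier SL2)) {A \<in> carrier SL2. psl A \<in> S \<inter> T}"
      by (rule back_subst) auto
  next
    fix \<K>
    assume *: "\<forall>K\<in>\<K>. K \<subseteq> carrier PSL2 \<and>
      openin (top_of_set (carrier SL2)) {A \<in> carrier SL2. psl A \<in> K}"
    have "openin (top_of_set (carrier SL2)) (\<Union>K\<in>\<K>. {A \<in> carrier SL2. psl A \<in> K})"
      using * by (intro openin_Union) auto
    then show "openin (top_of_set (carrier SL2)) {A \<in> carrier SL2. psl A \<in> \<Union> \<K>}"
      by (rule back_subst) auto
  qed auto
  then show ?thesis
    by (simp add: PSL2_topology_def topology_inverse')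
qed

lemma topspace_PSL2_topology: "topspace PSL2_topology = carrier PSL2"
proof
  show "topspace PSL2_topology \<subseteq> carrier PSL2"
    by (auto simp: topspace_def openin_PSL2_topology)
  have "{A \<in> carrier SL2. psl A \<in> carrier PSL2} = carrier SL2"
    by (auto simp: carrier_PSL2)
  then have "openin PSL2_topology (carrier PSL2)"
    by (simp add: openin_PSL2_topology)
  then show "carrier PSL2 \<subseteq> topspace PSL2_topology"
    by (rule openin_subset)
qed

lemma quotient_map_psl: "quotient_map (top_of_set (carrier SL2)) PSL2_topology psl"
  by (auto simp: quotient_map_def topspace_PSL2_topology openin_PSL2_topology carrier_PSL2)

definition discrete_subgroup :: "(real^2^2) set set \<Rightarrow> bool" where
  "discrete_subgroup \<Gamma> \<longleftrightarrow>
     subgroup \<Gamma> PSL2 \<and> subtopology PSL2_topology \<Gamma> = discrete_topology \<Gamma>"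

definition n_mat :: "real \<Rightarrow> real^2^2" where
  "n_mat x = vector [vector [1, x], vector [0, 1]]"

definition a_mat :: "real \<Rightarrow> real^2^2" where
  "a_mat y = vector [vector [sqrt y, 0], vector [0, 1 / sqrt y]]"

definition k_mat :: "real \<Rightarrow> real^2^2" where
  "k_mat \<theta> = vector [vector [cos \<theta>, sin \<theta>], vector [- sin \<theta>, cos \<theta>]]"

definition nak :: "real \<Rightarrow> real \<Rightarrow> real \<Rightarrow> (real^2^2) set" where
  "nak x y \<theta> = psl (n_mat x) \<otimes>\<^bsub>PSL2\<^esub> psl (a_mat y) \<otimes>\<^bsub>PSL2\<^esub> psl (k_mat \<theta>)"

definition nak_domain :: "(real \<times> real \<times> real) set" where
  "nak_domain = {(x, y, \<theta>). 0 < y \<and> 0 \<le> \<theta> \<and> \<theta> < pi}"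

definition nak_coords :: "(real^2^2) set \<Rightarrow> real \<times> real \<times> real" where
  "nak_coords g = (THE p. p \<in> nak_domain \<and> (case p of (x, y, \<theta>) \<Rightarrow> g = nak x y \<theta>))"

definition moebius :: "(real^2^2) set \<Rightarrow> complex \<Rightarrow> complex" where
  "moebius g z = (let A = (SOME A. A \<in> g) in
     (of_real (A$1$1) * z + of_real (A$1$2)) / (of_real (A$2$1) * z + of_real (A$2$2)))"

lemma psl_eq: "psl A = {A, - A}"
  by (auto simp: psl_def r_coset_def SL2_def matrix_mul_lid)
    (simp_all add: vec_eq_iff matrix_matrix_mult_def mat_def sum_2 forall_2)

lemma matrix_mult_minus: "(- A) ** B = - (A ** B)" "A ** (- B) = - (A ** (B :: real^2^2))"
  by (simp_all add: vec_eq_iff matrix_matrix_mult_def sum_negf)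

lemma psl_mult: "psl A \<otimes>\<^bsub>PSL2\<^esub> psl B = psl (A ** B)"
  by (auto simp: PSL2_def FactGroup_def set_mult_def psl_eq SL2_def matrix_mult_minus)

lemma nak_eq: "nak x y \<theta> = psl (n_mat x ** a_mat y ** k_mat \<theta>)"
  by (simp add: nak_def psl_mult)

lemma nak_entries:
  fixes x y \<theta>
  defines "M \<equiv> n_mat x ** a_mat y ** k_mat \<theta>"
  shows "M$2$1 = - sin \<theta> / sqrt y" "M$2$2 = cos \<theta> / sqrt y"
   "M$1$1 = sqrt y * cos \<theta> - x * sin \<theta> / sqrt y" "M$1$2 = sqrt y * sin \<theta> + x * cos \<theta> / sqrt y"
  by (simp_all add: M_def n_mat_def a_mat_def k_mat_def matrix_matrix_mult_def sum_2)

lemma moebius_nak: assumes "0 < y" shows "moebius (nak x y \<theta>) \<i> = Complex x y"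
proof -
  define M where "M = n_mat x ** a_mat y ** k_mat \<theta>"
  have nz: "Complex (cos \<theta>) (- sin \<theta>) \<noteq> 0"
    by (metis Complex_eq_0 add.right_neutral neg_equal_0_iff_equal power_zero_numeral sin_cos_squared_add zero_neq_one)
  have d: "\<i> * of_real (M$2$1) + of_real (M$2$2) = Complex (cos \<theta>) (- sin \<theta>) / of_real (sqrt y)"
    using assms by (simp add: M_def nak_entries complex_eq_iff)
  have n: "\<i> * of_real (M$1$1) + of_real (M$1$2) = Complex x y * (Complex (cos \<theta>) (- sin \<theta>) / of_real (sqrt y))"
  proof -
    have q: "sqrt y * (sqrt y * z) = y * z" for z
      using assms by (simp flip: mult.assoc)
    show ?thesis
      using assms by (simp add: M_def nak_entries complex_eq_iff field_simps q)
  qed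
  have *: "(of_real (A$1$1) * \<i> + of_real (A$1$2)) / (of_real (A$2$1) * \<i> + of_real (A$2$2)) = Complex x y"
    if "A \<in> {M, - M}" for A
  proof -
    have "(\<i> * of_real (M$1$1) + of_real (M$1$2)) / (\<i> * of_real (M$2$1) + of_real (M$2$2)) = Complex x y"
      unfolding d n using nz assms by simp
    moreover have "(- (\<i> * of_real (M$1$1)) - of_real (M$1$2)) / (- (\<i> * of_real (M$2$1)) - of_real (M$2$2)) =
     (\<i> * of_real (M$1$1) + of_real (M$1$2)) / (\<i> * of_real (M$2$1) + of_real (M$2$2))"
      by (metis (no_types, lifting) diff_conv_add_uminus minus_add_distrib minus_divide_divide)
    ultimately show ?thesis using that by (auto simp: mult.commute)
  qed
  have "(SOME A. A \<in> nak x y \<theta>) \<in> {M, - M}"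
    unfolding nak_eq psl_eq M_def[symmetric] by (rule someI[of _ M]) simp
  from *[OF this] show ?thesis by (simp add: moebius_def Let_def)
qed

lemma nak_coords_nak:
  assumes "(x, y, \<theta>) \<in> nak_domain"
  shows "nak_coords (nak x y \<theta>) = (x, y, \<theta>)"
  unfolding nak_coords_def
proof (rule the_equality)
  show "(x, y, \<theta>) \<in> nak_domain \<and> (case (x, y, \<theta>) of (x', y', \<theta>') \<Rightarrow> nak x y \<theta> = nak x' y' \<theta>')"
    using assms by simp
next
  fix p assume p: "p \<in> nak_domain \<and> (case p of (x', y', \<theta>') \<Rightarrow> nak x y \<theta> = nak x' y' \<theta>')"
  obtain x' y' t where pe: "p = (x', y', t)" by (cases p) auto
  have y: "0 < y" "0 < y'" and t: "0 \<le> t" "t < pi" "0 \<le> \<theta>" "\<theta> < pi" and e: "nak x y \<theta> = nak x' y' t"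
    using p assms by (auto simp: pe nak_domain_def)
  have xy: "x = x'" "y = y'" using moebius_nak[OF y(1), of x \<theta>] moebius_nak[OF y(2), of x' t] e by simp_all
  have "n_mat x ** a_mat y ** k_mat \<theta> \<in> nak x' y' t" using e unfolding nak_eq psl_eq by blast
  then consider "n_mat x ** a_mat y ** k_mat \<theta> = n_mat x' ** a_mat y' ** k_mat t"
    | "n_mat x ** a_mat y ** k_mat \<theta> = - (n_mat x' ** a_mat y' ** k_mat t)"
    unfolding nak_eq psl_eq by blast
  then have "\<exists>s. sin \<theta> / sqrt y = s * (sin t / sqrt y) \<and> cos \<theta> / sqrt y = s * (cos t / sqrt y)"
  proof cases
    case 1
    from arg_cong[OF this, of "\<lambda>A. A$2$1"] arg_cong[OF this, of "\<lambda>A. A$2$2"]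
    show ?thesis by (intro exI[of _ 1]) (simp add: nak_entries xy)
  next
    case 2
    from arg_cong[OF this, of "\<lambda>A. A$2$1"] arg_cong[OF this, of "\<lambda>A. A$2$2"]
    show ?thesis by (intro exI[of _ "-1"]) (simp add: nak_entries xy)
  qed
  then obtain s where "sin \<theta> / sqrt y = s * (sin t / sqrt y)" "cos \<theta> / sqrt y = s * (cos t / sqrt y)"
    by blast
  then have "sin \<theta> = s * sin t" "cos \<theta> = s * cos t" using y by auto
  then have "sin (\<theta> - t) = 0" by (simp add: sin_diff)
  then have "\<theta> = t" using t
    by (smt (verit) sin_gt_zero sin_minus)
  then show "p = (x, y, \<theta>)" using xy pe by simp
qed

text \<open>The density is \<open>1 / (\<pi> y\<^sup>2)\<close> because \<open>dk = d\<theta> / \<pi>\<close> has total mass 1 on \<open>[0, \<pi>)\<close>.\<close>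

definition haar :: "(real^2^2) set measure" where
  "haar = distr
     (density (restrict_space lborel nak_domain) (\<lambda>(x, y, \<theta>). ennreal (1 / (pi * y\<^sup>2))))
     (borel_of PSL2_topology) (\<lambda>(x, y, \<theta>). nak x y \<theta>)"


section \<open>The space \<open>L\<^sup>2(\<Gamma>\G)\<close>\<close>

text \<open>Functions on \<open>\<Gamma>\G\<close> are \<open>\<Gamma>\<close>-invariant functions on \<open>G\<close>, integrated over a strict Borel
  fundamental domain; the integral does not depend on which one is chosen.\<close>

definition fundamental_domain :: "(real^2^2) set set \<Rightarrow> (real^2^2) set set \<Rightarrow> bool" where
  "fundamental_domain \<Gamma> D \<longleftrightarrow>
     D \<in> sets haar \<and> (\<forall>g\<in>carrier PSL2. \<exists>!\<gamma>. \<gamma> \<in> \<Gamma> \<and> \<gamma> \<otimes>\<^bsub>PSL2\<^esub> g \<in> D)"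

definition quotient_haar :: "(real^2^2) set set \<Rightarrow> (real^2^2) set measure" where
  "quotient_haar \<Gamma> = restrict_space haar (SOME D. fundamental_domain \<Gamma> D)"

definition L2_quotient :: "(real^2^2) set set \<Rightarrow> ((real^2^2) set \<Rightarrow> complex) set" where
  "L2_quotient \<Gamma> = {f. f \<in> borel_measurable (borel_of PSL2_topology) \<and>
     (\<forall>\<gamma>\<in>\<Gamma>. \<forall>g\<in>carrier PSL2. f (\<gamma> \<otimes>\<^bsub>PSL2\<^esub> g) = f g) \<and>
     integrable (quotient_haar \<Gamma>) (\<lambda>g. (cmod (f g))\<^sup>2)}"

definition L2_norm :: "(real^2^2) set set \<Rightarrow> ((real^2^2) set \<Rightarrow> complex) \<Rightarrow> real" where
  "L2_norm \<Gamma> f = sqrt (\<integral>g. (cmod (f g))\<^sup>2 \<partial>quotient_haar \<Gamma>)"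


section \<open>Patterson measure\<close>

definition hyp_dist :: "complex \<Rightarrow> complex \<Rightarrow> real" where
  "hyp_dist z w = arcosh (1 + (cmod (z - w))\<^sup>2 / (2 * Im z * Im w))"

text \<open>\<open>H_bar\<close> is the compactification \<open>\<H> \<union> \<real> \<union> {\<infinity>}\<close> of the upper half plane inside the
  Riemann sphere, with \<open>None\<close> as the point at infinity.\<close>

definition H_bar :: "complex option topology" where
  "H_bar = subtopology (Alexandroff_compactification euclidean)
     (insert None (Some ` {z. 0 \<le> Im z}))"

definition H_boundary :: "complex option set" where
  "H_boundary = insert None (Some ` {z. Im z = 0})"

definition limit_set :: "(real^2^2) set set \<Rightarrow> complex option set" where
  "limit_set \<Gamma> = H_boundary \<inter> (H_bar derived_set_of ((\<lambda>\<gamma>. Some (moebius \<gamma> \<i>)) ` \<Gamma>))"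

definition critical_exponent :: "(real^2^2) set set \<Rightarrow> real" where
  "critical_exponent \<Gamma> =
     Inf {s. 0 \<le> s \<and> (\<lambda>\<gamma>. exp (- s * hyp_dist \<i> (moebius \<gamma> \<i>))) summable_on \<Gamma>}"

definition poincare_series :: "(real^2^2) set set \<Rightarrow> real \<Rightarrow> real" where
  "poincare_series \<Gamma> s = (\<Sum>\<^sub>\<infinity>\<gamma>\<in>\<Gamma>. exp (- s * hyp_dist \<i> (moebius \<gamma> \<i>)))"

text \<open>The normalised sum over \<open>\<gamma> \<in> \<Gamma>\<close> of the Dirac masses at \<open>\<gamma> i\<close> with weights
  \<open>e\<^sup>-\<^sup>s\<^sup>d\<^sup>(\<^sup>i\<^sup>,\<^sup>\<gamma>\<^sup>i\<^sup>)\<close>, as an image of a weighted counting measure on \<open>\<Gamma>\<close>.\<close>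

definition orbit_measure :: "(real^2^2) set set \<Rightarrow> real \<Rightarrow> complex option measure" where
  "orbit_measure \<Gamma> s = distr
     (density (count_space \<Gamma>)
       (\<lambda>\<gamma>. ennreal (exp (- s * hyp_dist \<i> (moebius \<gamma> \<i>)) / poincare_series \<Gamma> s)))
     (borel_of H_bar) (\<lambda>\<gamma>. Some (moebius \<gamma> \<i>))"

definition patterson_measure :: "(real^2^2) set set \<Rightarrow> complex option measure \<Rightarrow> bool" where
  "patterson_measure \<Gamma> \<nu> \<longleftrightarrow>
     finite_measure \<nu> \<and> sets \<nu> = sets (borel_of H_bar) \<and>
     emeasure \<nu> (space \<nu> - limit_set \<Gamma>) = 0 \<and>
     (\<exists>c>0. converges_weakly H_bar (orbit_measure \<Gamma>) (scale_measure (ennreal c) \<nu>)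
        (at_right (critical_exponent \<Gamma>)))"

text \<open>Integration over \<open>\<real>\<close> against a measure on \<open>\<H> \<union> \<real> \<union> {\<infinity>}\<close>.\<close>

definition integral_real :: "complex option measure \<Rightarrow> (real \<Rightarrow> complex) \<Rightarrow> complex" where
  "integral_real \<nu> h =
     (LINT p : range (\<lambda>u::real. Some (complex_of_real u)) | \<nu>. h (Re (the p)))"


section \<open>The functions \<open>\<phi>\<^sub>\<ell>\<close>\<close>

definition phi0 :: "real \<Rightarrow> complex option measure \<Rightarrow> (real^2^2) set \<Rightarrow> complex" where
  "phi0 \<delta> \<nu> g = (case nak_coords g of (x, y, \<theta>) \<Rightarrow>
     integral_real \<nu> (\<lambda>u. of_real (((u\<^sup>2 + 1) * y / ((x - u)\<^sup>2 + y\<^sup>2)) powr \<delta>)))"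

definition raising :: "((real^2^2) set \<Rightarrow> complex) \<Rightarrow> (real^2^2) set \<Rightarrow> complex" where
  "raising f g = (case nak_coords g of (x, y, \<theta>) \<Rightarrow>
     exp (2 * \<i> * of_real \<theta>) *
       (\<i> * of_real y * vector_derivative (\<lambda>t. f (nak t y \<theta>)) (at x)
        + of_real y * vector_derivative (\<lambda>t. f (nak x t \<theta>)) (at y)
        + 1 / (2 * \<i>) * vector_derivative (\<lambda>t. f (nak x y t)) (at \<theta>)))"

definition lowering :: "((real^2^2) set \<Rightarrow> complex) \<Rightarrow> (real^2^2) set \<Rightarrow> complex" where
  "lowering f g = (case nak_coords g of (x, y, \<theta>) \<Rightarrow>
     exp (- 2 * \<i> * of_real \<theta>) *
       (- \<i> * of_real y * vector_derivative (\<lambda>t. f (nak t y \<theta>)) (at x)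
        + of_real y * vector_derivative (\<lambda>t. f (nak x t \<theta>)) (at y)
        - 1 / (2 * \<i>) * vector_derivative (\<lambda>t. f (nak x y t)) (at \<theta>)))"

definition phi ::
    "(real^2^2) set set \<Rightarrow> real \<Rightarrow> complex option measure \<Rightarrow> int \<Rightarrow> (real^2^2) set \<Rightarrow> complex" where
  "phi \<Gamma> \<delta> \<nu> l =
     (let f = (if 0 \<le> l then (raising ^^ nat l) (phi0 \<delta> \<nu>)
               else (lowering ^^ nat (- l)) (phi0 \<delta> \<nu>))
      in (\<lambda>g. f g / of_real (L2_norm \<Gamma> f)))"

end

theory Submission
  imports Defs
begin

text \<open>The function \<open>\<phi>\<^sub>0\<close> is a superposition, over boundary points \<open>u\<close>, of powers of Poisson kernels. For
a matrix \<open>A = (a b; c d)\<close> in \<open>SL\<^sub>2\<close> put \<open>q = (b - u d) + i (a - u c)\<close>. Then the Poisson kernel is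
\<open>P = (u\<^sup>2 + 1) / |q|\<^sup>2\<close>, and since right multiplication by \<open>k\<^sub>\<theta>\<close> multiplies \<open>q\<close> by \<open>e\<^sup>-\<^sup>i\<^sup>\<theta>\<close>, the integral
\<open>F\<^sub>l(A) = \<integral> P\<^sup>\<delta> (cnj q / q)\<^sup>l d\<nu>(u)\<close> has \<open>K\<close>-weight \<open>2l\<close>. In the coordinates \<open>(x, y, \<theta>)\<close> it is
\<open>e\<^sup>2\<^sup>i\<^sup>l\<^sup>\<theta>\<close> times the integral in the theorem. Differentiating \<open>cnj q\<close> to the power \<open>l - \<delta>\<close> times \<open>q\<close> to
the power \<open>- l - \<delta>\<close> under the integral sign gives \<open>R F\<^sub>l = (\<delta> + l) F\<^sub>l\<^sub>+\<^sub>1\<close> and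
\<open>L F\<^sub>l = (\<delta> - l) F\<^sub>l\<^sub>-\<^sub>1\<close> (\<open>raising_weight_fun\<close>). Hence \<open>R\<^sup>l \<phi>\<^sub>0 = \<delta> (\<delta> + 1) \<dots> (\<delta> + l - 1) F\<^sub>l\<close>, and it remains
to compute the norm of \<open>F\<^sub>l\<close>.

The phase \<open>cnj q / q\<close> has modulus one, so \<open>|F\<^sub>l| \<le> F\<^sub>0 = \<phi>\<^sub>0\<close> pointwise and every \<open>F\<^sub>l\<close> is square integrable.
Let \<open>a\<^sub>t = diag(e\<^sup>t, e\<^sup>-\<^sup>t)\<close>. The derivative of \<open>F\<^sub>l(g a\<^sub>t)\<close> in \<open>t\<close> is \<open>(\<delta> + l) F\<^sub>l\<^sub>+\<^sub>1 + (\<delta> - l) F\<^sub>l\<^sub>-\<^sub>1\<close> at \<open>g a\<^sub>t\<close>.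
The inner product of the translates of \<open>F\<^sub>l\<close> and \<open>F\<^sub>l\<^sub>+\<^sub>1\<close> by \<open>a\<^sub>t\<close> does not depend on \<open>t\<close>; its derivative at 0
may be taken under the integral because \<open>F\<^sub>0(g a\<^sub>t) \<le> e\<^sup>2\<^sup>\<delta> F\<^sub>0(g)\<close> for \<open>|t| \<le> 1\<close>. As different \<open>K\<close>-weights are
orthogonal, only two terms survive, and they say
\<open>(\<delta> + l) \<parallel>F\<^sub>l\<^sub>+\<^sub>1\<parallel>\<^sup>2 = (1 - \<delta> + l) \<parallel>F\<^sub>l\<parallel>\<^sup>2\<close> (\<open>weight_inner_recursion\<close>). Together with \<open>\<parallel>F\<^sub>0\<parallel> = 1\<close> this
determines all norms as quotients of Pochhammer symbols, which are the Gamma factors of the theorem.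

This argument integrates over \<open>\<Gamma>\G\<close>, so it needs three facts. First, each \<open>F\<^sub>l\<close> is \<open>\<Gamma>\<close>-invariant: for \<open>F\<^sub>0\<close>
this is given, and differentiating along \<open>a\<^sub>t\<close>, after rotations, passes it from \<open>F\<^sub>l\<close> to \<open>F\<^sub>l\<^sub>+\<^sub>1\<close>
(\<open>poisson_integral_invariant_Suc\<close>). Secondly, the Haar measure is bi-invariant: in the coordinates
\<open>(x, c, d)\<close>, with \<open>(c, d)\<close> the bottom row, it is \<open>dx dc dd / \<pi>\<close>, applied to even functions of a matrix
(\<open>nn_integral_haar\<close>), and the group acts there by shears and by changing one entry affinely. Thirdly, a
strict Borel fundamental domain exists, and unfolding over \<open>\<Gamma>\<close> shows that the integral over it is
invariant under right translation (\<open>nn_integral_quotient_haar_right\<close>).\<close>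

section \<open>Matrices and the group \<open>PSL\<^sub>2(\<real>)\<close>\<close>

abbreviation PSL2_mult :: "(real^2^2) set \<Rightarrow> (real^2^2) set \<Rightarrow> (real^2^2) set" (infixl "\<cdot>" 70) where
  "g \<cdot> h \<equiv> g \<otimes>\<^bsub>PSL2\<^esub> h"

definition mat2 :: "real \<Rightarrow> real \<Rightarrow> real \<Rightarrow> real \<Rightarrow> real^2^2" where
  "mat2 a b c d = vector [vector [a, b], vector [c, d]]"

lemma mat2_nth [simp]:
  "mat2 a b c d $ 1 $ 1 = a" "mat2 a b c d $ 1 $ 2 = b" "mat2 a b c d $ 2 $ 1 = c" "mat2 a b c d $ 2 $ 2 = d"
  by (simp_all add: mat2_def)

lemma mat2_eta: "mat2 (A$1$1) (A$1$2) (A$2$1) (A$2$2) = A"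
  by (simp add: vec_eq_iff forall_2)

lemma matrix_eq_entries:
  "A = B \<longleftrightarrow> A$1$1 = B$1$1 \<and> A$1$2 = B$1$2 \<and> A$2$1 = B$2$1 \<and> A$2$2 = (B :: real^2^2)$2$2"
  by (auto simp: vec_eq_iff forall_2)

lemma mult_nth:
  fixes A B :: "real^2^2"
  shows "(A ** B)$1$1 = A$1$1 * B$1$1 + A$1$2 * B$2$1" "(A ** B)$1$2 = A$1$1 * B$1$2 + A$1$2 * B$2$2"
    "(A ** B)$2$1 = A$2$1 * B$1$1 + A$2$2 * B$2$1" "(A ** B)$2$2 = A$2$1 * B$1$2 + A$2$2 * B$2$2"
  by (simp_all add: matrix_matrix_mult_def sum_2)

lemma one_nth: "(mat 1 :: real^2^2)$1$1 = 1" "(mat 1 :: real^2^2)$1$2 = 0"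
  "(mat 1 :: real^2^2)$2$1 = 0" "(mat 1 :: real^2^2)$2$2 = 1"
  by (simp_all add: mat_def)

lemma mat2_mult: "mat2 a b c d ** mat2 a' b' c' d' = mat2 (a*a' + b*c') (a*b' + b*d') (c*a' + d*c') (c*b' + d*d')"
  by (simp add: matrix_eq_entries mult_nth)

definition adj2 :: "real^2^2 \<Rightarrow> real^2^2" where
  "adj2 A = mat2 (A$2$2) (- A$1$2) (- A$2$1) (A$1$1)"

lemma in_SL2: "A \<in> carrier SL2 \<longleftrightarrow> A$1$1 * A$2$2 - A$1$2 * A$2$1 = 1"
  by (simp add: SL2_def det_2)

lemma mat2_in_SL2: "mat2 a b c d \<in> carrier SL2 \<longleftrightarrow> a * d - b * c = 1"
  by (simp add: in_SL2)

lemma mult_in_SL2: "A \<in> carrier SL2 \<Longrightarrow> B \<in> carrier SL2 \<Longrightarrow> A ** B \<in> carrier SL2"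
  by (simp add: SL2_def det_mul)

lemma one_in_SL2: "mat 1 \<in> carrier SL2"
  by (simp add: SL2_def)

lemma uminus_in_SL2: "- A \<in> carrier SL2 \<longleftrightarrow> A \<in> carrier SL2"
  by (simp add: in_SL2)

lemma adj2_in_SL2: "A \<in> carrier SL2 \<Longrightarrow> adj2 A \<in> carrier SL2"
  by (simp add: in_SL2 adj2_def algebra_simps)

lemma adj2_mult: "A \<in> carrier SL2 \<Longrightarrow> adj2 A ** A = mat 1" "A \<in> carrier SL2 \<Longrightarrow> A ** adj2 A = mat 1"
  by (auto simp add: in_SL2 adj2_def matrix_eq_entries mult_nth one_nth algebra_simps)

lemma psl_uminus: "psl (- A) = psl A"
  by (auto simp: psl_eq)

lemma psl_eq_iff: "psl A = psl B \<longleftrightarrow> A = B \<or> A = - B"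
  by (auto simp: psl_eq doubleton_eq_iff)

lemma psl_in_PSL2: "A \<in> carrier SL2 \<Longrightarrow> psl A \<in> carrier PSL2"
  by (simp add: carrier_PSL2)

lemma psl_in_PSL2_iff: "psl A \<in> carrier PSL2 \<longleftrightarrow> A \<in> carrier SL2"
  by (auto simp: carrier_PSL2 psl_eq_iff uminus_in_SL2)

lemma PSL2_cases:
  assumes "g \<in> carrier PSL2" obtains A where "A \<in> carrier SL2" "g = psl A"
  using assms by (auto simp: carrier_PSL2)

lemma one_PSL2: "\<one>\<^bsub>PSL2\<^esub> = psl (mat 1)"
  by (simp add: PSL2_def FactGroup_def psl_eq)

lemma group_PSL2: "group PSL2"
proof (rule groupI)
  fix x y assume "x \<in> carrier PSL2" "y \<in> carrier PSL2"
  then show "x \<cdot> y \<in> carrier PSL2"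
    by (auto elim!: PSL2_cases simp: psl_mult mult_in_SL2 psl_in_PSL2)
next
  show "\<one>\<^bsub>PSL2\<^esub> \<in> carrier PSL2" by (simp add: one_PSL2 psl_in_PSL2 one_in_SL2)
next
  fix x y z assume "x \<in> carrier PSL2" "y \<in> carrier PSL2" "z \<in> carrier PSL2"
  then show "x \<cdot> y \<cdot> z = x \<cdot> (y \<cdot> z)"
    by (auto elim!: PSL2_cases simp: psl_mult matrix_mul_assoc)
next
  fix x assume "x \<in> carrier PSL2"
  then show "\<one>\<^bsub>PSL2\<^esub> \<cdot> x = x"
    by (auto elim!: PSL2_cases simp: psl_mult one_PSL2)
next
  fix x assume "x \<in> carrier PSL2"
  then obtain A where A: "A \<in> carrier SL2" "x = psl A" by (rule PSL2_cases)
  then show "\<exists>y\<in>carrier PSL2. y \<cdot> x = \<one>\<^bsub>PSL2\<^esub>"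
    by (intro bexI[of _ "psl (adj2 A)"]) (simp_all add: psl_mult adj2_mult one_PSL2 psl_in_PSL2 adj2_in_SL2)
qed

interpretation PSL2: group PSL2 by (rule group_PSL2)

lemma inv_psl: "A \<in> carrier SL2 \<Longrightarrow> inv\<^bsub>PSL2\<^esub> psl A = psl (adj2 A)"
  by (rule PSL2.inv_equality) (simp_all add: psl_mult adj2_mult one_PSL2 psl_in_PSL2 adj2_in_SL2)

lemma nak_mat2: "nak x y \<theta> = psl (mat2 (sqrt y * cos \<theta> - x * sin \<theta> / sqrt y)
   (sqrt y * sin \<theta> + x * cos \<theta> / sqrt y) (- sin \<theta> / sqrt y) (cos \<theta> / sqrt y))"
  unfolding nak_eq by (rule arg_cong[where f = psl]) (simp add: matrix_eq_entries nak_entries)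

lemma nak_mat2_in_SL2:
  assumes "0 < y"
  shows "mat2 (sqrt y * cos \<theta> - x * sin \<theta> / sqrt y)
   (sqrt y * sin \<theta> + x * cos \<theta> / sqrt y) (- sin \<theta> / sqrt y) (cos \<theta> / sqrt y) \<in> carrier SL2"
proof -
  define s where "s = sqrt y"
  have "s \<noteq> 0" using assms by (simp add: s_def)
  then have "(s * p - x * q / s) * (p / s) - (s * q + x * p / s) * (- q / s) = p * p + q * q" for p q
    by (simp add: field_simps)
  from this[of "cos \<theta>" "sin \<theta>"]
  show ?thesis by (simp add: mat2_in_SL2 s_def)
qed

lemma nak_in_PSL2: "0 < y \<Longrightarrow> nak x y \<theta> \<in> carrier PSL2"
  unfolding nak_mat2 by (intro psl_in_PSL2 nak_mat2_in_SL2)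

lemma bottom_row_nonzero: "A \<in> carrier SL2 \<Longrightarrow> 0 < (A$2$1)\<^sup>2 + (A$2$2)\<^sup>2"
  by (metis in_SL2 mult_zero_right diff_zero sum_power2_gt_zero_iff zero_neq_one)

text \<open>The bottom row \<open>(c, d)\<close> determines \<open>y\<close> and the angle up to a multiple of \<open>\<pi>\<close>; the sign ambiguity of
the matrix is used to bring the angle into \<open>[0, \<pi>)\<close>.\<close>

lemma iwasawa:
  assumes "g \<in> carrier PSL2"
  obtains x y \<theta> where "(x, y, \<theta>) \<in> nak_domain" "g = nak x y \<theta>"
proof -
  obtain A where A: "A \<in> carrier SL2" and g: "g = psl A" using assms by (rule PSL2_cases)
  obtain a b c d where Ae: "A = mat2 a b c d" using mat2_eta[of A] by metis
  have dt: "a * d - b * c = 1" using A by (simp add: Ae mat2_in_SL2)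
  define r where "r = sqrt (c\<^sup>2 + d\<^sup>2)"
  have r: "0 < r" "r\<^sup>2 = c\<^sup>2 + d\<^sup>2" using bottom_row_nonzero[OF A] by (simp_all add: r_def Ae)
  have "(d / r)\<^sup>2 + (- c / r)\<^sup>2 = 1" 
    using r(1) bottom_row_nonzero[OF A]
    by (auto simp: power_divide r(2) Ae add_divide_distrib[symmetric] add.commute[of "d\<^sup>2"] sum_power2_gt_zero_iff)
  then obtain t where t: "0 \<le> t" "t < 2 * pi" "d / r = cos t" "- c / r = sin t"
    using sincos_total_2pi by metis
  \<comment> \<open>Replacing the matrix by its negative shifts the angle by \<open>\<pi>\<close>.\<close>
  define s :: real where "s = (if t < pi then 1 else -1)"
  define \<theta> where "\<theta> = (if t < pi then t else t - pi)"
  have th: "0 \<le> \<theta>" "\<theta> < pi" "cos \<theta> = s * d / r" "sin \<theta> = - s * c / r"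
    using t by (auto simp: \<theta>_def s_def cos_diff sin_diff)
  have s: "s * s = 1" by (simp add: s_def)
  define y where "y = 1 / r\<^sup>2"
  have y: "0 < y" "sqrt y = 1 / r" using r(1) by (simp_all add: y_def real_sqrt_divide)
  define x where "x = (a * c + b * d) / r\<^sup>2"
  have e1: "s * a * r\<^sup>2 = s * d + (a * c + b * d) * (s * c)"
    unfolding r using dt by algebra
  have e2: "s * b * r\<^sup>2 = - (s * c) + (a * c + b * d) * (s * d)"
    unfolding r using dt by algebra
  have "nak x y \<theta> = psl (mat2 (s * a) (s * b) (s * c) (s * d))"
    unfolding nak_mat2
  proof (intro arg_cong[where f = psl])
    have "x * r\<^sup>2 = a * c + b * d" using r(1) by (simp add: x_def)
    then have "(s * a) * r\<^sup>2 = s * d + (x * r\<^sup>2) * (s * c)" "(s * b) * r\<^sup>2 = - (s * c) + (x * r\<^sup>2) * (s * d)"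
      using e1 e2 by simp_all
    moreover have "s * d + (x * r\<^sup>2) * (s * c) = (s * d / r\<^sup>2 + x * (s * c)) * r\<^sup>2"
      "- (s * c) + (x * r\<^sup>2) * (s * d) = (- s * c / r\<^sup>2 + x * (s * d)) * r\<^sup>2"
      using r(1) by (simp_all add: field_simps)
    ultimately have "(s * a) * r\<^sup>2 = (s * d / r\<^sup>2 + x * (s * c)) * r\<^sup>2"
      "(s * b) * r\<^sup>2 = (- s * c / r\<^sup>2 + x * (s * d)) * r\<^sup>2" by simp_all
    then have "s * a = s * d / r\<^sup>2 + x * (s * c)" "s * b = - s * c / r\<^sup>2 + x * (s * d)"
      using r(1) by simp_all
    then show "mat2 (sqrt y * cos \<theta> - x * sin \<theta> / sqrt y) (sqrt y * sin \<theta> + x * cos \<theta> / sqrt y)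
      (- sin \<theta> / sqrt y) (cos \<theta> / sqrt y) = mat2 (s * a) (s * b) (s * c) (s * d)"
      using r(1) by (simp add: y th matrix_eq_entries power2_eq_square)
  qed
  also have "\<dots> = g" by (auto simp: g s_def psl_eq_iff Ae matrix_eq_entries)
  finally show ?thesis using that[of x y \<theta>] y th by (simp add: nak_domain_def)
qed

text \<open>The quotient by a finite group is open: the saturation of \<open>U\<close> is \<open>U \<union> - U\<close>.\<close>

section \<open>Topology and Borel structure\<close>

lemma openin_psl_image:
  assumes "open U" shows "openin PSL2_topology (psl ` (U \<inter> carrier SL2))"
proof -
  have "{A \<in> carrier SL2. psl A \<in> psl ` (U \<inter> carrier SL2)} = carrier SL2 \<inter> (U \<union> uminus ` U)"
    by (force simp: psl_eq_iff uminus_in_SL2 image_iff)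
  then show ?thesis using assms
    by (auto simp: openin_PSL2_topology carrier_PSL2 open_negations openin_open intro!: exI[of _ "U \<union> uminus ` U"])
qed

lemma continuous_map_psl: "continuous_map (top_of_set (carrier SL2)) PSL2_topology psl"
  by (rule quotient_imp_continuous_map[OF quotient_map_psl])

lemma second_countable_euclidean: "second_countable (euclidean :: 'a::second_countable_topology topology)"
proof -
  obtain B :: "'a set set" where "countable B" "\<And>C. C \<in> B \<Longrightarrow> open C"
    "\<And>S. open S \<Longrightarrow> \<exists>U. U \<subseteq> B \<and> S = \<Union>U"
    using univ_second_countable by blast
  then show ?thesis
    unfolding second_countable_def
    by (intro exI[of _ B]) (simp, metis UnionE Union_upper subsetD)
qed

lemma second_countable_PSL2: "second_countable PSL2_topology"
proof (rule second_countable_open_map_image)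
  show "open_map (top_of_set (carrier SL2)) PSL2_topology psl"
    unfolding open_map_def
    using openin_psl_image by (auto simp: openin_open Int_commute)
  show "second_countable (top_of_set (carrier SL2))"
    by (rule second_countable_subtopology) (rule second_countable_euclidean)
qed (use continuous_map_psl in \<open>auto simp: topspace_PSL2_topology carrier_PSL2\<close>)

lemma continuous_map_PSL2I:
  assumes "continuous_on (carrier SL2) (\<lambda>A. f (psl A))"
  shows "continuous_map PSL2_topology euclidean f"
proof -
  have "continuous_map (top_of_set (carrier SL2)) euclidean (f \<circ> psl)"
    using assms by (simp add: o_def)
  then show ?thesis using continuous_compose_quotient_map[OF quotient_map_psl] by blast
qed

lemma continuous_map_PSL2_PSL2I:
  assumes "continuous_on (carrier SL2) h" "h ` carrier SL2 \<subseteq> carrier SL2"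
    and "\<And>A. A \<in> carrier SL2 \<Longrightarrow> f (psl A) = psl (h A)"
  shows "continuous_map PSL2_topology PSL2_topology f"
proof (rule continuous_compose_quotient_map[OF quotient_map_psl])
  have "continuous_map (top_of_set (carrier SL2)) (top_of_set (carrier SL2)) h"
    using assms by (auto simp: continuous_map_in_subtopology)
  from continuous_map_compose[OF this continuous_map_psl]
  show "continuous_map (top_of_set (carrier SL2)) PSL2_topology (f \<circ> psl)"
    by (rule continuous_map_eq) (use assms in auto)
qed

lemma space_borel_of [simp]: "space (borel_of T) = topspace T"
  by (auto simp: borel_of_def space_measure_of_conv)

lemma sets_borel_of: "sets (borel_of T) = sigma_sets (topspace T) {U. openin T U}"
  unfolding borel_of_def by (subst sets_measure_of) (auto dest: openin_subset)

lemma openin_in_borel_of: "openin T U \<Longrightarrow> U \<in> sets (borel_of T)"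
  by (auto simp: sets_borel_of)

lemma measurable_borel_of:
  assumes "f \<in> space M \<rightarrow> topspace T" "\<And>U. openin T U \<Longrightarrow> f -` U \<inter> space M \<in> sets M"
  shows "f \<in> measurable M (borel_of T)"
  unfolding borel_of_def using assms by (intro measurable_measure_of) (auto dest: openin_subset)

lemma borel_of_continuous_map:
  assumes "continuous_map S T f" shows "f \<in> measurable (borel_of S) (borel_of T)"
  by (rule measurable_borel_of)
    (use assms in \<open>auto simp: continuous_map_def vimage_def Int_def conj_commute intro!: openin_in_borel_of\<close>)

lemma borel_of_continuous_map_euclidean:
  fixes f :: "'a \<Rightarrow> 'b::topological_space"
  assumes "continuous_map T euclidean f" shows "f \<in> borel_measurable (borel_of T)"
  by (rule borel_measurableI)
    (use assms in \<open>auto simp: continuous_map_def vimage_def Int_def conj_commute intro!: openin_in_borel_of\<close>)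

lemma continuous_on_matrix_mult:
  fixes B :: "real^2^2"
  shows "continuous_on S (\<lambda>A. B ** A)" "continuous_on S (\<lambda>A. A ** B)"
  unfolding matrix_matrix_mult_def by (intro continuous_intros continuous_on_vec_lambda)+

lemma borel_of_mult_left:
  assumes "h \<in> carrier PSL2"
  shows "(\<lambda>g. h \<cdot> g) \<in> measurable (borel_of PSL2_topology) (borel_of PSL2_topology)"
proof -
  obtain B where B: "B \<in> carrier SL2" "h = psl B" using assms by (rule PSL2_cases)
  show ?thesis
    by (rule borel_of_continuous_map, rule continuous_map_PSL2_PSL2I[of "\<lambda>A. B ** A"])
      (use B in \<open>auto simp: psl_mult mult_in_SL2 intro!: continuous_on_matrix_mult\<close>)
qed

lemma borel_of_mult_right:
  assumes "h \<in> carrier PSL2"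
  shows "(\<lambda>g. g \<cdot> h) \<in> measurable (borel_of PSL2_topology) (borel_of PSL2_topology)"
proof -
  obtain B where B: "B \<in> carrier SL2" "h = psl B" using assms by (rule PSL2_cases)
  show ?thesis
    by (rule borel_of_continuous_map, rule continuous_map_PSL2_PSL2I[of "\<lambda>A. A ** B"])
      (use B in \<open>auto simp: psl_mult mult_in_SL2 intro!: continuous_on_matrix_mult\<close>)
qed

lemma psl_borel_measurable: "psl \<in> measurable (restrict_space borel (carrier SL2)) (borel_of PSL2_topology)"
proof (rule measurable_borel_of)
  fix U assume "openin PSL2_topology U"
  then have "openin (top_of_set (carrier SL2)) {A \<in> carrier SL2. psl A \<in> U}"
    by (simp add: openin_PSL2_topology)
  then obtain V where "open V" "{A \<in> carrier SL2. psl A \<in> U} = carrier SL2 \<inter> V"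
    by (auto simp: openin_open)
  then show "psl -` U \<inter> space (restrict_space borel (carrier SL2)) \<in> sets (restrict_space borel (carrier SL2))"
    by (auto simp: space_restrict_space sets_restrict_space vimage_def Int_def conj_commute intro!: image_eqI[of _ _ V])
qed (auto simp: space_restrict_space topspace_PSL2_topology psl_in_PSL2)

lemma closed_SL2: "closed (carrier SL2)"
proof -
  have "carrier SL2 = {A. A$1$1 * A$2$2 - A$1$2 * A$2$1 = 1}" using in_SL2 by auto
  also have "closed \<dots>" by (intro closed_Collect_eq continuous_intros)
  finally show ?thesis .
qed

lemma SL2_borel [measurable]: "carrier SL2 \<in> sets borel"
  using closed_SL2 by (rule borel_closed)

text \<open>Functions on \<open>PSL\<^sub>2(\<real>)\<close> are integrated as even functions on the whole space of matrices; the value zero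
off \<open>SL\<^sub>2(\<real>)\<close> keeps them Borel, because \<open>SL\<^sub>2(\<real>)\<close> is closed.\<close>

definition pullback :: "((real^2^2) set \<Rightarrow> ennreal) \<Rightarrow> real^2^2 \<Rightarrow> ennreal" where
  "pullback f A = (if A \<in> carrier SL2 then f (psl A) else 0)"

lemma borel_measurable_pullback:
  assumes "f \<in> borel_measurable (borel_of PSL2_topology)"
  shows "pullback f \<in> borel_measurable borel"
proof -
  have "(\<lambda>A. f (psl A)) \<in> borel_measurable (restrict_space borel (carrier SL2))"
    using measurable_compose[OF psl_borel_measurable assms] .
  then show ?thesis unfolding pullback_def
    by (subst measurable_If_restrict_space_iff) auto
qed

text \<open>Linearity in the entries reduces measurability and continuity of a matrix to that of its entries.\<close>

section \<open>One-dimensional substitutions\<close>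

lemma mat2_sum: "mat2 a b c d = a *\<^sub>R mat2 1 0 0 0 + b *\<^sub>R mat2 0 1 0 0 + c *\<^sub>R mat2 0 0 1 0 + d *\<^sub>R mat2 0 0 0 1"
  by (simp add: matrix_eq_entries)

lemma mat2_measurable [measurable]:
  assumes "a \<in> borel_measurable M" "b \<in> borel_measurable M" "c \<in> borel_measurable M" "d \<in> borel_measurable M"
  shows "(\<lambda>p. mat2 (a p) (b p) (c p) (d p)) \<in> borel_measurable M"
  unfolding mat2_sum[of "a _"] using assms by measurable

text \<open>The matrix in \<open>SL\<^sub>2(\<real>)\<close> with bottom row \<open>(c, d)\<close> that maps \<open>i\<close> to a point with real part \<open>x\<close>. For
\<open>x = 0\<close> its rows are orthogonal, and \<open>x\<close> adds \<open>x\<close> times the bottom row to the top row.\<close>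

definition chart :: "real \<Rightarrow> real \<Rightarrow> real \<Rightarrow> real^2^2" where
  "chart x c d = mat2 (x * c + d / (c\<^sup>2 + d\<^sup>2)) (x * d - c / (c\<^sup>2 + d\<^sup>2)) c d"

lemma chart_measurable [measurable]:
  assumes "x \<in> borel_measurable M" "c \<in> borel_measurable M" "d \<in> borel_measurable M"
  shows "(\<lambda>p. chart (x p) (c p) (d p)) \<in> borel_measurable M"
  unfolding chart_def using assms by measurable

text \<open>The substitution rule on compact intervals passes to increasing unions of such intervals by monotone
convergence; this allows open and unbounded domains.\<close>

lemma nn_integral_substitution_UN:
  fixes f :: "real \<Rightarrow> ennreal" and g g' :: "real \<Rightarrow> real" and a b :: "nat \<Rightarrow> real"
  assumes [measurable]: "f \<in> borel_measurable borel" "g \<in> borel_measurable borel" "g' \<in> borel_measurable borel"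
    and ab: "\<And>n. a n < b n" "decseq a" "incseq b"
    and der: "\<And>n x. x \<in> {a n..b n} \<Longrightarrow> (g has_real_derivative g' x) (at x)"
    and cont: "\<And>n. continuous_on {a n..b n} g'"
    and nn: "\<And>n x. x \<in> {a n..b n} \<Longrightarrow> 0 \<le> g' x"
  shows "(\<integral>\<^sup>+x. f x * indicator (\<Union>n. {g (a n)..g (b n)}) x \<partial>lborel)
       = (\<integral>\<^sup>+x. f (g x) * ennreal (g' x) * indicator (\<Union>n. {a n..b n}) x \<partial>lborel)"
proof -
  have inc: "incseq (\<lambda>n. {a n..b n})"
  proof (rule incseq_SucI)
    fix n
    have "a (Suc n) \<le> a n" "b n \<le> b (Suc n)" using ab(2,3) by (auto simp: incseq_Suc_iff decseq_Suc_iff)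
    then show "{a n..b n} \<subseteq> {a (Suc n)..b (Suc n)}" by auto
  qed
  have mono: "g x \<le> g y" if "x \<in> {a n..b n}" "y \<in> {a n..b n}" "x \<le> y" for n x y
  proof (rule DERIV_nonneg_imp_nondecreasing[OF that(3)])
    fix u assume "x \<le> u" "u \<le> y"
    then have "u \<in> {a n..b n}" using that by auto
    then show "\<exists>z. DERIV g u :> z \<and> 0 \<le> z" using der nn by blast
  qed
  have inc2: "incseq (\<lambda>n. {g (a n)..g (b n)})"
  proof (rule incseq_SucI)
    fix n
    have "a (Suc n) \<le> a n" "b n \<le> b (Suc n)" using ab(2,3) by (auto simp: incseq_Suc_iff decseq_Suc_iff)
    moreover have "a n < b n" by (rule ab)
    ultimately have "g (a (Suc n)) \<le> g (a n)" "g (b n) \<le> g (b (Suc n))"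
      by (auto intro!: mono[of _ "Suc n"])
    then show "{g (a n)..g (b n)} \<subseteq> {g (a (Suc n))..g (b (Suc n))}" by auto
  qed
  have "(\<integral>\<^sup>+x. f x * indicator (\<Union>n. {g (a n)..g (b n)}) x \<partial>lborel)
      = emeasure (density lborel f) (\<Union>n. {g (a n)..g (b n)})"
    by (simp add: emeasure_density)
  also have "\<dots> = (SUP n. emeasure (density lborel f) {g (a n)..g (b n)})"
    by (rule SUP_emeasure_incseq[symmetric]) (use inc2 in auto)
  also have "\<dots> = (SUP n. emeasure (density lborel (\<lambda>x. f (g x) * ennreal (g' x))) {a n..b n})"
  proof (rule SUP_cong[OF refl])
    fix n
    show "emeasure (density lborel f) {g (a n)..g (b n)} =
      emeasure (density lborel (\<lambda>x. f (g x) * ennreal (g' x))) {a n..b n}"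
      using nn_integral_substitution_aux[OF assms(1) _ der[of _ n] cont[of n] nn[of _ n] ab(1)[of n]]
      by (simp add: emeasure_density)
  qed
  also have "\<dots> = emeasure (density lborel (\<lambda>x. f (g x) * ennreal (g' x))) (\<Union>n. {a n..b n})"
    by (rule SUP_emeasure_incseq) (use inc in auto)
  also have "\<dots> = (\<integral>\<^sup>+x. f (g x) * ennreal (g' x) * indicator (\<Union>n. {a n..b n}) x \<partial>lborel)"
    by (simp add: emeasure_density)
  finally show ?thesis .
qed

text \<open>With \<open>n + 2\<close> instead of \<open>n + 1\<close> every interval has positive length, as \<open>nn_integral_substitution_UN\<close>
requires.\<close>

lemma UN_exhaust_negative: "(\<Union>n. {- real (n + 2)..- (1 / real (n + 2))}) = {..<0}"
proof (intro equalityI subsetI)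
  fix c :: real assume c: "c \<in> {..<0}"
  obtain n where n: "max (- c) (- 1 / c) < real n" using reals_Archimedean2 by blast
  have "c \<le> - (1 / real (n + 2))"
  proof -
    have "- 1 / c \<le> real (n + 2)" using n by simp
    then have "- 1 \<ge> real (n + 2) * c" using c by (simp add: field_simps)
    then show ?thesis by (simp add: field_simps)
  qed
  moreover have "- real (n + 2) \<le> c" using n by simp
  ultimately show "c \<in> (\<Union>n. {- real (n + 2)..- (1 / real (n + 2))})" by (intro UN_I[of n]) auto
next
  fix c :: real assume "c \<in> (\<Union>n. {- real (n + 2)..- (1 / real (n + 2))})"
  then obtain n where "c \<le> - (1 / real (n + 2))" by auto
  also have "\<dots> < 0" by simp
  finally show "c \<in> {..<0}" by simp
qed

lemma nn_integral_subst_inverse_square: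
  fixes f :: "real \<Rightarrow> ennreal"
  assumes [measurable]: "f \<in> borel_measurable borel" and s: "0 < s"
  shows "(\<integral>\<^sup>+y. f y * indicator {0<..} y \<partial>lborel)
    = (\<integral>\<^sup>+c. f (s\<^sup>2 / c\<^sup>2) * ennreal (- 2 * s\<^sup>2 / c^3) * indicator {..<0} c \<partial>lborel)"
proof -
  define g where "g c = s\<^sup>2 / c\<^sup>2" for c :: real
  have g1: "g (- real (n + 2)) = s\<^sup>2 / (real (n + 2))\<^sup>2" for n
    by (simp only: g_def power2_minus)
  have g2: "g (- (1 / real (n + 2))) = s\<^sup>2 * (real (n + 2))\<^sup>2" for n
    by (simp only: g_def power2_minus power_one_over divide_inverse inverse_inverse_eq mult_1_left power_inverse)
  have U: "(\<Union>n. {g (- real (n + 2))..g (- (1 / real (n + 2)))}) = {0<..}"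
  proof (intro equalityI subsetI)
    fix y :: real assume y: "y \<in> {0<..}"
    have "s / - sqrt y \<in> {..<0}" using s y by simp
    then obtain n where n: "- real (n + 2) \<le> s / - sqrt y" "s / - sqrt y \<le> - (1 / real (n + 2))"
      unfolding UN_exhaust_negative[symmetric] by auto
    have "s \<le> real (n + 2) * sqrt y" "sqrt y \<le> real (n + 2) * s"
      using n y by (simp_all add: field_simps)
    then have "s\<^sup>2 \<le> (real (n + 2) * sqrt y)\<^sup>2" "(sqrt y)\<^sup>2 \<le> (real (n + 2) * s)\<^sup>2"
      using s y by (intro power_mono; simp)+
    then have "s\<^sup>2 \<le> (real (n + 2))\<^sup>2 * y" "y \<le> (real (n + 2))\<^sup>2 * s\<^sup>2"
      using y by (simp_all add: power_mult_distrib)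
    then have "g (- real (n + 2)) \<le> y" "y \<le> g (- (1 / real (n + 2)))"
      unfolding g1 g2 by (simp_all add: divide_le_eq mult.commute del: of_nat_add)
    then show "y \<in> (\<Union>n. {g (- real (n + 2))..g (- (1 / real (n + 2)))})" by (intro UN_I[of n]) auto
  next
    fix y :: real assume "y \<in> (\<Union>n. {g (- real (n + 2))..g (- (1 / real (n + 2)))})"
    then obtain n where "g (- real (n + 2)) \<le> y" by auto
    moreover have "0 < g (- real (n + 2))" using s unfolding g1 by (simp add: add_pos_nonneg)
    ultimately show "y \<in> {0<..}" by simp
  qed
  have neg: "x < 0" if "x \<in> {- real (n + 2)..- (1 / real (n + 2))}" for x n
    using that UN_exhaust_negative by blast
  have "(\<integral>\<^sup>+y. f y * indicator (\<Union>n. {g (- real (n + 2))..g (- (1 / real (n + 2)))}) y \<partial>lborel)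
    = (\<integral>\<^sup>+c. f (g c) * ennreal (- 2 * s\<^sup>2 / c^3) * indicator (\<Union>n. {- real (n + 2)..- (1 / real (n + 2))}) c \<partial>lborel)"
  proof (rule nn_integral_substitution_UN)
    show "g \<in> borel_measurable borel" unfolding g_def by measurable
    show "- real (n + 2) < - (1 / real (n + 2))" for n
    proof -
      have "1 / real (n + 2) < 1" by simp
      also have "1 < real (n + 2)" by simp
      finally show ?thesis by (simp only: neg_less_iff_less)
    qed
    fix n x assume "x \<in> {- real (n + 2)..- (1 / real (n + 2))}"
    then have x: "x < 0" by (rule neg)
    then show "(g has_real_derivative - 2 * s\<^sup>2 / x ^ 3) (at x)"
      unfolding g_def by (auto intro!: derivative_eq_intros simp: field_simps power2_eq_square power3_eq_cube)
    show "0 \<le> - 2 * s\<^sup>2 / x ^ 3" using x s by (simp add: divide_nonneg_neg)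
  next
    show "continuous_on {- real (n + 2)..- (1 / real (n + 2))} (\<lambda>c. - 2 * s\<^sup>2 / c^3)" for n
      using neg by (intro continuous_intros) force
    show "decseq (\<lambda>n. - real (n + 2))" by (simp add: decseq_def)
    show "incseq (\<lambda>n. - (1 / real (n + 2)))" by (simp add: incseq_def frac_le)
  qed measurable
  then show ?thesis unfolding U UN_exhaust_negative by (simp add: g_def)
qed

lemma nn_integral_subst_arctan:
  fixes f :: "real \<Rightarrow> ennreal"
  assumes [measurable]: "f \<in> borel_measurable borel" and k: "0 < k"
  shows "(\<integral>\<^sup>+\<theta>. f \<theta> * indicator {0<..<pi} \<theta> \<partial>lborel)
    = (\<integral>\<^sup>+t. f (pi / 2 + arctan (t / k)) * ennreal (1 / (k * (1 + (t / k)\<^sup>2))) \<partial>lborel)"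
proof -
  define g where "g t = pi / 2 + arctan (t / k)" for t
  have UN: "(\<Union>n. {- real (Suc n)..real (Suc n)}) = UNIV"
  proof -
    have "x \<in> (\<Union>n. {- real (Suc n)..real (Suc n)})" for x :: real
    proof -
      obtain n where "\<bar>x\<bar> < real n" using reals_Archimedean2 by blast
      then show ?thesis by (intro UN_I[of n]) auto
    qed
    then show ?thesis by auto
  qed
  have U: "(\<Union>n. {g (- real (Suc n))..g (real (Suc n))}) = {0<..<pi}"
  proof (intro equalityI subsetI)
    fix y :: real assume y: "y \<in> {0<..<pi}"
    obtain n where n: "\<bar>k * tan (y - pi / 2)\<bar> < real n" using reals_Archimedean2 by blast
    then have "k * tan (y - pi / 2) \<le> real (Suc n)" "- real (Suc n) \<le> k * tan (y - pi / 2)" by linarith+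
    then have "tan (y - pi / 2) \<le> real (Suc n) / k" "- real (Suc n) / k \<le> tan (y - pi / 2)"
      using k by (simp_all add: pos_le_divide_eq pos_divide_le_eq mult.commute)
    then have "arctan (tan (y - pi / 2)) \<le> arctan (real (Suc n) / k)"
      "arctan (- real (Suc n) / k) \<le> arctan (tan (y - pi / 2))"
      by (simp_all only: arctan_le_iff)
    moreover have "arctan (tan (y - pi / 2)) = y - pi / 2"
      using y by (intro arctan_tan) auto
    ultimately show "y \<in> (\<Union>n. {g (- real (Suc n))..g (real (Suc n))})"
      unfolding g_def by (intro UN_I[of n]) auto
  next
    fix y :: real assume "y \<in> (\<Union>n. {g (- real (Suc n))..g (real (Suc n))})"
    then obtain n where "g (- real (Suc n)) \<le> y" "y \<le> g (real (Suc n))" by auto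
    then show "y \<in> {0<..<pi}"
      using arctan_lbound[of "- real (Suc n) / k"] arctan_ubound[of "real (Suc n) / k"]
      unfolding g_def greaterThanLessThan_iff by linarith
  qed
  have "(\<integral>\<^sup>+\<theta>. f \<theta> * indicator (\<Union>n. {g (- real (Suc n))..g (real (Suc n))}) \<theta> \<partial>lborel)
    = (\<integral>\<^sup>+t. f (g t) * ennreal (1 / (k * (1 + (t / k)\<^sup>2))) * indicator (\<Union>n. {- real (Suc n)..real (Suc n)}) t \<partial>lborel)"
  proof (rule nn_integral_substitution_UN)
    have "continuous_on UNIV arctan" using continuous_on_arctan[OF continuous_on_id] by simp
    then have [measurable]: "arctan \<in> borel_measurable borel" by (rule borel_measurable_continuous_onI)
    show "g \<in> borel_measurable borel" unfolding g_def by measurable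
    have nz: "1 + (x / k)\<^sup>2 \<noteq> 0" for x using zero_le_power2[of "x / k"] by linarith
    show "(g has_real_derivative 1 / (k * (1 + (x / k)\<^sup>2))) (at x)" for x
      unfolding g_def using k by (auto intro!: derivative_eq_intros simp: inverse_eq_divide)
    show "0 \<le> 1 / (k * (1 + (x / k)\<^sup>2))" for x using k by simp
    show "continuous_on {- real (Suc n)..real (Suc n)} (\<lambda>t. 1 / (k * (1 + (t / k)\<^sup>2)))" for n
      using nz k by (intro continuous_intros) auto
    show "decseq (\<lambda>n. - real (Suc n))" "incseq (\<lambda>n. real (Suc n))"
      by (auto simp: decseq_def incseq_def)
    show "- real (Suc n) < real (Suc n)" for n by simp
  qed measurable
  then show ?thesis unfolding U UN by (simp add: g_def)
qed

section \<open>Haar measure in bottom-row coordinates\<close>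

lemma nn_integral_reflect:
  fixes f :: "real \<Rightarrow> ennreal"
  assumes "f \<in> borel_measurable borel"
  shows "(\<integral>\<^sup>+x. f (- x) \<partial>lborel) = (\<integral>\<^sup>+x. f x \<partial>lborel)"
  using nn_integral_real_affine[OF assms, of "-1" 0] by simp

lemma nn_integral_shift:
  fixes f :: "real \<Rightarrow> ennreal"
  assumes "f \<in> borel_measurable borel"
  shows "(\<integral>\<^sup>+x. f (t + x) \<partial>lborel) = (\<integral>\<^sup>+x. f x \<partial>lborel)"
  using nn_integral_real_affine[OF assms, of 1 t] by simp

lemma AE_lborel_nz: "AE x::real in lborel. x \<noteq> 0"
  by (rule AE_lborel_singleton)

lemma nn_integral_swap:
  fixes H :: "real \<Rightarrow> real \<Rightarrow> ennreal"
  assumes [measurable]: "(\<lambda>(x, y). H x y) \<in> borel_measurable (borel \<Otimes>\<^sub>M borel)"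
  shows "(\<integral>\<^sup>+x. \<integral>\<^sup>+y. H x y \<partial>lborel \<partial>lborel) = (\<integral>\<^sup>+y. \<integral>\<^sup>+x. H x y \<partial>lborel \<partial>lborel)"
proof -
  have [measurable]: "(\<lambda>(x, y). H x y) \<in> borel_measurable (lborel \<Otimes>\<^sub>M lborel)"
    using assms by (simp cong: measurable_cong_sets sets_pair_measure_cong)
  show ?thesis by (rule lborel_pair.Fubini'[symmetric]) measurable
qed

lemma measurable_curried:
  assumes "(\<lambda>(x, y). H x y) \<in> borel_measurable (borel \<Otimes>\<^sub>M (borel :: real measure))"
    and "a \<in> borel_measurable M" "b \<in> borel_measurable M"
  shows "(\<lambda>p. H (a p) (b p)) \<in> borel_measurable M"
proof -
  have "(\<lambda>p. (a p, b p)) \<in> measurable M (borel \<Otimes>\<^sub>M (borel :: real measure))" using assms(2,3) by measurable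
  from measurable_compose[OF this assms(1)] show ?thesis by simp
qed

text \<open>The bottom row of \<open>n\<^sub>x a\<^sub>y k\<^sub>\<theta>\<close> is \<open>(c, d) = (- sin \<theta>, cos \<theta>) / \<surd>y\<close>, so \<open>1 / \<surd>y\<close> and \<open>\<theta>\<close> are polar
coordinates of the row and \<open>y\<^sup>-\<^sup>2 dy d\<theta> = 2 dc dd\<close>. The angle runs over \<open>[0, \<pi>)\<close>, which up to a null set
gives the half plane \<open>c < 0\<close>. The change of variables is made in two one-dimensional steps: \<open>y\<close> is replaced
by \<open>c\<close> for fixed \<open>\<theta>\<close>, then \<open>\<theta>\<close> by \<open>d\<close> for fixed \<open>c\<close>.\<close>

lemma nn_integral_polar:
  fixes H :: "real \<Rightarrow> real \<Rightarrow> ennreal"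
  assumes H: "(\<lambda>(c, d). H c d) \<in> borel_measurable (borel \<Otimes>\<^sub>M borel)"
  shows "(\<integral>\<^sup>+y. \<integral>\<^sup>+\<theta>. ennreal (1 / y\<^sup>2) * H (- sin \<theta> / sqrt y) (cos \<theta> / sqrt y)
            * indicator {0<..} y * indicator {0..<pi} \<theta> \<partial>lborel \<partial>lborel)
       = (\<integral>\<^sup>+c. \<integral>\<^sup>+d. 2 * H c d * indicator {..<0} c \<partial>lborel \<partial>lborel)"
proof -
  note [measurable (raw)] = measurable_curried[OF H]
  have "(\<integral>\<^sup>+y. \<integral>\<^sup>+\<theta>. ennreal (1 / y\<^sup>2) * H (- sin \<theta> / sqrt y) (cos \<theta> / sqrt y)
            * indicator {0<..} y * indicator {0..<pi} \<theta> \<partial>lborel \<partial>lborel)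
    = (\<integral>\<^sup>+\<theta>. \<integral>\<^sup>+y. ennreal (1 / y\<^sup>2) * H (- sin \<theta> / sqrt y) (cos \<theta> / sqrt y)
            * indicator {0<..} y * indicator {0..<pi} \<theta> \<partial>lborel \<partial>lborel)"
    by (rule nn_integral_swap) measurable
  also have "\<dots> = (\<integral>\<^sup>+\<theta>. \<integral>\<^sup>+c. ennreal (- 2 * c / (sin \<theta>)\<^sup>2) * H c (- c * cos \<theta> / sin \<theta>)
            * indicator {..<0} c * indicator {0<..<pi} \<theta> \<partial>lborel \<partial>lborel)"
  proof (rule nn_integral_cong_AE, rule AE_mp[OF AE_lborel_nz AE_I2], intro impI)
    fix \<theta> :: real assume nz: "\<theta> \<noteq> 0"
    show "(\<integral>\<^sup>+y. ennreal (1 / y\<^sup>2) * H (- sin \<theta> / sqrt y) (cos \<theta> / sqrt y)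
            * indicator {0<..} y * indicator {0..<pi} \<theta> \<partial>lborel)
      = (\<integral>\<^sup>+c. ennreal (- 2 * c / (sin \<theta>)\<^sup>2) * H c (- c * cos \<theta> / sin \<theta>)
            * indicator {..<0} c * indicator {0<..<pi} \<theta> \<partial>lborel)"
    proof (cases "\<theta> \<in> {0<..<pi}")
      case True
      define s where "s = sin \<theta>"
      have s: "0 < s" using True by (simp add: s_def sin_gt_zero)
      \<comment> \<open>Substitute \<open>y = (sin \<theta>)\<^sup>2 / c\<^sup>2\<close>, which solves \<open>c = - sin \<theta> / \<surd>y\<close>.\<close>
      have "(\<integral>\<^sup>+y. ennreal (1 / y\<^sup>2) * H (- sin \<theta> / sqrt y) (cos \<theta> / sqrt y) * indicator {0<..} y \<partial>lborel)
        = (\<integral>\<^sup>+c. ennreal (1 / (s\<^sup>2 / c\<^sup>2)\<^sup>2) * H (- sin \<theta> / sqrt (s\<^sup>2 / c\<^sup>2)) (cos \<theta> / sqrt (s\<^sup>2 / c\<^sup>2))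
            * ennreal (- 2 * s\<^sup>2 / c^3) * indicator {..<0} c \<partial>lborel)"
        using s by (subst nn_integral_subst_inverse_square[of _ s]) auto
      also have "\<dots> = (\<integral>\<^sup>+c. ennreal (- 2 * c / (sin \<theta>)\<^sup>2) * H c (- c * cos \<theta> / sin \<theta>) * indicator {..<0} c \<partial>lborel)"
      proof (rule nn_integral_cong)
        fix c :: real
        show "ennreal (1 / (s\<^sup>2 / c\<^sup>2)\<^sup>2) * H (- sin \<theta> / sqrt (s\<^sup>2 / c\<^sup>2)) (cos \<theta> / sqrt (s\<^sup>2 / c\<^sup>2))
            * ennreal (- 2 * s\<^sup>2 / c^3) * indicator {..<0} c
          = ennreal (- 2 * c / (sin \<theta>)\<^sup>2) * H c (- c * cos \<theta> / sin \<theta>) * indicator {..<0} c"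
        proof (cases "c < 0")
          case c: True
          have q: "sqrt (s\<^sup>2 / c\<^sup>2) = s / - c" using c s by (simp add: real_sqrt_divide)
          have "- sin \<theta> / sqrt (s\<^sup>2 / c\<^sup>2) = c" using c s unfolding q by (simp add: s_def field_simps)
          moreover have "cos \<theta> / sqrt (s\<^sup>2 / c\<^sup>2) = - c * cos \<theta> / sin \<theta>"
            using c s unfolding q by (simp add: s_def field_simps)
          moreover have "ennreal (1 / (s\<^sup>2 / c\<^sup>2)\<^sup>2) * ennreal (- 2 * s\<^sup>2 / c^3) = ennreal (- 2 * c / (sin \<theta>)\<^sup>2)"
          proof -
            have "1 / (s\<^sup>2 / c\<^sup>2)\<^sup>2 * (- 2 * s\<^sup>2 / c^3) = - 2 * c / s\<^sup>2"
              using c s by (simp add: field_simps power2_eq_square power3_eq_cube)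
            moreover have "ennreal (1 / (s\<^sup>2 / c\<^sup>2)\<^sup>2) * ennreal (- 2 * s\<^sup>2 / c^3)
               = ennreal (1 / (s\<^sup>2 / c\<^sup>2)\<^sup>2 * (- 2 * s\<^sup>2 / c^3))"
              using c s by (intro ennreal_mult[symmetric]) (auto simp: divide_nonneg_neg)
            ultimately show ?thesis by (simp only: s_def)
          qed
          ultimately show ?thesis by (simp add: mult_ac)
        qed simp
      qed
      finally show ?thesis using True by simp
    qed (use nz in simp)
  qed
  also have "\<dots> = (\<integral>\<^sup>+c. \<integral>\<^sup>+\<theta>. ennreal (- 2 * c / (sin \<theta>)\<^sup>2) * H c (- c * cos \<theta> / sin \<theta>)
            * indicator {..<0} c * indicator {0<..<pi} \<theta> \<partial>lborel \<partial>lborel)"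
    by (rule nn_integral_swap) measurable
  also have "\<dots> = (\<integral>\<^sup>+c. \<integral>\<^sup>+d. 2 * H c d * indicator {..<0} c \<partial>lborel \<partial>lborel)"
  proof (rule nn_integral_cong)
    fix c :: real
    show "(\<integral>\<^sup>+\<theta>. ennreal (- 2 * c / (sin \<theta>)\<^sup>2) * H c (- c * cos \<theta> / sin \<theta>)
            * indicator {..<0} c * indicator {0<..<pi} \<theta> \<partial>lborel)
       = (\<integral>\<^sup>+d. 2 * H c d * indicator {..<0} c \<partial>lborel)"
    proof (cases "c < 0")
      case c: True
      \<comment> \<open>Here \<open>\<theta> = \<tau> t\<close> solves \<open>- c cot \<theta> = - t\<close>, so \<open>d = - t\<close>; the sign makes the substitution increasing.\<close>
      define \<tau> where "\<tau> t = pi / 2 + arctan (t / - c)" for t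
      have "(\<integral>\<^sup>+\<theta>. ennreal (- 2 * c / (sin \<theta>)\<^sup>2) * H c (- c * cos \<theta> / sin \<theta>) * indicator {0<..<pi} \<theta> \<partial>lborel)
        = (\<integral>\<^sup>+t. ennreal (- 2 * c / (sin (\<tau> t))\<^sup>2) * H c (- c * cos (\<tau> t) / sin (\<tau> t))
            * ennreal (1 / (- c * (1 + (t / - c)\<^sup>2))) \<partial>lborel)"
        unfolding \<tau>_def using c by (intro nn_integral_subst_arctan) auto
      also have "\<dots> = (\<integral>\<^sup>+t. 2 * H c (- t) \<partial>lborel)"
      proof (rule nn_integral_cong)
        fix t :: real
        have sc: "sin (\<tau> t) = cos (arctan (t / - c))" "cos (\<tau> t) = - sin (arctan (t / - c))"
          unfolding \<tau>_def by (simp_all add: sin_add cos_add)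
        have nz: "cos (arctan (t / - c)) \<noteq> 0" by simp
        have "- c * cos (\<tau> t) / sin (\<tau> t) = c * tan (arctan (t / - c))"
          unfolding sc by (simp add: tan_def)
        also have "\<dots> = - t" using c by (simp add: tan_arctan)
        finally have 1: "- c * cos (\<tau> t) / sin (\<tau> t) = - t" .
        have p: "0 < 1 + (t / - c)\<^sup>2" by (simp add: add_pos_nonneg)
        have s2: "(sin (\<tau> t))\<^sup>2 = 1 / (1 + (t / - c)\<^sup>2)"
          unfolding sc cos_arctan using p by (simp add: power_divide del: minus_divide_right)
        have "ennreal (- 2 * c / (sin (\<tau> t))\<^sup>2) * ennreal (1 / (- c * (1 + (t / - c)\<^sup>2)))
            = ennreal (- 2 * c / (sin (\<tau> t))\<^sup>2 * (1 / (- c * (1 + (t / - c)\<^sup>2))))"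
          using c p by (intro ennreal_mult[symmetric]) (auto simp: s2 mult_nonpos_nonneg intro!: divide_nonneg_nonneg mult_nonneg_nonneg)
        also have "- 2 * c / (sin (\<tau> t))\<^sup>2 * (1 / (- c * (1 + (t / - c)\<^sup>2))) = 2"
        proof -
          define r where "r = 1 + (t / - c)\<^sup>2"
          have "r \<noteq> 0" using p by (simp add: r_def)
          then show ?thesis using c unfolding s2 r_def[symmetric] by (simp add: field_simps)
        qed
        finally have 2: "ennreal (- 2 * c / (sin (\<tau> t))\<^sup>2) * ennreal (1 / (- c * (1 + (t / - c)\<^sup>2))) = 2" by simp
        have "ennreal (- 2 * c / (sin (\<tau> t))\<^sup>2) * H c (- c * cos (\<tau> t) / sin (\<tau> t)) * ennreal (1 / (- c * (1 + (t / - c)\<^sup>2)))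
          = (ennreal (- 2 * c / (sin (\<tau> t))\<^sup>2) * ennreal (1 / (- c * (1 + (t / - c)\<^sup>2)))) * H c (- t)"
          unfolding 1 by (simp only: mult_ac)
        then show "ennreal (- 2 * c / (sin (\<tau> t))\<^sup>2) * H c (- c * cos (\<tau> t) / sin (\<tau> t)) * ennreal (1 / (- c * (1 + (t / - c)\<^sup>2)))
          = 2 * H c (- t)" unfolding 2 .
      qed
      also have "\<dots> = (\<integral>\<^sup>+d. 2 * H c d \<partial>lborel)"
        by (rule nn_integral_reflect) measurable
      finally show ?thesis using c by simp
    qed simp
  qed
  finally show ?thesis .
qed

text \<open>For even functions and up to the factor \<open>1 / \<pi>\<close>, this is integration against the Haar measure.\<close>

definition chart_integral :: "(real^2^2 \<Rightarrow> ennreal) \<Rightarrow> ennreal" where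
  "chart_integral F = (\<integral>\<^sup>+c. \<integral>\<^sup>+d. \<integral>\<^sup>+x. F (chart x c d) \<partial>lborel \<partial>lborel \<partial>lborel)"

lemma chart_in_SL2: "c \<noteq> 0 \<or> d \<noteq> 0 \<Longrightarrow> chart x c d \<in> carrier SL2"
proof -
  assume "c \<noteq> 0 \<or> d \<noteq> 0"
  then have r: "c\<^sup>2 + d\<^sup>2 \<noteq> 0" by (metis sum_power2_eq_zero_iff)
  have "(x * c + d / (c\<^sup>2 + d\<^sup>2)) * d - (x * d - c / (c\<^sup>2 + d\<^sup>2)) * c = (c\<^sup>2 + d\<^sup>2) / (c\<^sup>2 + d\<^sup>2)"
    unfolding add_divide_distrib by (simp add: algebra_simps power2_eq_square)
  then show ?thesis using r by (simp add: chart_def mat2_in_SL2)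
qed

lemma nak_chart:
  assumes "0 < y" shows "nak x y \<theta> = psl (chart x (- sin \<theta> / sqrt y) (cos \<theta> / sqrt y))"
proof -
  have r: "(- sin \<theta> / sqrt y)\<^sup>2 + (cos \<theta> / sqrt y)\<^sup>2 = 1 / y"
    using assms by (simp add: power_divide add_divide_distrib[symmetric])
  have "z / sqrt y / (1 / y) = sqrt y * z" for z
  proof -
    have "z / sqrt y / (1 / y) = z * (y / sqrt y)" by simp
    also have "y / sqrt y = sqrt y" using assms by (simp add: real_div_sqrt)
    finally show ?thesis by (simp only: mult.commute)
  qed
  from this[of "cos \<theta>"] this[of "- sin \<theta>"] show ?thesis
    unfolding nak_mat2 chart_def r by (simp add: mult.commute add.commute)
qed

lemma chart_uminus: "chart x (- c) (- d) = - chart x c d"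
  by (simp add: chart_def matrix_eq_entries)

lemma chart_integral_swap_x:
  assumes [measurable]: "F \<in> borel_measurable borel" "k \<in> borel_measurable borel"
  shows "(\<integral>\<^sup>+x. \<integral>\<^sup>+c. \<integral>\<^sup>+d. F (chart x c d) * k c \<partial>lborel \<partial>lborel \<partial>lborel)
    = (\<integral>\<^sup>+c. \<integral>\<^sup>+d. \<integral>\<^sup>+x. F (chart x c d) * k c \<partial>lborel \<partial>lborel \<partial>lborel)"
proof -
  have "(\<integral>\<^sup>+x. \<integral>\<^sup>+c. \<integral>\<^sup>+d. F (chart x c d) * k c \<partial>lborel \<partial>lborel \<partial>lborel)
    = (\<integral>\<^sup>+c. \<integral>\<^sup>+x. \<integral>\<^sup>+d. F (chart x c d) * k c \<partial>lborel \<partial>lborel \<partial>lborel)"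
    by (rule nn_integral_swap) measurable
  also have "\<dots> = (\<integral>\<^sup>+c. \<integral>\<^sup>+d. \<integral>\<^sup>+x. F (chart x c d) * k c \<partial>lborel \<partial>lborel \<partial>lborel)"
    by (intro nn_integral_cong nn_integral_swap) measurable
  finally show ?thesis .
qed

text \<open>For even integrands the half planes \<open>c < 0\<close> and \<open>c > 0\<close> contribute equally.\<close>

lemma chart_integral_half:
  assumes [measurable]: "F \<in> borel_measurable borel" and even: "\<And>A. F (- A) = F A"
  shows "chart_integral F = 2 * (\<integral>\<^sup>+c. \<integral>\<^sup>+d. \<integral>\<^sup>+x. F (chart x c d) * indicator {..<0} c \<partial>lborel \<partial>lborel \<partial>lborel)"
proof -
  define K where "K c = (\<integral>\<^sup>+d. \<integral>\<^sup>+x. F (chart x c d) \<partial>lborel \<partial>lborel)" for c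
  have [measurable]: "K \<in> borel_measurable borel" unfolding K_def by measurable
  have ev: "K (- c) = K c" for c
  proof -
    have "K (- c) = (\<integral>\<^sup>+d. \<integral>\<^sup>+x. F (chart x (- c) (- d)) \<partial>lborel \<partial>lborel)"
      unfolding K_def by (rule nn_integral_reflect[symmetric]) measurable
    then show ?thesis by (simp add: chart_uminus even K_def)
  qed
  have "chart_integral F = (\<integral>\<^sup>+c. K c \<partial>lborel)" by (simp add: chart_integral_def K_def)
  also have "\<dots> = (\<integral>\<^sup>+c. K c * indicator {..<0} c + K c * indicator {0<..} c \<partial>lborel)"
    by (rule nn_integral_cong_AE, rule AE_mp[OF AE_lborel_nz AE_I2]) (auto simp: indicator_def)
  also have "\<dots> = (\<integral>\<^sup>+c. K c * indicator {..<0} c \<partial>lborel) + (\<integral>\<^sup>+c. K c * indicator {0<..} c \<partial>lborel)"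
    by (rule nn_integral_add) measurable
  also have "(\<integral>\<^sup>+c. K c * indicator {0<..} c \<partial>lborel) = (\<integral>\<^sup>+c. K (- c) * indicator {0<..} (- c) \<partial>lborel)"
    by (rule nn_integral_reflect[symmetric]) measurable
  also have "\<dots> = (\<integral>\<^sup>+c. K c * indicator {..<0} c \<partial>lborel)"
    unfolding ev by (intro nn_integral_cong) (auto simp: indicator_def)
  finally show ?thesis
    by (simp add: mult_2 K_def nn_integral_multc)
qed

lemma pullback_uminus: "pullback f (- A) = pullback f A"
  by (simp add: pullback_def uminus_in_SL2 psl_uminus)

lemma sets_haar: "sets haar = sets (borel_of PSL2_topology)"
  and space_haar: "space haar = carrier PSL2"
  by (simp_all add: haar_def topspace_PSL2_topology)

lemma nak_domain_borel [measurable]: "nak_domain \<in> sets borel"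
proof -
  have "nak_domain = {p \<in> space (borel \<Otimes>\<^sub>M (borel :: real measure) \<Otimes>\<^sub>M (borel :: real measure)). 0 < fst (snd p) \<and> 0 \<le> snd (snd p) \<and> snd (snd p) < pi}"
    by (auto simp: nak_domain_def space_pair_measure)
  also have "\<dots> \<in> sets (borel \<Otimes>\<^sub>M borel \<Otimes>\<^sub>M borel)" by measurable
  finally show ?thesis unfolding borel_prod .
qed

lemma nak_measurable: "(\<lambda>(x, y, \<theta>). nak x y \<theta>) \<in> measurable (restrict_space lborel nak_domain) (borel_of PSL2_topology)"
proof -
  let ?m = "\<lambda>(x, y, \<theta>). chart x (- sin \<theta> / sqrt y) (cos \<theta> / sqrt y)"
  have "?m \<in> borel_measurable (borel \<Otimes>\<^sub>M borel \<Otimes>\<^sub>M borel)" by measurable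
  then have "?m \<in> borel_measurable borel" by (simp add: borel_prod)
  then have "?m \<in> borel_measurable (restrict_space lborel nak_domain)"
    by (intro measurable_restrict_space1) simp
  moreover have "chart x (- sin \<theta> / sqrt y) (cos \<theta> / sqrt y) \<in> carrier SL2" if "0 < y" for x y \<theta>
  proof (rule chart_in_SL2)
    show "- sin \<theta> / sqrt y \<noteq> 0 \<or> cos \<theta> / sqrt y \<noteq> 0"
      using that sin_zero_abs_cos_one[of \<theta>] by auto
  qed
  ultimately have "?m \<in> measurable (restrict_space lborel nak_domain) (restrict_space borel (carrier SL2))"
    by (intro measurable_restrict_space2) (auto simp: space_restrict_space nak_domain_def)
  from measurable_compose[OF this psl_borel_measurable]
  show ?thesis
    by (rule measurable_cong[THEN iffD1, rotated]) (auto simp: space_restrict_space nak_domain_def nak_chart)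
qed

lemma nn_integral_lborel3:
  fixes H :: "real \<Rightarrow> real \<Rightarrow> real \<Rightarrow> ennreal"
  assumes H: "(\<lambda>(x, y, z). H x y z) \<in> borel_measurable (borel \<Otimes>\<^sub>M borel \<Otimes>\<^sub>M borel)"
  shows "(\<integral>\<^sup>+p. (case p of (x, y, z) \<Rightarrow> H x y z) \<partial>lborel) = (\<integral>\<^sup>+x. \<integral>\<^sup>+y. \<integral>\<^sup>+z. H x y z \<partial>lborel \<partial>lborel \<partial>lborel)"
proof -
  have "(\<integral>\<^sup>+p. (case p of (x, y, z) \<Rightarrow> H x y z) \<partial>lborel)
    = (\<integral>\<^sup>+p. (case p of (x, y, z) \<Rightarrow> H x y z) \<partial>(lborel \<Otimes>\<^sub>M (lborel :: (real \<times> real) measure)))"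
    by (simp add: lborel_prod)
  also have "\<dots> = (\<integral>\<^sup>+x. \<integral>\<^sup>+q. (case (x, q) of (x, y, z) \<Rightarrow> H x y z) \<partial>lborel \<partial>lborel)"
    by (rule lborel.nn_integral_fst[symmetric])
      (use H in \<open>simp add: borel_prod lborel_prod\<close>)
  also have "\<dots> = (\<integral>\<^sup>+x. \<integral>\<^sup>+y. \<integral>\<^sup>+z. H x y z \<partial>lborel \<partial>lborel \<partial>lborel)"
  proof (rule nn_integral_cong)
    fix x :: real
    have "(\<lambda>q. (x, q)) \<in> measurable (borel \<Otimes>\<^sub>M borel) (borel \<Otimes>\<^sub>M borel \<Otimes>\<^sub>M (borel :: real measure))" by measurable
    from measurable_compose[OF this H]
    have m: "(\<lambda>(y, z). H x y z) \<in> borel_measurable (lborel \<Otimes>\<^sub>M lborel)"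
      by (simp cong: measurable_cong_sets sets_pair_measure_cong)
    have "(\<integral>\<^sup>+q. (case q of (y, z) \<Rightarrow> H x y z) \<partial>lborel) = (\<integral>\<^sup>+y. \<integral>\<^sup>+z. (case (y, z) of (y, z) \<Rightarrow> H x y z) \<partial>lborel \<partial>lborel)"
      unfolding lborel_prod[symmetric] by (rule lborel.nn_integral_fst[symmetric, OF m])
    then show "(\<integral>\<^sup>+q. (case (x, q) of (x, y, z) \<Rightarrow> H x y z) \<partial>lborel) = (\<integral>\<^sup>+y. \<integral>\<^sup>+z. H x y z \<partial>lborel \<partial>lborel)"
      by simp
  qed
  finally show ?thesis .
qed

text \<open>Only the half plane \<open>c < 0\<close> occurs in \<open>nn_integral_polar\<close>. Integrating over the whole plane
instead makes right translations act linearly, and it absorbs the factor 2.\<close>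

lemma nn_integral_haar:
  assumes f: "f \<in> borel_measurable (borel_of PSL2_topology)"
  shows "(\<integral>\<^sup>+g. f g \<partial>haar) = ennreal (1 / pi) * chart_integral (pullback f)"
proof -
  note [measurable] = borel_measurable_pullback[OF f]
  let ?R = "restrict_space lborel nak_domain"
  let ?w = "\<lambda>(x :: real, y :: real, \<theta> :: real). ennreal (1 / (pi * y\<^sup>2))"
  let ?n = "\<lambda>(x, y, \<theta>). nak x y \<theta>"
  have "?w \<in> borel_measurable (borel \<Otimes>\<^sub>M borel \<Otimes>\<^sub>M borel)" by measurable
  then have "?w \<in> borel_measurable lborel" by (simp add: borel_prod)
  then have w: "?w \<in> borel_measurable ?R" by (rule measurable_restrict_space1)
  have "(\<integral>\<^sup>+g. f g \<partial>haar) = (\<integral>\<^sup>+p. f (?n p) \<partial>density ?R ?w)"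
    unfolding haar_def using nak_measurable f
    by (subst nn_integral_distr) (auto simp: measurable_cong_sets[OF sets_density refl])
  also have "\<dots> = (\<integral>\<^sup>+p. ?w p * f (?n p) \<partial>?R)"
    using w measurable_compose[OF nak_measurable f] by (rule nn_integral_density)
  also have "\<dots> = (\<integral>\<^sup>+p. (?w p * f (?n p)) * indicator nak_domain p \<partial>lborel)"
    by (rule nn_integral_restrict_space) simp
  also have "\<dots> = (\<integral>\<^sup>+p. (case p of (x, y, \<theta>) \<Rightarrow> ennreal (1 / pi) * (ennreal (1 / y\<^sup>2)
       * pullback f (chart x (- sin \<theta> / sqrt y) (cos \<theta> / sqrt y)) * indicator {0<..} y * indicator {0..<pi} \<theta>)) \<partial>lborel)"
  proof (rule nn_integral_cong)
    fix p :: "real \<times> real \<times> real"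
    obtain x y \<theta> where p: "p = (x, y, \<theta>)" by (cases p) auto
    have "f (nak x y \<theta>) = pullback f (chart x (- sin \<theta> / sqrt y) (cos \<theta> / sqrt y))" if "0 < y"
      using nak_in_PSL2[OF that, of x \<theta>] by (simp add: nak_chart[OF that] pullback_def psl_in_PSL2_iff)
    moreover have "ennreal (1 / (pi * y\<^sup>2)) = ennreal (1 / pi) * ennreal (1 / y\<^sup>2)"
      by (simp add: ennreal_mult[symmetric])
    ultimately show "(?w p * f (?n p)) * indicator nak_domain p = (case p of (x, y, \<theta>) \<Rightarrow> ennreal (1 / pi) * (ennreal (1 / y\<^sup>2)
       * pullback f (chart x (- sin \<theta> / sqrt y) (cos \<theta> / sqrt y)) * indicator {0<..} y * indicator {0..<pi} \<theta>))"
      by (auto simp: p nak_domain_def indicator_def mult_ac)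
  qed
  also have "\<dots> = (\<integral>\<^sup>+x. \<integral>\<^sup>+y. \<integral>\<^sup>+\<theta>. ennreal (1 / pi) * (ennreal (1 / y\<^sup>2)
       * pullback f (chart x (- sin \<theta> / sqrt y) (cos \<theta> / sqrt y)) * indicator {0<..} y * indicator {0..<pi} \<theta>) \<partial>lborel \<partial>lborel \<partial>lborel)"
    by (rule nn_integral_lborel3) measurable
  also have "\<dots> = (\<integral>\<^sup>+x. ennreal (1 / pi) * (\<integral>\<^sup>+y. \<integral>\<^sup>+\<theta>. ennreal (1 / y\<^sup>2)
       * pullback f (chart x (- sin \<theta> / sqrt y) (cos \<theta> / sqrt y)) * indicator {0<..} y * indicator {0..<pi} \<theta> \<partial>lborel \<partial>lborel) \<partial>lborel)"
    by (simp add: nn_integral_cmult)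
  also have "\<dots> = (\<integral>\<^sup>+x. ennreal (1 / pi) * (\<integral>\<^sup>+c. \<integral>\<^sup>+d. 2 * pullback f (chart x c d) * indicator {..<0} c \<partial>lborel \<partial>lborel) \<partial>lborel)"
    by (intro nn_integral_cong arg_cong2[where f = "(*)"] refl nn_integral_polar) measurable
  also have "\<dots> = ennreal (1 / pi) * (2 * (\<integral>\<^sup>+x. \<integral>\<^sup>+c. \<integral>\<^sup>+d. pullback f (chart x c d) * indicator {..<0} c \<partial>lborel \<partial>lborel \<partial>lborel))"
    by (simp add: nn_integral_cmult mult.assoc)
  also have "(\<integral>\<^sup>+x. \<integral>\<^sup>+c. \<integral>\<^sup>+d. pullback f (chart x c d) * indicator {..<0} c \<partial>lborel \<partial>lborel \<partial>lborel)
    = (\<integral>\<^sup>+c. \<integral>\<^sup>+d. \<integral>\<^sup>+x. pullback f (chart x c d) * indicator {..<0} c \<partial>lborel \<partial>lborel \<partial>lborel)"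
    by (rule chart_integral_swap_x) measurable
  also have "2 * \<dots> = chart_integral (pullback f)"
    by (rule chart_integral_half[symmetric]) (simp_all add: pullback_uminus)
  finally show ?thesis .
qed

section \<open>Bi-invariance of the Haar measure\<close>

definition unip_upper :: "real \<Rightarrow> real^2^2" where "unip_upper s = mat2 1 s 0 1"
definition unip_lower :: "real \<Rightarrow> real^2^2" where "unip_lower s = mat2 1 0 s 1"

text \<open>If the lower left entry \<open>c\<close> is not zero, a matrix is a product of three shears; if it is zero, then
multiplying by a lower shear makes it nonzero.\<close>

lemma SL2_generated:
  assumes A: "A \<in> carrier SL2"
    and mult: "\<And>A B. P A \<Longrightarrow> P B \<Longrightarrow> P (A ** B)"
    and unip_upper: "\<And>s. P (unip_upper s)" and unip_lower: "\<And>s. P (unip_lower s)"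
  shows "P A"
proof -
  have *: "P B" if B: "B \<in> carrier SL2" and nz: "B$2$1 \<noteq> 0" for B
  proof -
    obtain a b c d where Be: "B = mat2 a b c d" using mat2_eta[of B] by metis
    have c: "c \<noteq> 0" and "a * d - b * c = 1" using B nz by (simp_all add: Be mat2_in_SL2)
    then have "b = (a * d - 1) / c" by (simp add: field_simps)
    moreover have "mat2 a ((a * d - 1) / c) c d = unip_upper ((a - 1) / c) ** unip_lower c ** unip_upper ((d - 1) / c)"
      using c by (simp add: unip_upper_def unip_lower_def mat2_mult matrix_eq_entries field_simps)
    ultimately have "B = unip_upper ((a - 1) / c) ** unip_lower c ** unip_upper ((d - 1) / c)" by (simp add: Be)
    then show ?thesis by (simp add: mult unip_upper unip_lower)
  qed
  show ?thesis
  proof (cases "A$2$1 = 0")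
    case False
    then show ?thesis using A * by blast
  next
    case True
    have "A ** unip_lower 1 \<in> carrier SL2" "(A ** unip_lower 1)$2$1 \<noteq> 0"
      using A True by (auto intro!: mult_in_SL2 simp: unip_lower_def mat2_in_SL2 mult_nth in_SL2 algebra_simps)
    then have "P (A ** unip_lower 1 ** unip_lower (- 1))" by (intro mult unip_lower *)
    moreover have "unip_lower 1 ** unip_lower (- 1) = mat 1"
      by (simp add: unip_lower_def mat2_mult matrix_eq_entries one_nth)
    ultimately show ?thesis by (simp flip: matrix_mul_assoc)
  qed
qed

lemma unip_upper_chart: "unip_upper t ** chart x c d = chart (x + t) c d"
  by (simp add: unip_upper_def chart_def mat2_mult matrix_eq_entries algebra_simps)

lemma chart_surj:
  assumes "A \<in> carrier SL2"
  shows "chart ((A$1$1 * A$2$1 + A$1$2 * A$2$2) / ((A$2$1)\<^sup>2 + (A$2$2)\<^sup>2)) (A$2$1) (A$2$2) = A"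
proof -
  obtain a b c d where Ae: "A = mat2 a b c d" using mat2_eta[of A] by metis
  have dt: "a * d - b * c = 1" using assms by (simp add: Ae mat2_in_SL2)
  define r where "r = c\<^sup>2 + d\<^sup>2"
  have r: "r \<noteq> 0" using bottom_row_nonzero[OF assms] by (auto simp: r_def Ae sum_power2_gt_zero_iff)
  have "(a * c + b * d) * c + d = a * r" "(a * c + b * d) * d - c = b * r"
    unfolding r_def using dt by algebra+
  then have "(a * c + b * d) / r * c + d / r = a" "(a * c + b * d) / r * d - c / r = b"
    using r by (simp_all add: field_simps)
  then show ?thesis by (simp add: Ae chart_def matrix_eq_entries r_def)
qed

text \<open>The \<open>x\<close>-coordinate of \<open>chart 0 c d ** h\<close>.\<close>

definition chart_shift :: "real^2^2 \<Rightarrow> real \<Rightarrow> real \<Rightarrow> real" where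
  "chart_shift h c d = (let A = chart 0 c d ** h in
     (A$1$1 * A$2$1 + A$1$2 * A$2$2) / ((A$2$1)\<^sup>2 + (A$2$2)\<^sup>2))"

text \<open>Right multiplication acts linearly on the bottom row and translates \<open>x\<close> by an amount that depends only
on that row, because \<open>x\<close> itself enters through left multiplication by an upper shear.\<close>

lemma chart_mult:
  assumes "c \<noteq> 0 \<or> d \<noteq> 0" "h \<in> carrier SL2"
  shows "chart x c d ** h = chart (chart_shift h c d + x) (c * h$1$1 + d * h$2$1) (c * h$1$2 + d * h$2$2)"
proof -
  have "chart 0 c d ** h \<in> carrier SL2" using assms by (intro mult_in_SL2 chart_in_SL2)
  from chart_surj[OF this]
  have "chart 0 c d ** h = chart (chart_shift h c d) (c * h$1$1 + d * h$2$1) (c * h$1$2 + d * h$2$2)"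
    unfolding chart_shift_def Let_def by (simp add: mult_nth(3,4) chart_def)
  then have "unip_upper x ** (chart 0 c d ** h) = chart (chart_shift h c d + x) (c * h$1$1 + d * h$2$1) (c * h$1$2 + d * h$2$2)"
    by (simp only: unip_upper_chart)
  then show ?thesis by (simp add: matrix_mul_assoc unip_upper_chart)
qed

lemma unip_upper_in_SL2: "unip_upper s \<in> carrier SL2" and unip_lower_in_SL2: "unip_lower s \<in> carrier SL2"
  by (simp_all add: unip_upper_def unip_lower_def mat2_in_SL2)

text \<open>For fixed \<open>c\<close> a shear translates \<open>d\<close>, and for fixed \<open>(c, d)\<close> it translates \<open>x\<close>.\<close>

lemma chart_integral_right_upper:
  assumes [measurable]: "F \<in> borel_measurable borel"
  shows "chart_integral (\<lambda>A. F (A ** unip_upper s)) = chart_integral F"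
  unfolding chart_integral_def
proof (rule nn_integral_cong_AE, rule AE_mp[OF AE_lborel_nz AE_I2], intro impI)
  fix c :: real assume c: "c \<noteq> 0"
  have "(\<integral>\<^sup>+d. \<integral>\<^sup>+x. F (chart x c d ** unip_upper s) \<partial>lborel \<partial>lborel)
    = (\<integral>\<^sup>+d. \<integral>\<^sup>+x. F (chart (chart_shift (unip_upper s) c d + x) c (c * s + d)) \<partial>lborel \<partial>lborel)"
    using c by (simp add: chart_mult unip_upper_in_SL2) (simp add: unip_upper_def)
  also have "\<dots> = (\<integral>\<^sup>+d. \<integral>\<^sup>+x. F (chart x c (c * s + d)) \<partial>lborel \<partial>lborel)"
    by (intro nn_integral_cong nn_integral_shift) measurable
  also have "\<dots> = (\<integral>\<^sup>+d. \<integral>\<^sup>+x. F (chart x c d) \<partial>lborel \<partial>lborel)"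
    by (rule nn_integral_shift) measurable
  finally show "(\<integral>\<^sup>+d. \<integral>\<^sup>+x. F (chart x c d ** unip_upper s) \<partial>lborel \<partial>lborel)
    = (\<integral>\<^sup>+d. \<integral>\<^sup>+x. F (chart x c d) \<partial>lborel \<partial>lborel)" .
qed

lemma matrix_mult_measurable:
  fixes B :: "real^2^2"
  shows "(\<lambda>A :: real^2^2. A ** B) \<in> borel_measurable borel" "(\<lambda>A :: real^2^2. B ** A) \<in> borel_measurable borel"
  by (simp_all add: borel_measurable_continuous_onI continuous_on_matrix_mult)

lemma chart_integral_right_lower:
  assumes F [measurable]: "F \<in> borel_measurable borel"
  shows "chart_integral (\<lambda>A. F (A ** unip_lower s)) = chart_integral F"
proof -
  note [measurable] = measurable_compose[OF matrix_mult_measurable(1) F]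
  have swap: "chart_integral F' = (\<integral>\<^sup>+d. \<integral>\<^sup>+c. \<integral>\<^sup>+x. F' (chart x c d) \<partial>lborel \<partial>lborel \<partial>lborel)"
    if [measurable]: "F' \<in> borel_measurable borel" for F'
    unfolding chart_integral_def by (rule nn_integral_swap) measurable
  have "(\<integral>\<^sup>+d. \<integral>\<^sup>+c. \<integral>\<^sup>+x. F (chart x c d ** unip_lower s) \<partial>lborel \<partial>lborel \<partial>lborel)
    = (\<integral>\<^sup>+d. \<integral>\<^sup>+c. \<integral>\<^sup>+x. F (chart x c d) \<partial>lborel \<partial>lborel \<partial>lborel)"
  proof (rule nn_integral_cong_AE, rule AE_mp[OF AE_lborel_nz AE_I2], intro impI)
    fix d :: real assume d: "d \<noteq> 0"
    have "(\<integral>\<^sup>+c. \<integral>\<^sup>+x. F (chart x c d ** unip_lower s) \<partial>lborel \<partial>lborel)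
      = (\<integral>\<^sup>+c. \<integral>\<^sup>+x. F (chart (chart_shift (unip_lower s) c d + x) (d * s + c) d) \<partial>lborel \<partial>lborel)"
      using d by (simp add: chart_mult unip_lower_in_SL2) (simp add: unip_lower_def add.commute)
    also have "\<dots> = (\<integral>\<^sup>+c. \<integral>\<^sup>+x. F (chart x (d * s + c) d) \<partial>lborel \<partial>lborel)"
      by (intro nn_integral_cong nn_integral_shift) measurable
    also have "\<dots> = (\<integral>\<^sup>+c. \<integral>\<^sup>+x. F (chart x c d) \<partial>lborel \<partial>lborel)"
      by (rule nn_integral_shift) measurable
    finally show "(\<integral>\<^sup>+c. \<integral>\<^sup>+x. F (chart x c d ** unip_lower s) \<partial>lborel \<partial>lborel)
      = (\<integral>\<^sup>+c. \<integral>\<^sup>+x. F (chart x c d) \<partial>lborel \<partial>lborel)" .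
  qed
  then show ?thesis by (simp add: swap)
qed

lemma chart_integral_right:
  assumes h: "h \<in> carrier SL2" and F: "F \<in> borel_measurable borel"
  shows "chart_integral (\<lambda>A. F (A ** h)) = chart_integral F"
proof -
  have "\<forall>F. F \<in> borel_measurable borel \<longrightarrow> chart_integral (\<lambda>A. F (A ** h)) = chart_integral F"
  proof (rule SL2_generated[OF h])
    fix A B
    assume A: "\<forall>F. F \<in> borel_measurable borel \<longrightarrow> chart_integral (\<lambda>C. F (C ** A)) = chart_integral F"
      and B: "\<forall>F. F \<in> borel_measurable borel \<longrightarrow> chart_integral (\<lambda>C. F (C ** B)) = chart_integral F"
    show "\<forall>F. F \<in> borel_measurable borel \<longrightarrow> chart_integral (\<lambda>C. F (C ** (A ** B))) = chart_integral F"
    proof (intro allI impI)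
      fix F :: "real^2^2 \<Rightarrow> ennreal" assume F: "F \<in> borel_measurable borel"
      have "chart_integral (\<lambda>C. F (C ** A ** B)) = chart_integral (\<lambda>C. F (C ** B))"
        using A measurable_compose[OF matrix_mult_measurable(1)[of B] F] by blast
      then show "chart_integral (\<lambda>C. F (C ** (A ** B))) = chart_integral F" using B F by (simp add: matrix_mul_assoc)
    qed
  qed (simp_all add: chart_integral_right_upper chart_integral_right_lower)
  then show ?thesis using F by blast
qed

lemma chart_integral_left_upper:
  assumes [measurable]: "F \<in> borel_measurable borel"
  shows "chart_integral (\<lambda>A. F (unip_upper s ** A)) = chart_integral F"
  unfolding chart_integral_def unip_upper_chart add.commute[of _ s]
  by (intro nn_integral_cong nn_integral_shift) measurable

text \<open>For fixed bottom row with \<open>c \<noteq> 0\<close> the entry \<open>a\<close> is an affine function of \<open>x\<close> with slope \<open>c\<close>. The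
coordinates \<open>(a, c, d)\<close> treat the two rows alike, which is what the Weyl element needs.\<close>

lemma chart_integral_entries:
  assumes [measurable]: "F \<in> borel_measurable borel"
  shows "chart_integral F = (\<integral>\<^sup>+c. \<integral>\<^sup>+d. \<integral>\<^sup>+a. ennreal (1 / \<bar>c\<bar>) * F (mat2 a ((a * d - 1) / c) c d) \<partial>lborel \<partial>lborel \<partial>lborel)"
  unfolding chart_integral_def
proof (rule nn_integral_cong_AE, rule AE_mp[OF AE_lborel_nz AE_I2], intro impI, rule nn_integral_cong)
  fix c d :: real assume c: "c \<noteq> 0"
  define r where "r = c\<^sup>2 + d\<^sup>2"
  have r: "r \<noteq> 0" unfolding r_def using c by (metis sum_power2_eq_zero_iff)
  have "(\<integral>\<^sup>+a. ennreal (1 / \<bar>c\<bar>) * F (mat2 a ((a * d - 1) / c) c d) \<partial>lborel)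
    = ennreal \<bar>c\<bar> * (\<integral>\<^sup>+x. ennreal (1 / \<bar>c\<bar>) * F (mat2 (d / r + c * x) (((d / r + c * x) * d - 1) / c) c d) \<partial>lborel)"
    using c by (rule nn_integral_real_affine[rotated]) measurable
  also have "\<dots> = (\<integral>\<^sup>+x. ennreal \<bar>c\<bar> * (ennreal (1 / \<bar>c\<bar>) * F (mat2 (d / r + c * x) (((d / r + c * x) * d - 1) / c) c d)) \<partial>lborel)"
    by (rule nn_integral_cmult[symmetric]) measurable
  also have "\<dots> = (\<integral>\<^sup>+x. F (chart x c d) \<partial>lborel)"
  proof (rule nn_integral_cong)
    fix x
    have "ennreal \<bar>c\<bar> * ennreal (1 / \<bar>c\<bar>) = 1" using c by (simp flip: ennreal_mult)
    moreover have "((d / r + c * x) * d - 1) / c = x * d - c / r"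
    proof -
      have "((d / r + c * x) * d - 1) * r = (x * d - c / r) * c * r"
        using r by (simp add: algebra_simps r_def[symmetric]) (simp add: r_def power2_eq_square algebra_simps)
      then show ?thesis using r c by (simp add: field_simps)
    qed
    ultimately show "ennreal \<bar>c\<bar> * (ennreal (1 / \<bar>c\<bar>) * F (mat2 (d / r + c * x) (((d / r + c * x) * d - 1) / c) c d)) = F (chart x c d)"
      by (simp add: chart_def r_def add.commute mult.commute flip: mult.assoc)
  qed
  finally show "(\<integral>\<^sup>+x. F (chart x c d) \<partial>lborel) = (\<integral>\<^sup>+a. ennreal (1 / \<bar>c\<bar>) * F (mat2 a ((a * d - 1) / c) c d) \<partial>lborel)" ..
qed

definition weyl :: "real^2^2" where "weyl = mat2 0 (- 1) 1 0"

text \<open>The Weyl element exchanges the rows, so up to signs it turns the coordinates \<open>(a, c, d)\<close> with density \<open>1 / |c|\<close>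
into \<open>(a, b, c)\<close> with density \<open>1 / |a|\<close>. These agree, since \<open>d = (1 + b c) / a\<close> is affine in \<open>b\<close> with slope
\<open>c / a\<close>.\<close>

lemma chart_integral_left_weyl:
  assumes F [measurable]: "F \<in> borel_measurable borel"
  shows "chart_integral (\<lambda>A. F (weyl ** A)) = chart_integral F"
proof -
  have wm: "weyl ** mat2 a b c d = mat2 (- c) (- d) a b" for a b c d
    by (simp add: weyl_def mat2_mult)
  have "chart_integral (\<lambda>A. F (weyl ** A))
    = (\<integral>\<^sup>+c. \<integral>\<^sup>+d. \<integral>\<^sup>+a. ennreal (1 / \<bar>c\<bar>) * F (mat2 (- c) (- d) a ((a * d - 1) / c)) \<partial>lborel \<partial>lborel \<partial>lborel)"
    using measurable_compose[OF matrix_mult_measurable(2) F] by (subst chart_integral_entries) (simp_all add: wm)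
  also have "\<dots> = (\<integral>\<^sup>+c. \<integral>\<^sup>+a. \<integral>\<^sup>+d. ennreal (1 / \<bar>c\<bar>) * F (mat2 (- c) (- d) a ((a * d - 1) / c)) \<partial>lborel \<partial>lborel \<partial>lborel)"
    by (intro nn_integral_cong nn_integral_swap) measurable
  also have "\<dots> = (\<integral>\<^sup>+c. \<integral>\<^sup>+a. \<integral>\<^sup>+b. ennreal (1 / \<bar>a\<bar>) * F (mat2 (- c) (((- c) * b - 1) / a) a b) \<partial>lborel \<partial>lborel \<partial>lborel)"
  proof (rule nn_integral_cong_AE, rule AE_mp[OF AE_lborel_nz AE_I2], intro impI,
      rule nn_integral_cong_AE, rule AE_mp[OF AE_lborel_nz AE_I2], intro impI)
    fix c a :: real assume nz: "c \<noteq> 0" "a \<noteq> 0"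
    have "(\<integral>\<^sup>+d. ennreal (1 / \<bar>c\<bar>) * F (mat2 (- c) (- d) a ((a * d - 1) / c)) \<partial>lborel)
      = ennreal \<bar>c / a\<bar> * (\<integral>\<^sup>+b. ennreal (1 / \<bar>c\<bar>) * F (mat2 (- c) (- (1 / a + c / a * b)) a ((a * (1 / a + c / a * b) - 1) / c)) \<partial>lborel)"
      using nz by (intro nn_integral_real_affine) auto
    also have "\<dots> = (\<integral>\<^sup>+b. ennreal \<bar>c / a\<bar> * (ennreal (1 / \<bar>c\<bar>) * F (mat2 (- c) (- (1 / a + c / a * b)) a ((a * (1 / a + c / a * b) - 1) / c))) \<partial>lborel)"
      by (rule nn_integral_cmult[symmetric]) measurable
    also have "\<dots> = (\<integral>\<^sup>+b. ennreal (1 / \<bar>a\<bar>) * F (mat2 (- c) (((- c) * b - 1) / a) a b) \<partial>lborel)"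
    proof (rule nn_integral_cong)
      fix b
      have "ennreal \<bar>c / a\<bar> * ennreal (1 / \<bar>c\<bar>) = ennreal (1 / \<bar>a\<bar>)"
        using nz by (simp flip: ennreal_mult)
      moreover have "- (1 / a + c / a * b) = ((- c) * b - 1) / a" "(a * (1 / a + c / a * b) - 1) / c = b"
        using nz by (simp_all add: field_simps)
      ultimately show "ennreal \<bar>c / a\<bar> * (ennreal (1 / \<bar>c\<bar>) * F (mat2 (- c) (- (1 / a + c / a * b)) a ((a * (1 / a + c / a * b) - 1) / c)))
        = ennreal (1 / \<bar>a\<bar>) * F (mat2 (- c) (((- c) * b - 1) / a) a b)"
        by (simp flip: mult.assoc)
    qed
    finally show "(\<integral>\<^sup>+d. ennreal (1 / \<bar>c\<bar>) * F (mat2 (- c) (- d) a ((a * d - 1) / c)) \<partial>lborel)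
      = (\<integral>\<^sup>+b. ennreal (1 / \<bar>a\<bar>) * F (mat2 (- c) (((- c) * b - 1) / a) a b) \<partial>lborel)" .
  qed
  also have "\<dots> = (\<integral>\<^sup>+c. \<integral>\<^sup>+a. \<integral>\<^sup>+b. ennreal (1 / \<bar>a\<bar>) * F (mat2 c ((c * b - 1) / a) a b) \<partial>lborel \<partial>lborel \<partial>lborel)"
    by (rule nn_integral_reflect) measurable
  also have "\<dots> = (\<integral>\<^sup>+a. \<integral>\<^sup>+c. \<integral>\<^sup>+b. ennreal (1 / \<bar>a\<bar>) * F (mat2 c ((c * b - 1) / a) a b) \<partial>lborel \<partial>lborel \<partial>lborel)"
    by (rule nn_integral_swap) measurable
  also have "\<dots> = (\<integral>\<^sup>+a. \<integral>\<^sup>+b. \<integral>\<^sup>+c. ennreal (1 / \<bar>a\<bar>) * F (mat2 c ((c * b - 1) / a) a b) \<partial>lborel \<partial>lborel \<partial>lborel)"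
    by (intro nn_integral_cong nn_integral_swap) measurable
  also have "\<dots> = chart_integral F" by (rule chart_integral_entries[OF F, symmetric])
  finally show ?thesis .
qed

text \<open>Lower shears are conjugates of upper shears by the Weyl element, so the two cases above generate
everything.\<close>

lemma chart_integral_left:
  assumes h: "h \<in> carrier SL2" and F: "F \<in> borel_measurable borel"
  shows "chart_integral (\<lambda>A. F (h ** A)) = chart_integral F"
proof -
  define P where "P h \<longleftrightarrow> (\<forall>F. F \<in> borel_measurable borel \<longrightarrow> chart_integral (\<lambda>A. F (h ** A)) = chart_integral F)" for h
  have mult: "P (A ** B)" if A: "P A" and B: "P B" for A B
    unfolding P_def
  proof (intro allI impI)
    fix F :: "real^2^2 \<Rightarrow> ennreal" assume F: "F \<in> borel_measurable borel"
    have "chart_integral (\<lambda>C. F (A ** (B ** C))) = chart_integral (\<lambda>C. F (A ** C))"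
      using B measurable_compose[OF matrix_mult_measurable(2)[of A] F] unfolding P_def by blast
    then show "chart_integral (\<lambda>C. F (A ** B ** C)) = chart_integral F" using A F by (simp add: matrix_mul_assoc P_def)
  qed
  have up: "P (unip_upper s)" for s by (simp add: P_def chart_integral_left_upper)
  have w: "P weyl" by (simp add: P_def chart_integral_left_weyl)
  have low: "P (unip_lower s)" for s
  proof -
    have "unip_lower s = weyl ** unip_upper (- s) ** (weyl ** weyl ** weyl)"
      by (simp add: unip_lower_def unip_upper_def weyl_def mat2_mult)
    then show ?thesis by (simp add: mult up w)
  qed
  have "P h" by (rule SL2_generated[OF h mult up low])
  then show ?thesis using F by (simp add: P_def)
qed

lemma nn_integral_haar_right:
  assumes h: "h \<in> carrier PSL2" and f: "f \<in> borel_measurable (borel_of PSL2_topology)"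
  shows "(\<integral>\<^sup>+g. f (g \<cdot> h) \<partial>haar) = (\<integral>\<^sup>+g. f g \<partial>haar)"
proof -
  obtain B where B: "B \<in> carrier SL2" "h = psl B" using h by (rule PSL2_cases)
  have "pullback (\<lambda>g. f (g \<cdot> h)) A = pullback f (A ** B)" for A
    using B(1) by (auto simp: pullback_def B(2) psl_mult SL2_def det_mul)
  then have "chart_integral (pullback (\<lambda>g. f (g \<cdot> h))) = chart_integral (pullback f)"
    using chart_integral_right[OF B(1) borel_measurable_pullback[OF f]] by presburger
  then show ?thesis
    using nn_integral_haar[OF f] nn_integral_haar[OF measurable_compose[OF borel_of_mult_right[OF h] f]] by simp
qed

lemma nn_integral_haar_left:
  assumes h: "h \<in> carrier PSL2" and f: "f \<in> borel_measurable (borel_of PSL2_topology)"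
  shows "(\<integral>\<^sup>+g. f (h \<cdot> g) \<partial>haar) = (\<integral>\<^sup>+g. f g \<partial>haar)"
proof -
  obtain B where B: "B \<in> carrier SL2" "h = psl B" using h by (rule PSL2_cases)
  have "pullback (\<lambda>g. f (h \<cdot> g)) A = pullback f (B ** A)" for A
    using B(1) by (auto simp: pullback_def B(2) psl_mult SL2_def det_mul)
  then have "chart_integral (pullback (\<lambda>g. f (h \<cdot> g))) = chart_integral (pullback f)"
    using chart_integral_left[OF B(1) borel_measurable_pullback[OF f]] by presburger
  then show ?thesis
    using nn_integral_haar[OF f] nn_integral_haar[OF measurable_compose[OF borel_of_mult_left[OF h] f]] by simp
qed

section \<open>Fundamental domains and unfolding\<close>

lemma discrete_subgroup_countable:
  assumes "discrete_subgroup \<Gamma>" shows "countable \<Gamma>"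
  using second_countable_subtopology[OF second_countable_PSL2, of \<Gamma>] assms
  by (simp add: discrete_subgroup_def second_countable_discrete_topology)

lemma continuous_on_mat2:
  assumes "continuous_on S a" "continuous_on S b" "continuous_on S c" "continuous_on S d"
  shows "continuous_on S (\<lambda>p. mat2 (a p) (b p) (c p) (d p))"
  unfolding mat2_sum[of "a _"] using assms by (intro continuous_intros)

text \<open>If \<open>A\<close> and \<open>B\<close> are close to \<open>A0\<close>, then \<open>A B\<^sup>-\<^sup>1\<close> is close to the identity, where the only element
of \<open>\<Gamma>\<close> is the identity.\<close>

lemma discrete_subgroup_wandering:
  assumes "discrete_subgroup \<Gamma>" and A0: "A0 \<in> carrier SL2"
  obtains U where "openin PSL2_topology U" "psl A0 \<in> U"
    "\<And>\<gamma> g. \<gamma> \<in> \<Gamma> \<Longrightarrow> g \<in> U \<Longrightarrow> \<gamma> \<cdot> g \<in> U \<Longrightarrow> \<gamma> = \<one>\<^bsub>PSL2\<^esub>"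
proof -
  have sub: "subgroup \<Gamma> PSL2" and disc: "subtopology PSL2_topology \<Gamma> = discrete_topology \<Gamma>"
    using assms by (auto simp: discrete_subgroup_def)
  have "openin (subtopology PSL2_topology \<Gamma>) {\<one>\<^bsub>PSL2\<^esub>}"
    unfolding disc using subgroup.one_closed[OF sub] by simp
  then obtain W where W: "openin PSL2_topology W" "{\<one>\<^bsub>PSL2\<^esub>} = W \<inter> \<Gamma>"
    by (auto simp: openin_subtopology)
  obtain V where V: "open V" "{A \<in> carrier SL2. psl A \<in> W} = carrier SL2 \<inter> V"
    using W(1) by (auto simp: openin_PSL2_topology openin_open)
  define q where "q p = fst p ** adj2 (snd p)" for p :: "(real^2^2) \<times> (real^2^2)"
  have "continuous_on UNIV q"
    unfolding q_def adj2_def matrix_matrix_mult_def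
    by (intro continuous_on_vec_lambda continuous_intros continuous_on_mat2)
  then have "open (q -` V)" using V(1) by (simp add: open_vimage)
  moreover have "(A0, A0) \<in> q -` V"
  proof -
    have "psl (mat 1) \<in> W" using W(2) one_PSL2 by auto
    then have "mat 1 \<in> V" using V(2) one_in_SL2 by blast
    then show ?thesis using A0 by (simp add: q_def adj2_mult)
  qed
  ultimately obtain S T where ST: "open S" "open T" "A0 \<in> S" "A0 \<in> T" "S \<times> T \<subseteq> q -` V"
    by (auto elim!: open_prod_elim)
  show ?thesis
  proof (rule that[of "psl ` ((S \<inter> T) \<inter> carrier SL2)"])
    show "openin PSL2_topology (psl ` ((S \<inter> T) \<inter> carrier SL2))"
      using ST by (intro openin_psl_image open_Int)
    show "psl A0 \<in> psl ` ((S \<inter> T) \<inter> carrier SL2)" using ST A0 by blast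
    fix \<gamma> g assume g: "\<gamma> \<in> \<Gamma>" "g \<in> psl ` ((S \<inter> T) \<inter> carrier SL2)" "\<gamma> \<cdot> g \<in> psl ` ((S \<inter> T) \<inter> carrier SL2)"
    then obtain A B where AB: "A \<in> S" "A \<in> carrier SL2" "\<gamma> \<cdot> g = psl A" "B \<in> T" "B \<in> carrier SL2" "g = psl B"
      by auto
    have "\<gamma> \<in> carrier PSL2" using subgroup.mem_carrier[OF sub g(1)] .
    then have "\<gamma> = psl A \<cdot> inv\<^bsub>PSL2\<^esub> psl B"
      using AB by (metis PSL2.inv_solve_right PSL2.m_closed psl_in_PSL2)
    also have "\<dots> = psl (q (A, B))" using AB by (simp add: inv_psl psl_mult q_def)
    finally have e: "\<gamma> = psl (q (A, B))" .
    have "q (A, B) \<in> V" using ST(5) AB by auto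
    moreover have "q (A, B) \<in> carrier SL2" using AB by (simp add: q_def mult_in_SL2 adj2_in_SL2)
    ultimately have "\<gamma> \<in> W" using V(2) e by blast
    then show "\<gamma> = \<one>\<^bsub>PSL2\<^esub>" using W(2) g(1) by blast
  qed
qed

text \<open>Countably many wandering open sets \<open>v n\<close> cover the group. An orbit is represented by its unique point
in \<open>v n\<close> for the first \<open>n\<close> such that \<open>v n\<close> meets the orbit; \<open>S n\<close> is the union of the orbits that meet
\<open>v n\<close>.\<close>

lemma fundamental_domain_exists:
  assumes disc: "discrete_subgroup \<Gamma>"
  obtains D where "fundamental_domain \<Gamma> D"
proof -
  have sub: "subgroup \<Gamma> PSL2" using disc by (simp add: discrete_subgroup_def)
  have car: "\<gamma> \<in> carrier PSL2" if "\<gamma> \<in> \<Gamma>" for \<gamma> using subgroup.mem_carrier[OF sub that] .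
  obtain \<B> where \<B>: "countable \<B>" "\<And>V. V \<in> \<B> \<Longrightarrow> openin PSL2_topology V"
    "\<And>U g. openin PSL2_topology U \<Longrightarrow> g \<in> U \<Longrightarrow> \<exists>V\<in>\<B>. g \<in> V \<and> V \<subseteq> U"
    using second_countable_PSL2 unfolding second_countable_def by metis
  define \<V> where "\<V> = {V \<in> \<B>. \<forall>\<gamma>\<in>\<Gamma>. \<forall>g\<in>V. \<gamma> \<cdot> g \<in> V \<longrightarrow> \<gamma> = \<one>\<^bsub>PSL2\<^esub>}"
  have cover: "\<exists>V\<in>\<V>. g \<in> V" if gc: "g \<in> carrier PSL2" for g
  proof -
    obtain A0 where A0: "A0 \<in> carrier SL2" "g = psl A0" using gc by (rule PSL2_cases)
    obtain U where U: "openin PSL2_topology U" "psl A0 \<in> U"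
      "\<And>\<gamma> g. \<gamma> \<in> \<Gamma> \<Longrightarrow> g \<in> U \<Longrightarrow> \<gamma> \<cdot> g \<in> U \<Longrightarrow> \<gamma> = \<one>\<^bsub>PSL2\<^esub>"
      using discrete_subgroup_wandering[OF disc A0(1)] by blast
    obtain V where "V \<in> \<B>" "g \<in> V" "V \<subseteq> U" using \<B>(3)[OF U(1,2)] A0 by blast
    then show ?thesis using U(3) unfolding \<V>_def by blast
  qed
  have "countable \<V>" using \<B>(1) by (simp add: \<V>_def)
  moreover have "\<V> \<noteq> {}" using cover[OF PSL2.one_closed] by blast
  ultimately obtain v :: "nat \<Rightarrow> _" where v: "range v = \<V>"
    by (metis range_from_nat_into)
  have vV: "v n \<in> \<V>" for n using v rangeI[of v n] by simp
  have v1: "openin PSL2_topology (v n)" for n using vV[of n] \<B>(2) by (simp add: \<V>_def)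
  have v2: "\<gamma> = \<one>\<^bsub>PSL2\<^esub>" if "\<gamma> \<in> \<Gamma>" "g \<in> v n" "\<gamma> \<cdot> g \<in> v n" for \<gamma> g n
using vV[of n] that unfolding \<V>_def by blast
  define S where "S n = (\<Union>\<gamma>\<in>\<Gamma>. {g \<in> carrier PSL2. \<gamma> \<cdot> g \<in> v n})" for n
  define D where "D = (\<Union>n. v n - (\<Union>m<n. S m))"
  have S_inv: "g \<in> S n" if S: "\<gamma> \<in> \<Gamma>" "g \<in> carrier PSL2" "\<gamma> \<cdot> g \<in> S n" for \<gamma> g n
  proof -
    obtain \<beta> where "\<beta> \<in> \<Gamma>" "\<beta> \<cdot> (\<gamma> \<cdot> g) \<in> v n" using S by (auto simp: S_def)
    then have "\<beta> \<cdot> \<gamma> \<in> \<Gamma>" "\<beta> \<cdot> \<gamma> \<cdot> g \<in> v n"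
      using that car by (auto simp: PSL2.m_assoc subgroup.m_closed[OF sub])
    then show ?thesis using that unfolding S_def by blast
  qed
  have S_inv': "\<gamma> \<cdot> g \<in> S n" if "\<gamma> \<in> \<Gamma>" "g \<in> S n" for \<gamma> g n
  proof (rule S_inv[of "inv\<^bsub>PSL2\<^esub> \<gamma>"])
    have g: "g \<in> carrier PSL2" using that by (auto simp: S_def)
    then show "\<gamma> \<cdot> g \<in> carrier PSL2" using car that by simp
    show "inv\<^bsub>PSL2\<^esub> \<gamma> \<in> \<Gamma>" using that subgroup.m_inv_closed[OF sub] by blast
    show "inv\<^bsub>PSL2\<^esub> \<gamma> \<cdot> (\<gamma> \<cdot> g) \<in> S n"
      using car that g by (simp add: PSL2.m_assoc[symmetric])
  qed
  have vS: "v n \<subseteq> S n" for n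
  proof
    fix g assume g: "g \<in> v n"
    then have "g \<in> carrier PSL2" using openin_subset[OF v1] topspace_PSL2_topology by blast
    then show "g \<in> S n" using g subgroup.one_closed[OF sub] unfolding S_def by (intro UN_I[of "\<one>\<^bsub>PSL2\<^esub>"]) auto
  qed
  have "fundamental_domain \<Gamma> D"
    unfolding fundamental_domain_def
  proof (intro conjI ballI)
    have "{g \<in> carrier PSL2. \<gamma> \<cdot> g \<in> v n} \<in> sets haar" if "\<gamma> \<in> \<Gamma>" for \<gamma> n
      using measurable_sets[OF borel_of_mult_left[OF car[OF that]] openin_in_borel_of[OF v1[of n]]]
      by (simp add: sets_haar topspace_PSL2_topology vimage_def Int_def conj_commute)
    then have "S n \<in> sets haar" for n
      unfolding S_def using discrete_subgroup_countable[OF disc] by (intro sets.countable_UN') auto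
    moreover have "v n \<in> sets haar" for n using openin_in_borel_of[OF v1] by (simp add: sets_haar)
    ultimately show "D \<in> sets haar" unfolding D_def by auto
  next
    fix g assume g: "g \<in> carrier PSL2"
    obtain n0 where "g \<in> v n0" using cover[OF g] v by blast
    then have ex: "\<exists>n. g \<in> S n" using vS by blast
    define n where "n = (LEAST n. g \<in> S n)"
    have n: "g \<in> S n" "\<And>m. m < n \<Longrightarrow> g \<notin> S m"
      unfolding n_def using LeastI_ex[OF ex] not_less_Least by blast+
    have only: "\<gamma> \<cdot> g \<in> v n" if \<gamma>: "\<gamma> \<in> \<Gamma>" "\<gamma> \<cdot> g \<in> D" for \<gamma>
    proof -
      obtain k where k: "\<gamma> \<cdot> g \<in> v k" "\<And>m. m < k \<Longrightarrow> \<gamma> \<cdot> g \<notin> S m"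
        using \<gamma> unfolding D_def by blast
      have "g \<in> S k" using k(1) vS S_inv[OF \<gamma>(1) g] by blast
      then have "\<not> k < n" using n by blast
      moreover have "\<not> n < k" using k(2) S_inv'[OF \<gamma>(1) n(1)] by blast
      ultimately show ?thesis using k(1) by simp
    qed
    obtain \<gamma> where \<gamma>: "\<gamma> \<in> \<Gamma>" "\<gamma> \<cdot> g \<in> v n" using n(1) by (auto simp: S_def)
    have "\<gamma> \<cdot> g \<in> D" using \<gamma> n(2) S_inv[OF \<gamma>(1) g] unfolding D_def by blast
    moreover have "\<beta> = \<gamma>" if \<beta>: "\<beta> \<in> \<Gamma>" "\<beta> \<cdot> g \<in> D" for \<beta>
    proof -
      have c: "\<beta> \<in> carrier PSL2" "\<gamma> \<in> carrier PSL2" using \<beta> \<gamma> car by auto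
      have "(\<beta> \<cdot> inv\<^bsub>PSL2\<^esub> \<gamma>) \<cdot> (\<gamma> \<cdot> g) = \<beta> \<cdot> g"
        using c g by (simp add: PSL2.m_assoc) (simp flip: PSL2.m_assoc)
      then have "\<beta> \<cdot> inv\<^bsub>PSL2\<^esub> \<gamma> = \<one>\<^bsub>PSL2\<^esub>"
        using v2[of "\<beta> \<cdot> inv\<^bsub>PSL2\<^esub> \<gamma>" "\<gamma> \<cdot> g" n] only[OF \<beta>] \<gamma> \<beta>
        by (simp add: subgroup.m_closed[OF sub] subgroup.m_inv_closed[OF sub])
      then show ?thesis using c by (metis PSL2.inv_solve_right' PSL2.l_one PSL2.one_closed)
    qed
    ultimately show "\<exists>!\<gamma>. \<gamma> \<in> \<Gamma> \<and> \<gamma> \<cdot> g \<in> D" using \<gamma>(1) by blast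
  qed
  then show ?thesis by (rule that)
qed

definition left_invariant :: "(real^2^2) set set \<Rightarrow> ((real^2^2) set \<Rightarrow> 'b) \<Rightarrow> bool" where
  "left_invariant \<Gamma> f \<longleftrightarrow> (\<forall>\<gamma>\<in>\<Gamma>. \<forall>g\<in>carrier PSL2. f (\<gamma> \<cdot> g) = f g)"

text \<open>Insert the second partition of unity, exchange sum and integral, and translate the \<open>\<gamma>\<close>-th term by the
inverse of \<open>\<gamma>\<close>; this exchanges the roles of the two weights. For weights that are indicators it says that
integrals of invariant functions do not depend on the fundamental domain.\<close>

lemma unfolding_weights:
  fixes f w w' :: "(real^2^2) set \<Rightarrow> ennreal"
  assumes disc: "discrete_subgroup \<Gamma>"
    and m: "f \<in> borel_measurable (borel_of PSL2_topology)"
      "w \<in> borel_measurable (borel_of PSL2_topology)" "w' \<in> borel_measurable (borel_of PSL2_topology)"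
    and inv: "left_invariant \<Gamma> f"
    and one: "\<And>g. g \<in> carrier PSL2 \<Longrightarrow> (\<integral>\<^sup>+\<gamma>. w (\<gamma> \<cdot> g) \<partial>count_space \<Gamma>) = 1"
      "\<And>g. g \<in> carrier PSL2 \<Longrightarrow> (\<integral>\<^sup>+\<gamma>. w' (\<gamma> \<cdot> g) \<partial>count_space \<Gamma>) = 1"
  shows "(\<integral>\<^sup>+g. w g * f g \<partial>haar) = (\<integral>\<^sup>+g. w' g * f g \<partial>haar)"
proof -
  have sub: "subgroup \<Gamma> PSL2" using disc by (simp add: discrete_subgroup_def)
  have car: "\<gamma> \<in> carrier PSL2" if "\<gamma> \<in> \<Gamma>" for \<gamma> using subgroup.mem_carrier[OF sub that] .
  have icar: "inv\<^bsub>PSL2\<^esub> \<gamma> \<in> \<Gamma>" if "\<gamma> \<in> \<Gamma>" for \<gamma> using subgroup.m_inv_closed[OF sub that] .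
  have [measurable_cong]: "sets haar = sets (borel_of PSL2_topology)" by (rule sets_haar)
  note m[measurable]
  have tr[measurable]: "(\<lambda>g. k (\<gamma> \<cdot> g)) \<in> borel_measurable (borel_of PSL2_topology)"
    if "\<gamma> \<in> \<Gamma>" "k \<in> borel_measurable (borel_of PSL2_topology)" for \<gamma> and k :: "_ \<Rightarrow> ennreal"
    using measurable_compose[OF borel_of_mult_left[OF car[OF that(1)]] that(2)] .
  have C: "countable \<Gamma>" by (rule discrete_subgroup_countable[OF disc])
  have "(\<integral>\<^sup>+g. w g * f g \<partial>haar) = (\<integral>\<^sup>+g. \<integral>\<^sup>+\<gamma>. w g * f g * w' (\<gamma> \<cdot> g) \<partial>count_space \<Gamma> \<partial>haar)"
    by (rule nn_integral_cong) (simp add: nn_integral_cmult space_haar one)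
  also have "\<dots> = (\<integral>\<^sup>+\<gamma>. \<integral>\<^sup>+g. w g * f g * w' (\<gamma> \<cdot> g) \<partial>haar \<partial>count_space \<Gamma>)"
    using C tr by (intro nn_integral_count_space_nn_integral) auto
  also have "\<dots> = (\<integral>\<^sup>+\<gamma>. \<integral>\<^sup>+g. w (inv\<^bsub>PSL2\<^esub> \<gamma> \<cdot> g) * f g * w' g \<partial>haar \<partial>count_space \<Gamma>)"
  proof (rule nn_integral_cong)
    fix \<gamma> assume "\<gamma> \<in> space (count_space \<Gamma>)"
    then have \<gamma>: "\<gamma> \<in> \<Gamma>" by simp
    have "(\<integral>\<^sup>+g. w g * f g * w' (\<gamma> \<cdot> g) \<partial>haar)
      = (\<integral>\<^sup>+g. w (inv\<^bsub>PSL2\<^esub> \<gamma> \<cdot> g) * f (inv\<^bsub>PSL2\<^esub> \<gamma> \<cdot> g) * w' (\<gamma> \<cdot> (inv\<^bsub>PSL2\<^esub> \<gamma> \<cdot> g)) \<partial>haar)"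
      using car[OF icar[OF \<gamma>]] \<gamma> tr by (intro nn_integral_haar_left[symmetric]) auto
    also have "\<dots> = (\<integral>\<^sup>+g. w (inv\<^bsub>PSL2\<^esub> \<gamma> \<cdot> g) * f g * w' g \<partial>haar)"
      using car[OF \<gamma>] icar[OF \<gamma>] inv
      by (intro nn_integral_cong) (simp add: space_haar left_invariant_def flip: PSL2.m_assoc)
    finally show "(\<integral>\<^sup>+g. w g * f g * w' (\<gamma> \<cdot> g) \<partial>haar)
      = (\<integral>\<^sup>+g. w (inv\<^bsub>PSL2\<^esub> \<gamma> \<cdot> g) * f g * w' g \<partial>haar)" .
  qed
  also have "\<dots> = (\<integral>\<^sup>+\<gamma>. \<integral>\<^sup>+g. w (\<gamma> \<cdot> g) * f g * w' g \<partial>haar \<partial>count_space \<Gamma>)"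
  proof (rule nn_integral_bij_count_space)
    show "bij_betw (\<lambda>\<gamma>. inv\<^bsub>PSL2\<^esub> \<gamma>) \<Gamma> \<Gamma>"
      using icar car by (intro bij_betw_byWitness[where f' = "\<lambda>\<gamma>. inv\<^bsub>PSL2\<^esub> \<gamma>"]) auto
  qed
  also have "\<dots> = (\<integral>\<^sup>+g. \<integral>\<^sup>+\<gamma>. w (\<gamma> \<cdot> g) * f g * w' g \<partial>count_space \<Gamma> \<partial>haar)"
    using C tr by (intro nn_integral_count_space_nn_integral[symmetric]) auto
  also have "\<dots> = (\<integral>\<^sup>+g. w' g * f g \<partial>haar)"
  proof (rule nn_integral_cong)
    fix g assume "g \<in> space haar"
    then have g: "g \<in> carrier PSL2" by (simp add: space_haar)
    have "(\<integral>\<^sup>+\<gamma>. w (\<gamma> \<cdot> g) * f g * w' g \<partial>count_space \<Gamma>) = (\<integral>\<^sup>+\<gamma>. w (\<gamma> \<cdot> g) * (f g * w' g) \<partial>count_space \<Gamma>)"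
      by (simp only: mult.assoc)
    also have "\<dots> = w' g * f g" by (subst nn_integral_multc) (simp_all add: one(1)[OF g] mult.commute)
    finally show "(\<integral>\<^sup>+\<gamma>. w (\<gamma> \<cdot> g) * f g * w' g \<partial>count_space \<Gamma>) = w' g * f g" .
  qed
  finally show ?thesis .
qed

lemma fundamental_domain_weight:
  assumes "fundamental_domain \<Gamma> D" "g \<in> carrier PSL2"
  shows "(\<integral>\<^sup>+\<gamma>. indicator D (\<gamma> \<cdot> g) \<partial>count_space \<Gamma>) = (1::ennreal)"
proof -
  have "\<exists>!\<gamma>. \<gamma> \<in> \<Gamma> \<and> \<gamma> \<cdot> g \<in> D"
    using assms by (simp add: fundamental_domain_def)
  then obtain \<gamma>0 where g0: "\<gamma>0 \<in> \<Gamma>" "\<gamma>0 \<cdot> g \<in> D" "\<And>\<gamma>. \<gamma> \<in> \<Gamma> \<Longrightarrow> \<gamma> \<cdot> g \<in> D \<Longrightarrow> \<gamma> = \<gamma>0"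
    by blast
  have "(\<integral>\<^sup>+\<gamma>. indicator D (\<gamma> \<cdot> g) \<partial>count_space \<Gamma>) = (\<integral>\<^sup>+\<gamma>. indicator {\<gamma>0} \<gamma> \<partial>count_space \<Gamma>)"
  proof (rule nn_integral_cong)
    fix \<gamma> assume "\<gamma> \<in> space (count_space \<Gamma>)"
    then have "\<gamma> \<cdot> g \<in> D \<longleftrightarrow> \<gamma> \<in> {\<gamma>0}" using g0 by (metis singleton_iff space_count_space)
    then show "indicator D (\<gamma> \<cdot> g) = (indicator {\<gamma>0} \<gamma> :: ennreal)"
      by (simp only: indicator_def)
  qed
  also have "\<dots> = 1" using g0(1) by simp
  finally show ?thesis .
qed

text \<open>A right translate of a fundamental domain is again a fundamental domain, so the claim follows from the
right invariance of the Haar measure and from \<open>unfolding_weights\<close>.\<close>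

lemma nn_integral_quotient_haar_right:
  assumes disc: "discrete_subgroup \<Gamma>" and h: "h \<in> carrier PSL2"
    and f: "f \<in> borel_measurable (borel_of PSL2_topology)" and inv: "left_invariant \<Gamma> f"
  shows "(\<integral>\<^sup>+g. f (g \<cdot> h) \<partial>quotient_haar \<Gamma>) = (\<integral>\<^sup>+g. f g \<partial>quotient_haar \<Gamma>)"
proof -
  define D where "D = (SOME D. fundamental_domain \<Gamma> D)"
  have D: "fundamental_domain \<Gamma> D"
    unfolding D_def using fundamental_domain_exists[OF disc] by (metis someI)
  have Ds: "D \<in> sets (borel_of PSL2_topology)" using D by (simp add: fundamental_domain_def sets_haar)
  then have Dm[measurable]: "(indicator D :: _ \<Rightarrow> ennreal) \<in> borel_measurable (borel_of PSL2_topology)" by simp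
  have Dh: "D \<inter> space haar \<in> sets haar" using Ds by (auto simp: sets_haar intro!: sets.Int)
  have hi: "inv\<^bsub>PSL2\<^esub> h \<in> carrier PSL2" using h by simp
  have sub: "subgroup \<Gamma> PSL2" using disc by (simp add: discrete_subgroup_def)
  note f[measurable]
  have [measurable]: "(\<lambda>g. indicator D (g \<cdot> inv\<^bsub>PSL2\<^esub> h) :: ennreal) \<in> borel_measurable (borel_of PSL2_topology)"
    using measurable_compose[OF borel_of_mult_right[OF hi] Dm] .
  have Q: "(\<integral>\<^sup>+g. k g \<partial>quotient_haar \<Gamma>) = (\<integral>\<^sup>+g. indicator D g * k g \<partial>haar)" for k
    unfolding quotient_haar_def D_def[symmetric] by (simp add: nn_integral_restrict_space[OF Dh] mult.commute)
  have "(\<integral>\<^sup>+g. f (g \<cdot> h) \<partial>quotient_haar \<Gamma>)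
    = (\<integral>\<^sup>+g. indicator D (g \<cdot> h \<cdot> inv\<^bsub>PSL2\<^esub> h) * f (g \<cdot> h) \<partial>haar)"
    unfolding Q using h by (intro nn_integral_cong) (simp add: space_haar PSL2.m_assoc)
  also have "\<dots> = (\<integral>\<^sup>+g. indicator D (g \<cdot> inv\<^bsub>PSL2\<^esub> h) * f g \<partial>haar)"
    using h by (intro nn_integral_haar_right) auto
  also have "\<dots> = (\<integral>\<^sup>+g. indicator D g * f g \<partial>haar)"
  proof (rule unfolding_weights[OF disc f _ _ inv])
    fix g assume g: "g \<in> carrier PSL2"
    show "(\<integral>\<^sup>+\<gamma>. indicator D (\<gamma> \<cdot> g) \<partial>count_space \<Gamma>) = (1::ennreal)"
      by (rule fundamental_domain_weight[OF D g])
    have "(\<integral>\<^sup>+\<gamma>. indicator D (\<gamma> \<cdot> g \<cdot> inv\<^bsub>PSL2\<^esub> h) \<partial>count_space \<Gamma>)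
      = (\<integral>\<^sup>+\<gamma>. indicator D (\<gamma> \<cdot> (g \<cdot> inv\<^bsub>PSL2\<^esub> h)) \<partial>count_space \<Gamma>)"
      using g hi subgroup.mem_carrier[OF sub] by (intro nn_integral_cong) (simp add: PSL2.m_assoc)
    also have "\<dots> = (1::ennreal)" using g hi by (intro fundamental_domain_weight[OF D]) simp
    finally show "(\<integral>\<^sup>+\<gamma>. indicator D (\<gamma> \<cdot> g \<cdot> inv\<^bsub>PSL2\<^esub> h) \<partial>count_space \<Gamma>) = (1::ennreal)" .
  qed measurable
  finally show ?thesis unfolding Q .
qed

text \<open>The difference quotients are dominated by \<open>g\<close> through the mean value inequality, so dominated
convergence applies along every sequence that tends to \<open>t0\<close>.\<close>

section \<open>Differentiation under the integral sign\<close>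

lemma has_vector_derivative_integral:
  fixes f f' :: "real \<Rightarrow> 'a \<Rightarrow> 'b::{banach, second_countable_topology}"
  assumes e: "0 < e"
    and der: "\<And>t x. t \<in> ball t0 e \<Longrightarrow> x \<in> space M \<Longrightarrow> ((\<lambda>s. f s x) has_vector_derivative f' t x) (at t)"
    and bound: "\<And>t x. t \<in> ball t0 e \<Longrightarrow> x \<in> space M \<Longrightarrow> norm (f' t x) \<le> g x"
    and int: "integrable M g" "\<And>t. t \<in> ball t0 e \<Longrightarrow> integrable M (f t)" "integrable M (f' t0)"
  shows "((\<lambda>t. \<integral>x. f t x \<partial>M) has_vector_derivative (\<integral>x. f' t0 x \<partial>M)) (at t0)"
proof -
  define s where "s t x = (1 / (t - t0)) *\<^sub>R (f t x - f t0 x - (t - t0) *\<^sub>R f' t0 x)" for t x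
  have t0: "t0 \<in> ball t0 e" using e by simp
  have lip: "norm (f t x - f t0 x) \<le> g x * norm (t - t0)" if "t \<in> ball t0 e" "x \<in> space M" for t x
  proof (rule differentiable_bound[of "ball t0 e" "\<lambda>s. f s x" "\<lambda>s h. h *\<^sub>R f' s x"])
    fix u assume u: "u \<in> ball t0 e"
    show "((\<lambda>s. f s x) has_derivative (\<lambda>h. h *\<^sub>R f' u x)) (at u within ball t0 e)"
      using der[OF u that(2)] unfolding has_vector_derivative_def by (rule has_derivative_at_withinI)
    have "norm (h *\<^sub>R f' u x) \<le> g x * norm h" for h :: real
      using mult_right_mono[OF bound[OF u that(2)], of "\<bar>h\<bar>"] by (simp add: mult.commute)
    then show "onorm (\<lambda>h. h *\<^sub>R f' u x) \<le> g x"
      using bound[OF u that(2)] by (intro onorm_bound) (auto intro: order_trans[OF norm_ge_zero])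
  qed (use that t0 in auto)
  have sb: "norm (s t x) \<le> 2 * g x" if "t \<in> ball t0 e" "t \<noteq> t0" "x \<in> space M" for t x
  proof -
    have "norm (f t x - f t0 x - (t - t0) *\<^sub>R f' t0 x) \<le> g x * \<bar>t - t0\<bar> + \<bar>t - t0\<bar> * g x"
    proof (rule order_trans[OF norm_triangle_ineq4 add_mono])
      show "norm (f t x - f t0 x) \<le> g x * \<bar>t - t0\<bar>" using lip[OF that(1,3)] by simp
      show "norm ((t - t0) *\<^sub>R f' t0 x) \<le> \<bar>t - t0\<bar> * g x"
        using mult_left_mono[OF bound[OF t0 that(3)], of "\<bar>t - t0\<bar>"] by simp
    qed
    then show ?thesis using that(2) by (simp add: s_def divide_le_eq mult_ac)
  qed
  have lim: "((\<lambda>t. s t x) \<longlongrightarrow> 0) (at t0)" if "x \<in> space M" for x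
  proof -
    have "((\<lambda>t. norm (f t x - f t0 x - (t - t0) *\<^sub>R f' t0 x) / norm (t - t0)) \<longlongrightarrow> 0) (at t0)"
      using der[OF t0 that] by (simp add: has_vector_derivative_def has_derivative_iff_norm)
    then have "((\<lambda>t. norm (s t x)) \<longlongrightarrow> 0) (at t0)" by (simp add: s_def)
    then show ?thesis by (simp add: tendsto_norm_zero_iff)
  qed
  have s_int: "integrable M (s t)" and s_eq: "(\<integral>x. s t x \<partial>M)
      = (1 / (t - t0)) *\<^sub>R ((\<integral>x. f t x \<partial>M) - (\<integral>x. f t0 x \<partial>M) - (t - t0) *\<^sub>R (\<integral>x. f' t0 x \<partial>M))"
    if "t \<in> ball t0 e" for t
    unfolding s_def using int(2)[OF that] int(2)[OF t0] int(3) by (simp_all add: Bochner_Integration.integral_diff)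
  have "((\<lambda>t. \<integral>x. s t x \<partial>M) \<longlongrightarrow> 0) (at t0)"
    unfolding tendsto_at_iff_sequentially comp_def
  proof (intro allI impI)
    fix X :: "nat \<Rightarrow> real" assume X: "\<forall>i. X i \<in> UNIV - {t0}" "X \<longlonglongrightarrow> t0"
    obtain N where N: "\<And>n. N \<le> n \<Longrightarrow> X n \<in> ball t0 e"
      using X(2) e unfolding lim_sequentially by (auto simp: dist_commute)
    have "(\<lambda>n. \<integral>x. s (X (n + N)) x \<partial>M) \<longlonglongrightarrow> (\<integral>x. (0::'b) \<partial>M)"
    proof (rule integral_dominated_convergence[where w = "\<lambda>x. 2 * g x"])
      show "s (X (n + N)) \<in> borel_measurable M" for n using s_int[OF N] by auto
      show "AE x in M. norm (s (X (n + N)) x) \<le> 2 * g x" for n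
        using sb[OF N] X(1) by (intro AE_I2) auto
      show "AE x in M. (\<lambda>n. s (X (n + N)) x) \<longlonglongrightarrow> 0"
      proof (rule AE_I2)
        fix x assume "x \<in> space M"
        from lim[OF this] X have "(\<lambda>n. s (X n) x) \<longlonglongrightarrow> 0"
          unfolding tendsto_at_iff_sequentially comp_def by blast
        then show "(\<lambda>n. s (X (n + N)) x) \<longlonglongrightarrow> 0" by (rule LIMSEQ_ignore_initial_segment)
      qed
    qed (use int in auto)
    then have "(\<lambda>n. \<integral>x. s (X (n + N)) x \<partial>M) \<longlonglongrightarrow> 0" by simp
    then show "(\<lambda>n. \<integral>x. s (X n) x \<partial>M) \<longlonglongrightarrow> 0" by (rule LIMSEQ_offset)
  qed
  then have "((\<lambda>t. norm (\<integral>x. s t x \<partial>M)) \<longlongrightarrow> 0) (at t0)" by (rule tendsto_norm_zero)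
  then have "((\<lambda>t. norm ((\<integral>x. f t x \<partial>M) - (\<integral>x. f t0 x \<partial>M) - (t - t0) *\<^sub>R (\<integral>x. f' t0 x \<partial>M)) / norm (t - t0)) \<longlongrightarrow> 0) (at t0)"
  proof (rule Lim_transform_eventually)
    show "\<forall>\<^sub>F t in at t0. norm (\<integral>x. s t x \<partial>M) = norm ((\<integral>x. f t x \<partial>M) - (\<integral>x. f t0 x \<partial>M) - (t - t0) *\<^sub>R (\<integral>x. f' t0 x \<partial>M)) / norm (t - t0)"
      unfolding eventually_at using e s_eq by (intro exI[of _ e]) (auto simp: dist_commute)
  qed
  then show ?thesis
    unfolding has_vector_derivative_def has_derivative_iff_norm by (simp add: bounded_linear_scaleR_left)
qed

text \<open>For \<open>w = u\<^sup>2 + 1\<close> and the form \<open>q = row_form u A\<close> below, the first factor is the power \<open>\<delta>\<close> of the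
Poisson kernel at the boundary point \<open>u\<close>, and the second one is a phase. Up to the constant factor, this is
\<open>cnj q\<close> to the power \<open>l - \<delta>\<close> times \<open>q\<close> to the power \<open>- l - \<delta>\<close>.\<close>

section \<open>Weighted Poisson kernels\<close>

definition poisson_form :: "real \<Rightarrow> real \<Rightarrow> int \<Rightarrow> complex \<Rightarrow> complex" where
  "poisson_form w \<delta> l q = of_real ((w / (cmod q)\<^sup>2) powr \<delta>) * (cnj q / q) powi l"

lemma cmod_poisson_form: "q \<noteq> 0 \<Longrightarrow> cmod (poisson_form w \<delta> l q) = (w / (cmod q)\<^sup>2) powr \<delta>"
  by (simp add: poisson_form_def norm_mult norm_power_int norm_divide)

text \<open>This is the logarithmic derivative of \<open>cnj q\<close> to the power \<open>l - \<delta>\<close> times \<open>q\<close> to the power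
\<open>- l - \<delta>\<close>, computed on modulus and phase separately so that no branch of a complex power is needed.\<close>

lemma poisson_form_has_vector_derivative:
  assumes q: "(q has_vector_derivative q') (at t)" and nz: "q t \<noteq> 0" and w: "0 < w"
  shows "((\<lambda>s. poisson_form w \<delta> l (q s)) has_vector_derivative
    poisson_form w \<delta> l (q t) * (- of_real (\<delta> + of_int l) * (q' / q t) + of_real (of_int l - \<delta>) * cnj (q' / q t))) (at t)"
proof -
  let ?N = "\<lambda>s. (cmod (q s))\<^sup>2"
  have N0: "0 < ?N t" using nz by simp
  have "((\<lambda>s. (Re (q s))\<^sup>2 + (Im (q s))\<^sup>2) has_real_derivative 2 * (Re (q t) * Re q' + Im (q t) * Im q')) (at t)"
  proof -
    have d: "((\<lambda>s. Re (q s)) has_real_derivative Re q') (at t)" "((\<lambda>s. Im (q s)) has_real_derivative Im q') (at t)"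
      using q unfolding has_vector_derivative_complex_iff by auto
    show ?thesis
      using DERIV_add[OF DERIV_power[OF d(1), of 2] DERIV_power[OF d(2), of 2]] by (simp add: algebra_simps)
  qed
  then have N: "(?N has_real_derivative 2 * (Re (q t) * Re q' + Im (q t) * Im q')) (at t)"
    by (simp add: cmod_power2)
  define \<rho> where "\<rho> = q' / q t"
  have rho: "of_real (2 * (Re (q t) * Re q' + Im (q t) * Im q') / ?N t) = \<rho> + cnj \<rho>"
  proof -
    have "\<rho> + cnj \<rho> = of_real (2 * Re \<rho>)" by (simp add: complex_add_cnj)
    also have "Re \<rho> = (Re (q t) * Re q' + Im (q t) * Im q') / ?N t"
      by (simp add: \<rho>_def Re_divide cmod_power2 mult.commute)
    finally show ?thesis by simp
  qed
  have "((\<lambda>s. (w / ?N s) powr \<delta>) has_real_derivative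
      (w / ?N t) powr \<delta> * (- \<delta> * (2 * (Re (q t) * Re q' + Im (q t) * Im q') / ?N t))) (at t)"
  proof -
    have d1: "((\<lambda>s. w / ?N s) has_real_derivative - (w * (2 * (Re (q t) * Re q' + Im (q t) * Im q'))) / (?N t * ?N t)) (at t)"
      using DERIV_divide[OF DERIV_const N, of w] N0 by simp
    have p: "0 < w / ?N t" using w N0 by simp
    from DERIV_powr[OF d1 p DERIV_const, of \<delta>] show ?thesis
      by (rule DERIV_cong) (use w N0 in \<open>simp add: field_simps\<close>)
  qed
  then have P: "((\<lambda>s. of_real ((w / ?N s) powr \<delta>) :: complex) has_vector_derivative
      of_real ((w / ?N t) powr \<delta>) * (- of_real \<delta> * (\<rho> + cnj \<rho>))) (at t)"
    unfolding rho[symmetric]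
    by (rule has_vector_derivative_eq_rhs[OF has_vector_derivative_of_real]) simp
  have e: "((\<lambda>s. cnj (q s) / q s) has_vector_derivative (cnj (q t) / q t) * (cnj \<rho> - \<rho>)) (at t)"
  proof -
    have "((\<lambda>s. inverse (q s)) has_vector_derivative - (inverse (q t) * q' * inverse (q t))) (at t)"
      using field_vector_diff_chain_at[OF q DERIV_inverse[OF nz, unfolded]]
      by (simp add: o_def power2_eq_square mult.commute mult.left_commute)
    from has_vector_derivative_mult[OF has_vector_derivative_cnj[OF q] this]
    have "((\<lambda>s. cnj (q s) * inverse (q s)) has_vector_derivative
      cnj (q t) * - (inverse (q t) * q' * inverse (q t)) + cnj q' * inverse (q t)) (at t)" .
    then show ?thesis
      unfolding divide_inverse
      by (rule has_vector_derivative_eq_rhs) (use nz in \<open>simp add: \<rho>_def field_simps\<close>)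
  qed
  have ez: "cnj (q t) / q t \<noteq> 0" using nz by simp
  have "((\<lambda>s. (cnj (q s) / q s) powi l) has_vector_derivative (cnj (q t) / q t) powi l * (of_int l * (cnj \<rho> - \<rho>))) (at t)"
  proof -
    have pz: "((\<lambda>z. z powi l) has_field_derivative of_int l * z powi (l - 1)) (at z)" if "z \<noteq> 0" for z :: complex
      using has_derivative_power_int'[OF that, of l UNIV] unfolding has_field_derivative_def
      by (rule has_derivative_eq_rhs) (simp add: fun_eq_iff mult_ac)
    from field_vector_diff_chain_at[OF e pz[OF ez]]
    have "((\<lambda>s. (cnj (q s) / q s) powi l) has_vector_derivative
      cnj (q t) / q t * (cnj \<rho> - \<rho>) * (of_int l * (cnj (q t) / q t) powi (l - 1))) (at t)"
      by (simp add: o_def)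
    then show ?thesis
    proof (rule has_vector_derivative_eq_rhs)
      define z where "z = cnj (q t) / q t"
      have "z * z powi (l - 1) = z powi l" using ez unfolding z_def[symmetric]
        by (metis power_int_minus_mult mult.commute)
      then show "cnj (q t) / q t * (cnj \<rho> - \<rho>) * (of_int l * (cnj (q t) / q t) powi (l - 1)) = (cnj (q t) / q t) powi l * (of_int l * (cnj \<rho> - \<rho>))"
        unfolding z_def[symmetric] by (metis (no_types, lifting) mult.assoc mult.commute)
    qed
  qed
  from has_vector_derivative_mult[OF P this]
  show ?thesis unfolding poisson_form_def \<rho>_def[symmetric]
    by (rule has_vector_derivative_eq_rhs) (simp add: algebra_simps)
qed

lemma sq_plus_one_pos: "0 < (u::real)\<^sup>2 + 1" by (simp add: add_nonneg_pos)

text \<open>The row vector \<open>(1, - u) A = (p\<^sub>1, p\<^sub>2)\<close>, written as the complex number \<open>p\<^sub>2 + i p\<^sub>1\<close>.\<close>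

definition row_form :: "real \<Rightarrow> real^2^2 \<Rightarrow> complex" where
  "row_form u A = Complex (A$1$2 - u * A$2$2) (A$1$1 - u * A$2$1)"

definition entry_sumsq :: "real^2^2 \<Rightarrow> real" where
  "entry_sumsq A = (A$1$1)\<^sup>2 + (A$1$2)\<^sup>2 + (A$2$1)\<^sup>2 + (A$2$2)\<^sup>2"

lemma row_form_sq_le: "(cmod (row_form u A))\<^sup>2 \<le> (u\<^sup>2 + 1) * entry_sumsq A"
proof -
  have cs: "(a - u * b)\<^sup>2 \<le> (u\<^sup>2 + 1) * (a\<^sup>2 + b\<^sup>2)" for a b
  proof -
    have "(u\<^sup>2 + 1) * (a\<^sup>2 + b\<^sup>2) - (a - u * b)\<^sup>2 = (u * a + b)\<^sup>2" by algebra
    then show ?thesis using zero_le_power2[of "u * a + b"] by linarith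
  qed
  have "(cmod (row_form u A))\<^sup>2 = (A$1$2 - u * A$2$2)\<^sup>2 + (A$1$1 - u * A$2$1)\<^sup>2"
    by (simp add: row_form_def cmod_power2)
  also have "\<dots> \<le> (u\<^sup>2 + 1) * ((A$1$2)\<^sup>2 + (A$2$2)\<^sup>2) + (u\<^sup>2 + 1) * ((A$1$1)\<^sup>2 + (A$2$1)\<^sup>2)"
    by (intro add_mono cs)
  finally show ?thesis by (simp add: entry_sumsq_def algebra_simps)
qed

text \<open>The vector \<open>(1, - u)\<close> is recovered from \<open>(1, - u) A\<close> by the inverse matrix, which has the same entries
as \<open>A\<close> up to order and sign. The resulting bound on the Poisson kernel is uniform in \<open>u\<close>, and it justifies all
interchanges of limits with the integral over the boundary.\<close>

lemma row_form_sq_ge: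
  assumes "A \<in> carrier SL2" shows "u\<^sup>2 + 1 \<le> (cmod (row_form u A))\<^sup>2 * entry_sumsq A"
proof -
  obtain a b c d where Ae: "A = mat2 a b c d" using mat2_eta[of A] by metis
  have dt: "a * d - b * c = 1" using assms by (simp add: Ae mat2_in_SL2)
  define p where "p = a - u * c" define q where "q = b - u * d"
  have 1: "p * d - q * c = 1" "q * a - p * b = - u" unfolding p_def q_def using dt by algebra+
  have cs: "(x * y - z * v)\<^sup>2 \<le> (x\<^sup>2 + z\<^sup>2) * (y\<^sup>2 + v\<^sup>2)" for x y z v :: real
  proof -
    have "(x\<^sup>2 + z\<^sup>2) * (y\<^sup>2 + v\<^sup>2) - (x * y - z * v)\<^sup>2 = (x * v + z * y)\<^sup>2" by algebra
    then show ?thesis using zero_le_power2[of "x * v + z * y"] by linarith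
  qed
  have "u\<^sup>2 + 1 = (q * a - p * b)\<^sup>2 + (p * d - q * c)\<^sup>2" using 1 by simp
  also have "\<dots> \<le> (q\<^sup>2 + p\<^sup>2) * (a\<^sup>2 + b\<^sup>2) + (p\<^sup>2 + q\<^sup>2) * (d\<^sup>2 + c\<^sup>2)" by (intro add_mono cs)
  also have "\<dots> = (q\<^sup>2 + p\<^sup>2) * entry_sumsq A" by (simp add: entry_sumsq_def Ae algebra_simps)
  also have "q\<^sup>2 + p\<^sup>2 = (cmod (row_form u A))\<^sup>2" by (simp add: row_form_def cmod_power2 Ae p_def q_def)
  finally show ?thesis .
qed

lemma row_form_nonzero: "A \<in> carrier SL2 \<Longrightarrow> row_form u A \<noteq> 0"
  using row_form_sq_ge[of A u] sq_plus_one_pos[of u] by auto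

definition poisson :: "real \<Rightarrow> int \<Rightarrow> real \<Rightarrow> real^2^2 \<Rightarrow> complex" where
  "poisson \<delta> l u A = poisson_form (u\<^sup>2 + 1) \<delta> l (row_form u A)"

lemma cmod_poisson: "A \<in> carrier SL2 \<Longrightarrow> cmod (poisson \<delta> l u A) = ((u\<^sup>2 + 1) / (cmod (row_form u A))\<^sup>2) powr \<delta>"
  by (simp add: poisson_def cmod_poisson_form row_form_nonzero)

lemma cmod_poisson_le:
  assumes "A \<in> carrier SL2" "0 \<le> \<delta>" shows "cmod (poisson \<delta> l u A) \<le> entry_sumsq A powr \<delta>"
proof -
  have "0 < (cmod (row_form u A))\<^sup>2" using row_form_nonzero[OF assms(1)] by simp
  then have "(u\<^sup>2 + 1) / (cmod (row_form u A))\<^sup>2 \<le> entry_sumsq A"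
    using row_form_sq_ge[OF assms(1), of u] by (simp add: divide_le_eq mult.commute)
  then show ?thesis unfolding cmod_poisson[OF assms(1)]
    using assms(2) by (intro powr_mono2) auto
qed

lemma poisson_measurable:
  assumes "A \<in> carrier SL2" shows "(\<lambda>u. poisson \<delta> l u A) \<in> borel_measurable borel"
proof (rule borel_measurable_continuous_onI)
  have c: "continuous_on UNIV (\<lambda>u. row_form u A)" unfolding row_form_def Complex_eq by (intro continuous_intros)
  have p: "(u\<^sup>2 + 1) / (cmod (row_form u A))\<^sup>2 \<noteq> 0" for u
    using sq_plus_one_pos[of u] row_form_nonzero[OF assms] by simp
  show "continuous_on UNIV (\<lambda>u. poisson \<delta> l u A)"
    unfolding poisson_def poisson_form_def using row_form_nonzero[OF assms] p
    by (intro continuous_intros c) auto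
qed

definition poisson_integral :: "real measure \<Rightarrow> real \<Rightarrow> int \<Rightarrow> real^2^2 \<Rightarrow> complex" where
  "poisson_integral \<mu> \<delta> l A = (\<integral>u. poisson \<delta> l u A \<partial>\<mu>)"

lemma entry_sumsq_nonneg: "0 \<le> entry_sumsq A" by (simp add: entry_sumsq_def)

text \<open>Together \<open>row_form_sq_le\<close> and \<open>row_form_sq_ge\<close> bound logarithmic derivatives of \<open>q\<close> along a path of
matrices uniformly in the boundary point.\<close>

lemma row_form_ratio_le:
  assumes "A \<in> carrier SL2"
  shows "cmod (row_form u A' / row_form u A) \<le> sqrt (entry_sumsq A' * entry_sumsq A)"
proof -
  have q: "0 < (cmod (row_form u A))\<^sup>2" using row_form_nonzero[OF assms] by simp
  have "(cmod (row_form u A'))\<^sup>2 \<le> (u\<^sup>2 + 1) * entry_sumsq A'" by (rule row_form_sq_le)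
  also have "\<dots> \<le> ((cmod (row_form u A))\<^sup>2 * entry_sumsq A) * entry_sumsq A'"
    by (rule mult_right_mono[OF row_form_sq_ge[OF assms] entry_sumsq_nonneg])
  finally have "(cmod (row_form u A' / row_form u A))\<^sup>2 \<le> entry_sumsq A' * entry_sumsq A"
    using q by (simp add: norm_divide power_divide divide_le_eq mult_ac)
  then show ?thesis by (rule real_le_rsqrt)
qed

lemma cnj_measurable: "cnj \<in> borel_measurable borel"
  by (intro borel_measurable_continuous_onI continuous_intros)

lemma row_form_measurable: "(\<lambda>u. row_form u A) \<in> borel_measurable borel"
  by (rule borel_measurable_continuous_onI) (unfold row_form_def Complex_eq, intro continuous_intros)

lemma poisson_Suc: "A \<in> carrier SL2 \<Longrightarrow> poisson \<delta> (l + 1) u A = poisson \<delta> l u A * (cnj (row_form u A) / row_form u A)"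
  by (simp add: poisson_def poisson_form_def power_int_add_1 row_form_nonzero)

lemma poisson_pred: "A \<in> carrier SL2 \<Longrightarrow> poisson \<delta> (l - 1) u A = poisson \<delta> l u A * (row_form u A / cnj (row_form u A))"
  using poisson_Suc[of A \<delta> "l - 1" u] row_form_nonzero[of A u] by simp

lemma poisson_minus: "A \<in> carrier SL2 \<Longrightarrow> poisson \<delta> (- l) u A = cnj (poisson \<delta> l u A)"
  by (simp add: poisson_def poisson_form_def power_int_minus flip: power_int_inverse)

lemma poisson_uminus: "poisson \<delta> l u (- A) = poisson \<delta> l u A"
proof -
  have "row_form u (- A) = - row_form u A" by (simp add: row_form_def complex_eq_iff)
  then show ?thesis by (simp add: poisson_def poisson_form_def)
qed

lemma poisson_integral_uminus: "poisson_integral \<mu> \<delta> l (- A) = poisson_integral \<mu> \<delta> l A"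
  by (simp add: poisson_integral_def poisson_uminus)

lemma poisson_integral_minus:
  assumes "A \<in> carrier SL2" shows "poisson_integral \<mu> \<delta> (- l) A = cnj (poisson_integral \<mu> \<delta> l A)"
  unfolding poisson_integral_def using assms by (simp add: poisson_minus)

text \<open>Right rotations act on the form by a scalar, which is why powers of the phase have a \<open>K\<close>-weight.\<close>

lemma row_form_k: "row_form u (A ** k_mat \<theta>) = row_form u A * cis (- \<theta>)"
  by (simp add: row_form_def k_mat_def mult_nth complex_eq_iff algebra_simps)

lemma poisson_k: "poisson \<delta> l u (A ** k_mat \<theta>) = cis (2 * of_int l * \<theta>) * poisson \<delta> l u A"
proof -
  have "cnj (row_form u A * cis (- \<theta>)) / (row_form u A * cis (- \<theta>)) = cis (2 * \<theta>) * (cnj (row_form u A) / row_form u A)"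
    by (simp add: cis_cnj cis_divide[symmetric] field_simps cis_mult flip: cis_inverse)
  moreover have "cis (2 * \<theta>) powi l = cis (2 * of_int l * \<theta>)"
    by (simp add: cis_power_int mult_ac)
  ultimately have "(cnj (row_form u A * cis (- \<theta>)) / (row_form u A * cis (- \<theta>))) powi l
      = cis (2 * of_int l * \<theta>) * (cnj (row_form u A) / row_form u A) powi l"
    by (simp only: power_int_mult_distrib)
  then show ?thesis unfolding poisson_def poisson_form_def row_form_k
    by (simp only: norm_mult norm_cis mult_1_right mult.left_commute)
qed

lemma poisson_integral_k: "poisson_integral \<mu> \<delta> l (A ** k_mat \<theta>) = cis (2 * of_int l * \<theta>) * poisson_integral \<mu> \<delta> l A"
  by (simp add: poisson_integral_def poisson_k)

lemma k_in_SL2: "k_mat \<theta> \<in> carrier SL2"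
  by (simp add: k_mat_def in_SL2 flip: power2_eq_square)

definition diag_flow :: "real \<Rightarrow> real^2^2" where "diag_flow t = mat2 (exp t) 0 0 (exp (- t))"

lemma diag_flow_in_SL2: "diag_flow t \<in> carrier SL2"
  by (simp add: diag_flow_def mat2_in_SL2 flip: exp_add)

locale boundary_measure = finite_measure \<mu> for \<mu> :: "real measure" +
  fixes \<delta> :: real
  assumes sets_mu: "sets \<mu> = sets borel" and delta_pos: "0 < \<delta>"
begin

abbreviation E :: "int \<Rightarrow> real^2^2 \<Rightarrow> complex" where "E \<equiv> poisson_integral \<mu> \<delta>"

lemma measurable_mu: "f \<in> borel_measurable borel \<Longrightarrow> f \<in> borel_measurable \<mu>"
  using sets_mu measurable_cong_sets by blast

lemma poisson_integrable: "A \<in> carrier SL2 \<Longrightarrow> integrable \<mu> (\<lambda>u. poisson \<delta> l u A)"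
  using cmod_poisson_le[of A \<delta> l] delta_pos
  by (intro integrable_const_bound[of _ "entry_sumsq A powr \<delta>"] measurable_mu poisson_measurable) auto

lemma poisson_mult_integrable:
  assumes A: "A \<in> carrier SL2" and h: "h \<in> borel_measurable borel" "\<And>u. cmod (h u) \<le> B"
  shows "integrable \<mu> (\<lambda>u. poisson \<delta> l u A * h u)"
proof (rule integrable_const_bound[of _ "entry_sumsq A powr \<delta> * B"])
  show "AE u in \<mu>. cmod (poisson \<delta> l u A * h u) \<le> entry_sumsq A powr \<delta> * B"
    using cmod_poisson_le[OF A, of \<delta> l] delta_pos h(2)
    by (intro AE_I2) (auto simp: norm_mult intro!: mult_mono)
  show "(\<lambda>u. poisson \<delta> l u A * h u) \<in> borel_measurable \<mu>"
    using measurable_mu[OF poisson_measurable[OF A]] measurable_mu[OF h(1)] by measurable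
qed

text \<open>Every derivative used below, in \<open>x\<close>, in \<open>y\<close> and along the diagonal flow, is the derivative along a
path of matrices whose entries are continuously differentiable; on a compact parameter interval the bounds above
are uniform.\<close>

lemma poisson_integral_path:
  fixes A A' :: "real \<Rightarrow> real^2^2"
  assumes e: "0 < e" and SL: "\<And>t. t \<in> cball t0 e \<Longrightarrow> A t \<in> carrier SL2"
    and der: "\<And>t. t \<in> cball t0 e \<Longrightarrow> \<forall>i j. ((\<lambda>s. A s$i$j) has_real_derivative A' t$i$j) (at t)"
    and cont: "\<forall>i j. continuous_on (cball t0 e) (\<lambda>t. A' t$i$j)"
  defines "h \<equiv> (\<lambda>t l u. - of_real (\<delta> + of_int l) * (row_form u (A' t) / row_form u (A t))
     + of_real (of_int l - \<delta>) * cnj (row_form u (A' t) / row_form u (A t)))"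
  shows "((\<lambda>t. E l (A t)) has_vector_derivative (\<integral>u. poisson \<delta> l u (A t0) * h t0 l u \<partial>\<mu>)) (at t0)"
    and "integrable \<mu> (\<lambda>u. poisson \<delta> l u (A t0) * h t0 l u)"
proof -
  have contA: "continuous_on (cball t0 e) (\<lambda>t. A t$i$j)" for i j
    using der by (intro continuous_at_imp_continuous_on ballI DERIV_isCont) blast
  have contA': "continuous_on (cball t0 e) (\<lambda>t. A' t$i$j)" for i j using cont by blast
  have "continuous_on (cball t0 e) (\<lambda>t. entry_sumsq (A t))" "continuous_on (cball t0 e) (\<lambda>t. entry_sumsq (A' t))"
    unfolding entry_sumsq_def by (intro continuous_intros contA contA')+
  then have "compact ((\<lambda>t. entry_sumsq (A t)) ` cball t0 e)" "compact ((\<lambda>t. entry_sumsq (A' t)) ` cball t0 e)"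
    by (simp_all add: compact_continuous_image)
  then have "bounded ((\<lambda>t. entry_sumsq (A t)) ` cball t0 e)" "bounded ((\<lambda>t. entry_sumsq (A' t)) ` cball t0 e)"
    by (simp_all add: compact_imp_bounded)
  then obtain B1 B2 where "\<forall>y\<in>(\<lambda>t. entry_sumsq (A t)) ` cball t0 e. norm y \<le> B1"
    "\<forall>y\<in>(\<lambda>t. entry_sumsq (A' t)) ` cball t0 e. norm y \<le> B2"
    unfolding bounded_iff by blast
  then have B: "entry_sumsq (A t) \<le> B1" "entry_sumsq (A' t) \<le> B2" if "t \<in> cball t0 e" for t
    using that by (auto simp del: mem_cball)
  define C where "C = B1 powr \<delta> * ((\<bar>\<delta> + of_int l\<bar> + \<bar>of_int l - \<delta>\<bar>) * sqrt (B2 * B1))"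
  have hb: "cmod (h t l u) \<le> (\<bar>\<delta> + of_int l\<bar> + \<bar>of_int l - \<delta>\<bar>) * sqrt (B2 * B1)" if "t \<in> cball t0 e" for t u
  proof -
    have "cmod (row_form u (A' t) / row_form u (A t)) \<le> sqrt (entry_sumsq (A' t) * entry_sumsq (A t))"
      by (rule row_form_ratio_le[OF SL[OF that]])
    also have "\<dots> \<le> sqrt (B2 * B1)"
      using B[OF that] entry_sumsq_nonneg[of "A t"] entry_sumsq_nonneg[of "A' t"]
      by (intro real_sqrt_le_mono mult_mono) auto
    finally have r: "cmod (row_form u (A' t) / row_form u (A t)) \<le> sqrt (B2 * B1)" .
    have "cmod (h t l u) \<le> \<bar>\<delta> + of_int l\<bar> * cmod (row_form u (A' t) / row_form u (A t)) + \<bar>of_int l - \<delta>\<bar> * cmod (row_form u (A' t) / row_form u (A t))"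
      unfolding h_def
      by (rule order_trans[OF norm_triangle_ineq])
        (simp only: norm_mult norm_minus_cancel norm_of_real complex_mod_cnj order_refl)
    also have "\<dots> \<le> \<bar>\<delta> + of_int l\<bar> * sqrt (B2 * B1) + \<bar>of_int l - \<delta>\<bar> * sqrt (B2 * B1)"
      by (intro add_mono mult_left_mono r) auto
    finally show ?thesis by (simp only: distrib_right)
  qed
  have t0: "t0 \<in> cball t0 e" using e by simp
  have hm: "h t0 l \<in> borel_measurable borel"
    unfolding h_def using measurable_compose[OF _ cnj_measurable] row_form_measurable by measurable
  show int: "integrable \<mu> (\<lambda>u. poisson \<delta> l u (A t0) * h t0 l u)"
    using hm hb[OF t0] by (rule poisson_mult_integrable[OF SL[OF t0]])
  show "((\<lambda>t. E l (A t)) has_vector_derivative (\<integral>u. poisson \<delta> l u (A t0) * h t0 l u \<partial>\<mu>)) (at t0)"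
    unfolding poisson_integral_def
  proof (rule has_vector_derivative_integral[OF e, where g = "\<lambda>_. C"])
    fix t u assume "t \<in> ball t0 e"
    then have t: "t \<in> cball t0 e" by simp
    have d: "((\<lambda>s. A s$i$j) has_real_derivative A' t$i$j) (at t)" for i j using der[OF t] by blast
    have "((\<lambda>s. row_form u (A s)) has_vector_derivative row_form u (A' t)) (at t)"
      unfolding has_vector_derivative_complex_iff row_form_def complex.sel
      by (intro conjI DERIV_diff DERIV_cmult d)
    from poisson_form_has_vector_derivative[OF this row_form_nonzero[OF SL[OF t]] sq_plus_one_pos, of u \<delta> l]
    show "((\<lambda>s. poisson \<delta> l u (A s)) has_vector_derivative poisson \<delta> l u (A t) * h t l u) (at t)"
      unfolding poisson_def h_def .
    have "cmod (poisson \<delta> l u (A t)) \<le> B1 powr \<delta>"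
      using cmod_poisson_le[OF SL[OF t], of \<delta> l u] powr_mono2[OF _ entry_sumsq_nonneg B(1)[OF t], of \<delta>] delta_pos by simp
    then show "cmod (poisson \<delta> l u (A t) * h t l u) \<le> C"
      unfolding C_def norm_mult by (intro mult_mono hb[OF t]) auto
  next
    show "integrable \<mu> (\<lambda>u. poisson \<delta> l u (A t))" if "t \<in> ball t0 e" for t
      using that by (intro poisson_integrable SL) simp
  qed (use int in auto)
qed

text \<open>Along the flow \<open>q\<close> has derivative \<open>- cnj q\<close>, so the two logarithmic derivatives are minus the phase and
minus its inverse, and they move the weight up and down by one.\<close>

lemma poisson_integral_flow:
  assumes A: "A \<in> carrier SL2"
  shows "((\<lambda>t. E l (A ** diag_flow t)) has_vector_derivative
    of_real (\<delta> + of_int l) * E (l + 1) (A ** diag_flow t0) + of_real (\<delta> - of_int l) * E (l - 1) (A ** diag_flow t0)) (at t0)"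
proof -
  define P where "P t = A ** diag_flow t" for t
  define P' where "P' t = mat2 (A$1$1 * exp t) (- A$1$2 * exp (- t)) (A$2$1 * exp t) (- A$2$2 * exp (- t))" for t
  have SL: "P t \<in> carrier SL2" for t unfolding P_def by (intro mult_in_SL2 A diag_flow_in_SL2)
  note path = poisson_integral_path[of 1 t0 P P' l, OF zero_less_one SL]
  have der: "\<forall>i j. ((\<lambda>s. P s$i$j) has_real_derivative P' t$i$j) (at t)" for t
    unfolding forall_2 by (auto simp: P_def P'_def diag_flow_def mult_nth intro!: derivative_eq_intros)
  have cont: "\<forall>i j. continuous_on (cball t0 1) (\<lambda>t. P' t$i$j)"
    unfolding forall_2 by (auto simp: P'_def intro!: continuous_intros)
  have pw: "poisson \<delta> l u (P t0) * (- of_real (\<delta> + of_int l) * (row_form u (P' t0) / row_form u (P t0))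
     + of_real (of_int l - \<delta>) * cnj (row_form u (P' t0) / row_form u (P t0)))
    = of_real (\<delta> + of_int l) * poisson \<delta> (l + 1) u (P t0) + of_real (\<delta> - of_int l) * poisson \<delta> (l - 1) u (P t0)" for u
  proof -
    have alg: "k * (- (d + m) * - x + (m - d) * - y) = (d + m) * (k * x) + (d - m) * (k * y)" for k d m x y :: complex
      by (simp add: algebra_simps)
    have "row_form u (P' t0) = - cnj (row_form u (P t0))"
      by (simp add: row_form_def P_def P'_def diag_flow_def mult_nth complex_eq_iff algebra_simps)
    then have *: "row_form u (P' t0) / row_form u (P t0) = - (cnj (row_form u (P t0)) / row_form u (P t0))"
      "cnj (row_form u (P' t0) / row_form u (P t0)) = - (row_form u (P t0) / cnj (row_form u (P t0)))" by simp_all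
    then show ?thesis unfolding poisson_Suc[OF SL] poisson_pred[OF SL]
      unfolding of_real_diff of_real_add *(1) using *(2) by (simp only: * alg)
  qed
  have "(\<integral>u. of_real (\<delta> + of_int l) * poisson \<delta> (l + 1) u (P t0) + of_real (\<delta> - of_int l) * poisson \<delta> (l - 1) u (P t0) \<partial>\<mu>)
    = of_real (\<delta> + of_int l) * E (l + 1) (P t0) + of_real (\<delta> - of_int l) * E (l - 1) (P t0)"
    unfolding poisson_integral_def using poisson_integrable[OF SL] by simp
  then show ?thesis
    using path(1)[OF der cont] unfolding pw by (simp add: P_def)
qed

text \<open>Differentiating the invariance of the weight \<open>l\<close> integral along the flow gives the invariance of a
combination of the integrals of weights \<open>l + 1\<close> and \<open>l - 1\<close>. Rotations multiply the two terms by different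
characters, so the terms are invariant separately; the coefficient \<open>\<delta> + l\<close> does not vanish.\<close>

lemma poisson_integral_invariant_Suc:
  assumes B: "B \<in> carrier SL2" and inv: "\<And>A. A \<in> carrier SL2 \<Longrightarrow> E (int l) (B ** A) = E (int l) A"
    and A: "A \<in> carrier SL2"
  shows "E (int (Suc l)) (B ** A) = E (int (Suc l)) A"
proof -
  define X where "X = of_real (\<delta> + l) * (E (int l + 1) (B ** A) - E (int l + 1) A)"
  define Y where "Y = of_real (\<delta> - l) * (E (int l - 1) (B ** A) - E (int l - 1) A)"
  have diag_flow0: "C ** diag_flow 0 = C" for C :: "real^2^2"
  proof -
    have "diag_flow 0 = mat 1" by (simp add: diag_flow_def matrix_eq_entries one_nth)
    then show ?thesis by simp
  qed
  have *: "cis (2 * (real l + 1) * \<theta>) * X + cis (2 * (real l - 1) * \<theta>) * Y = 0" for \<theta> :: real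
  proof -
    let ?A = "A ** k_mat \<theta>"
    have SL: "?A \<in> carrier SL2" "B ** ?A \<in> carrier SL2" using A B k_in_SL2 mult_in_SL2 by auto
    have "E (int l) (B ** ?A ** diag_flow t) = E (int l) (?A ** diag_flow t)" for t
      using inv[OF mult_in_SL2[OF SL(1) diag_flow_in_SL2]] by (simp add: matrix_mul_assoc)
    then have "vector_derivative (\<lambda>t. E (int l) (B ** ?A ** diag_flow t)) (at 0) = vector_derivative (\<lambda>t. E (int l) (?A ** diag_flow t)) (at 0)"
      by simp
    then have "of_real (\<delta> + l) * E (int l + 1) (B ** A ** k_mat \<theta>) + of_real (\<delta> - l) * E (int l - 1) (B ** A ** k_mat \<theta>)
      = of_real (\<delta> + l) * E (int l + 1) ?A + of_real (\<delta> - l) * E (int l - 1) ?A"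
      using vector_derivative_at[OF poisson_integral_flow[OF SL(1), of "int l" 0]] vector_derivative_at[OF poisson_integral_flow[OF SL(2), of "int l" 0]]
      by (simp add: diag_flow0 matrix_mul_assoc)
    then show ?thesis unfolding poisson_integral_k X_def Y_def by (simp add: algebra_simps)
  qed
  \<comment> \<open>At \<open>\<theta> = 0\<close> the two characters are equal, and at \<open>\<theta> = \<pi> / 4\<close> they are opposite.\<close>
  have "X + Y = 0" using *[of 0] by simp
  moreover have "X - Y = 0"
  proof -
    have "cis (2 * (real l + 1) * (pi / 4)) = cis (l * pi / 2) * \<i>" "cis (2 * (real l - 1) * (pi / 4)) = cis (l * pi / 2) * (- \<i>)"
    proof -
      have "cis (2 * (real l + 1) * (pi / 4)) = cis (l * pi / 2 + pi / 2)"
        by (rule arg_cong[where f = cis]) (simp add: field_simps)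
      then show "cis (2 * (real l + 1) * (pi / 4)) = cis (l * pi / 2) * \<i>" by (simp add: cis_mult[symmetric])
      have "cis (2 * (real l - 1) * (pi / 4)) = cis (l * pi / 2 + - (pi / 2))"
        by (rule arg_cong[where f = cis]) (simp add: field_simps)
      then show "cis (2 * (real l - 1) * (pi / 4)) = cis (l * pi / 2) * (- \<i>)" by (simp only: cis_mult[symmetric] cis_minus_pi_half)
    qed
    with *[of "pi / 4"] have "cis (l * pi / 2) * (\<i> * (X - Y)) = 0"
      by (simp add: algebra_simps)
    then show ?thesis by simp
  qed
  ultimately have "X = 0" by (simp add: algebra_simps)
  moreover have "complex_of_real (\<delta> + l) \<noteq> 0" using delta_pos by (simp only: of_real_eq_0_iff)
  ultimately show ?thesis unfolding X_def by (simp add: add.commute)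
qed

end

section \<open>Raising and lowering operators\<close>

definition nak_mat :: "real \<Rightarrow> real \<Rightarrow> real \<Rightarrow> real^2^2" where
  "nak_mat x y \<theta> = mat2 (sqrt y * cos \<theta> - x * sin \<theta> / sqrt y)
     (sqrt y * sin \<theta> + x * cos \<theta> / sqrt y) (- sin \<theta> / sqrt y) (cos \<theta> / sqrt y)"

lemma nak_eq_nak_mat: "nak x y \<theta> = psl (nak_mat x y \<theta>)"
  by (simp add: nak_mat2 nak_mat_def)

lemma nak_mat_in_SL2: "0 < y \<Longrightarrow> nak_mat x y \<theta> \<in> carrier SL2"
  unfolding nak_mat_def by (rule nak_mat2_in_SL2)

lemma nak_mat_rotate: "nak_mat x y \<theta> = nak_mat x y 0 ** k_mat \<theta>"
  by (simp add: nak_mat_def k_mat_def matrix_eq_entries mult_nth)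

lemma row_form_nak_mat:
  assumes "0 < y" shows "row_form u (nak_mat x y \<theta>) = Complex (x - u) y * cis (- \<theta>) / sqrt y"
proof -
  define s where "s = sqrt y"
  have s: "s \<noteq> 0" "y = s * s" using assms by (simp_all add: s_def)
  show ?thesis
    unfolding nak_mat_def s_def[symmetric] using s(1)
    by (simp add: row_form_def complex_eq_iff s(2) field_simps)
qed

lemma Complex_ne_0: "0 < y \<Longrightarrow> Complex x y \<noteq> 0"
  by (simp add: complex_eq_iff)

lemma poisson_integral_psl: "poisson_integral \<mu> \<delta> l (SOME A. A \<in> psl B) = poisson_integral \<mu> \<delta> l B"
proof -
  have "(SOME A. A \<in> psl B) \<in> {B, - B}"
    unfolding psl_eq by (rule someI[of _ B]) simp
  then show ?thesis by (auto simp: poisson_integral_uminus)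
qed

text \<open>The integral is even in the matrix, so the choice of a representative is immaterial.\<close>

definition weight_fun :: "real measure \<Rightarrow> real \<Rightarrow> int \<Rightarrow> (real^2^2) set \<Rightarrow> complex" where
  "weight_fun \<mu> \<delta> l g = poisson_integral \<mu> \<delta> l (SOME A. A \<in> g)"

lemma weight_fun_psl: "weight_fun \<mu> \<delta> l (psl A) = poisson_integral \<mu> \<delta> l A"
  by (simp add: weight_fun_def poisson_integral_psl)

lemma poisson_nak_mat:
  assumes y: "0 < y"
  shows "poisson \<delta> l u (nak_mat x y \<theta>) = cis (2 * of_int l * \<theta>) *
    (of_real (((u\<^sup>2 + 1) * y / ((x - u)\<^sup>2 + y\<^sup>2)) powr \<delta>) * (Complex (x - u) (- y) / Complex (x - u) y) powi l)"
proof -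
  have "poisson \<delta> l u (nak_mat x y 0) = of_real (((u\<^sup>2 + 1) * y / ((x - u)\<^sup>2 + y\<^sup>2)) powr \<delta>) * (Complex (x - u) (- y) / Complex (x - u) y) powi l"
  proof -
    have q: "row_form u (nak_mat x y 0) = Complex (x - u) y / sqrt y" using row_form_nak_mat[OF y, of u x 0] by simp
    have "(cmod (row_form u (nak_mat x y 0)))\<^sup>2 = ((x - u)\<^sup>2 + y\<^sup>2) / y"
      unfolding q using y by (simp add: norm_divide power_divide cmod_power2)
    moreover have "cnj (row_form u (nak_mat x y 0)) / row_form u (nak_mat x y 0) = Complex (x - u) (- y) / Complex (x - u) y"
      unfolding q using y by (simp add: complex_cnj_divide) (simp add: complex_eq_iff)
    ultimately show ?thesis by (simp add: poisson_def poisson_form_def)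
  qed
  then show ?thesis by (simp only: nak_mat_rotate[of x y \<theta>] poisson_k)
qed

lemma nak_coords_carrier:
  assumes "g \<in> carrier PSL2"
  obtains x y \<theta> where "0 < y" "0 \<le> \<theta>" "\<theta> < pi" "g = nak x y \<theta>" "nak_coords g = (x, y, \<theta>)"
proof -
  obtain x y \<theta> where D: "(x, y, \<theta>) \<in> nak_domain" "g = nak x y \<theta>" using assms by (rule iwasawa)
  then have "0 < y" "0 \<le> \<theta>" "\<theta> < pi" by (simp_all add: nak_domain_def)
  then show ?thesis using D nak_coords_nak[OF D(1)] by (intro that) simp_all
qed

lemma vector_derivative_cmult:
  assumes "(f has_vector_derivative f') (at t)" "\<And>s. s \<in> S \<Longrightarrow> h s = c * f s" "open S" "t \<in> S"
  shows "vector_derivative h (at t) = c * (f' :: complex)"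
proof (rule vector_derivative_at)
  have "((\<lambda>s. c * f s) has_vector_derivative c * f') (at t)"
    using assms(1) by (rule has_vector_derivative_mult_right)
  then show "(h has_vector_derivative c * f') (at t)"
    using assms(3,4) by (rule has_vector_derivative_transform_within_open) (simp add: assms(2))
qed

context boundary_measure
begin

abbreviation F :: "int \<Rightarrow> (real^2^2) set \<Rightarrow> complex" where "F \<equiv> weight_fun \<mu> \<delta>"

text \<open>In these coordinates \<open>q\<close> is \<open>(z - u) e\<^sup>-\<^sup>i\<^sup>\<theta> / \<surd>y\<close> with \<open>z = x + i y\<close>, so \<open>q\<close> has logarithmic derivative
\<open>1 / (z - u)\<close> in \<open>x\<close>.\<close>

lemma poisson_integral_deriv_x:
  assumes y: "0 < y"
  shows "((\<lambda>t. E l (nak_mat t y \<theta>)) has_vector_derivative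
     (\<integral>u. poisson \<delta> l u (nak_mat x y \<theta>) * (- of_real (\<delta> + of_int l) * (1 / Complex (x - u) y)
        + of_real (of_int l - \<delta>) * cnj (1 / Complex (x - u) y)) \<partial>\<mu>)) (at x)"
    and "integrable \<mu> (\<lambda>u. poisson \<delta> l u (nak_mat x y \<theta>) * (- of_real (\<delta> + of_int l) * (1 / Complex (x - u) y)
        + of_real (of_int l - \<delta>) * cnj (1 / Complex (x - u) y)))"
proof -
  define A' :: "real \<Rightarrow> real^2^2" where "A' t = mat2 (- sin \<theta> / sqrt y) (cos \<theta> / sqrt y) 0 0" for t
  have r: "row_form u (A' x) / row_form u (nak_mat x y \<theta>) = 1 / Complex (x - u) y" for u
  proof -
    have "row_form u (A' x) = cis (- \<theta>) / sqrt y" using y by (simp add: row_form_def A'_def complex_eq_iff)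
    then show ?thesis using y Complex_ne_0[OF y] by (simp add: row_form_nak_mat)
  qed
  have d: "\<forall>i j. ((\<lambda>s. nak_mat s y \<theta>$i$j) has_real_derivative A' t$i$j) (at t)" for t
  proof -
    have sq: "z * sqrt y / y = z / sqrt y" for z using y by (simp add: field_simps)
    show ?thesis
      unfolding forall_2 using y by (auto simp: nak_mat_def A'_def sq intro!: derivative_eq_intros)
  qed
  have c: "\<forall>i j. continuous_on (cball x 1) (\<lambda>t. A' t$i$j)"
    unfolding forall_2 by (auto simp: A'_def)
  show "((\<lambda>t. E l (nak_mat t y \<theta>)) has_vector_derivative
     (\<integral>u. poisson \<delta> l u (nak_mat x y \<theta>) * (- of_real (\<delta> + of_int l) * (1 / Complex (x - u) y)
        + of_real (of_int l - \<delta>) * cnj (1 / Complex (x - u) y)) \<partial>\<mu>)) (at x)"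
    "integrable \<mu> (\<lambda>u. poisson \<delta> l u (nak_mat x y \<theta>) * (- of_real (\<delta> + of_int l) * (1 / Complex (x - u) y)
        + of_real (of_int l - \<delta>) * cnj (1 / Complex (x - u) y)))"
    using poisson_integral_path[OF zero_less_one nak_mat_in_SL2[OF y] d c, of l] unfolding r by auto
qed

text \<open>Here the logarithmic derivative of \<open>q\<close> is \<open>i / (z - u) - 1 / (2 y)\<close>.\<close>

lemma poisson_integral_deriv_y:
  assumes y: "0 < y"
  shows "((\<lambda>t. E l (nak_mat x t \<theta>)) has_vector_derivative
     (\<integral>u. poisson \<delta> l u (nak_mat x y \<theta>) * (- of_real (\<delta> + of_int l) * (\<i> / Complex (x - u) y - 1 / (2 * of_real y))
        + of_real (of_int l - \<delta>) * cnj (\<i> / Complex (x - u) y - 1 / (2 * of_real y))) \<partial>\<mu>)) (at y)"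
    and "integrable \<mu> (\<lambda>u. poisson \<delta> l u (nak_mat x y \<theta>) * (- of_real (\<delta> + of_int l) * (\<i> / Complex (x - u) y - 1 / (2 * of_real y))
        + of_real (of_int l - \<delta>) * cnj (\<i> / Complex (x - u) y - 1 / (2 * of_real y))))"
proof -
  define A' :: "real \<Rightarrow> real^2^2" where
    "A' t = mat2 (cos \<theta> / (2 * sqrt t) + x * sin \<theta> / (2 * t * sqrt t)) (sin \<theta> / (2 * sqrt t) - x * cos \<theta> / (2 * t * sqrt t))
      (sin \<theta> / (2 * t * sqrt t)) (- cos \<theta> / (2 * t * sqrt t))" for t
  have pos: "0 < t" if "t \<in> cball y (y / 2)" for t
    using that y by (auto simp: dist_real_def abs_if split: if_splits)
  have r: "row_form u (A' y) / row_form u (nak_mat x y \<theta>) = \<i> / Complex (x - u) y - 1 / (2 * of_real y)" for u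
  proof -
    define s where "s = sqrt y"
    have s: "s \<noteq> 0" "y = s * s" using y by (simp_all add: s_def)
    have "row_form u (A' y) = (\<i> * y - (x - u)) * cis (- \<theta>) / (2 * y * sqrt y)"
      unfolding A'_def s_def[symmetric] using s(1)
      by (simp add: row_form_def complex_eq_iff s(2) field_simps)
    then have "row_form u (A' y) / row_form u (nak_mat x y \<theta>) = (\<i> * y - (x - u)) / (2 * y * Complex (x - u) y)"
      using y Complex_ne_0[OF y] by (simp add: row_form_nak_mat field_simps)
    also have "\<i> * y - (x - u) = 2 * y * \<i> - Complex (x - u) y" by (simp add: complex_eq_iff)
    finally show ?thesis using y Complex_ne_0[OF y, of "x - u"] by (simp add: diff_divide_distrib)
  qed
  have d: "\<forall>i j. ((\<lambda>s. nak_mat x s \<theta>$i$j) has_real_derivative A' t$i$j) (at t)" if "t \<in> cball y (y / 2)" for t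
    unfolding forall_2 using pos[OF that]
    by (auto simp: nak_mat_def A'_def intro!: derivative_eq_intros simp: field_simps)
  have c: "\<forall>i j. continuous_on (cball y (y / 2)) (\<lambda>t. A' t$i$j)"
    unfolding forall_2 A'_def mat2_nth by (intro conjI continuous_intros) (use pos in force)+
  have y2: "0 < y / 2" using y by simp
  note P = poisson_integral_path[OF y2 nak_mat_in_SL2[OF pos] d c, of l, unfolded r]
  show "((\<lambda>t. E l (nak_mat x t \<theta>)) has_vector_derivative
     (\<integral>u. poisson \<delta> l u (nak_mat x y \<theta>) * (- of_real (\<delta> + of_int l) * (\<i> / Complex (x - u) y - 1 / (2 * of_real y))
        + of_real (of_int l - \<delta>) * cnj (\<i> / Complex (x - u) y - 1 / (2 * of_real y))) \<partial>\<mu>)) (at y)"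
    "integrable \<mu> (\<lambda>u. poisson \<delta> l u (nak_mat x y \<theta>) * (- of_real (\<delta> + of_int l) * (\<i> / Complex (x - u) y - 1 / (2 * of_real y))
        + of_real (of_int l - \<delta>) * cnj (\<i> / Complex (x - u) y - 1 / (2 * of_real y))))"
    using P by auto
qed

lemma poisson_integral_deriv_\<theta>:
  "((\<lambda>t. E l (nak_mat x y t)) has_vector_derivative 2 * of_int l * \<i> * E l (nak_mat x y \<theta>)) (at \<theta>)"
proof -
  have d: "((\<lambda>t. cis (2 * of_int l * t)) has_vector_derivative 2 * of_int l * \<i> * cis (2 * of_int l * \<theta>)) (at \<theta>)"
    unfolding has_vector_derivative_complex_iff by (auto intro!: derivative_eq_intros)
  define c where "c = E l (nak_mat x y 0)"
  have "((\<lambda>t. cis (2 * of_int l * t) * c) has_vector_derivative 2 * of_int l * \<i> * cis (2 * of_int l * \<theta>) * c) (at \<theta>)"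
    using d by (rule has_vector_derivative_mult_left)
  moreover have "E l (nak_mat x y t) = cis (2 * of_int l * t) * c" for t
    unfolding c_def by (subst nak_mat_rotate) (rule poisson_integral_k)
  ultimately show ?thesis by (simp add: mult.assoc)
qed

lemma row_form_phase:
  assumes y: "0 < y"
  shows "cnj (row_form u (nak_mat x y \<theta>)) / row_form u (nak_mat x y \<theta>) = cis (2 * \<theta>) * (cnj (Complex (x - u) y) / Complex (x - u) y)"
proof -
  have "cnj (cis (- \<theta>)) / cis (- \<theta>) = cis (2 * \<theta>)" by (simp add: cis_cnj cis_divide)
  then show ?thesis unfolding row_form_nak_mat[OF y] using y
    by (simp only: complex_cnj_divide complex_cnj_mult complex_cnj_complex_of_real) (simp add: field_simps)
qed

text \<open>For the raising operator the terms with \<open>cnj (1 / (z - u))\<close> cancel, and the others add up to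
\<open>(\<delta> + l) (1 - 2 i y / (z - u))\<close>, which is \<open>\<delta> + l\<close> times \<open>cnj (z - u) / (z - u)\<close>. This quotient and the factor
\<open>e\<^sup>2\<^sup>i\<^sup>\<theta>\<close> make up one more power of the phase. The lowering operator is treated symmetrically.\<close>

lemma raising_lowering_poisson_integral:
  assumes y: "0 < y"
  shows "exp (2 * \<i> * of_real \<theta>) *
       (\<i> * of_real y * vector_derivative (\<lambda>t. E l (nak_mat t y \<theta>)) (at x)
        + of_real y * vector_derivative (\<lambda>t. E l (nak_mat x t \<theta>)) (at y)
        + 1 / (2 * \<i>) * vector_derivative (\<lambda>t. E l (nak_mat x y t)) (at \<theta>))
    = of_real (\<delta> + of_int l) * E (l + 1) (nak_mat x y \<theta>)" (is ?R)
  and "exp (- 2 * \<i> * of_real \<theta>) *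
       (- \<i> * of_real y * vector_derivative (\<lambda>t. E l (nak_mat t y \<theta>)) (at x)
        + of_real y * vector_derivative (\<lambda>t. E l (nak_mat x t \<theta>)) (at y)
        - 1 / (2 * \<i>) * vector_derivative (\<lambda>t. E l (nak_mat x y t)) (at \<theta>))
    = of_real (\<delta> - of_int l) * E (l - 1) (nak_mat x y \<theta>)" (is ?L)
proof -
  let ?M = "nak_mat x y \<theta>"
  define z where "z u = Complex (x - u) y" for u
  define d where "d = complex_of_real \<delta>"
  define m where "m = (of_int l :: complex)"
  define fx where "fx u = poisson \<delta> l u ?M * (- (d + m) * (1 / z u) + (m - d) * cnj (1 / z u))" for u
  define fy where "fy u = poisson \<delta> l u ?M * (- (d + m) * (\<i> / z u - 1 / (2 * of_real y)) + (m - d) * cnj (\<i> / z u - 1 / (2 * of_real y)))" for u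
  have X: "vector_derivative (\<lambda>t. E l (nak_mat t y \<theta>)) (at x) = (\<integral>u. fx u \<partial>\<mu>)" "integrable \<mu> fx"
    unfolding fx_def d_def m_def z_def using vector_derivative_at[OF poisson_integral_deriv_x(1)[OF y]] poisson_integral_deriv_x(2)[OF y] by simp_all
  have Y: "vector_derivative (\<lambda>t. E l (nak_mat x t \<theta>)) (at y) = (\<integral>u. fy u \<partial>\<mu>)" "integrable \<mu> fy"
    unfolding fy_def d_def m_def z_def using vector_derivative_at[OF poisson_integral_deriv_y(1)[OF y]] poisson_integral_deriv_y(2)[OF y] by simp_all
  have T: "vector_derivative (\<lambda>t. E l (nak_mat x y t)) (at \<theta>) = 2 * m * \<i> * (\<integral>u. poisson \<delta> l u ?M \<partial>\<mu>)"
    using vector_derivative_at[OF poisson_integral_deriv_\<theta>] by (simp add: m_def poisson_integral_def)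
  have tt: "1 / (2 * \<i>) * (2 * m * \<i> * k) = m * k" for k by (simp add: field_simps)
  note SL = nak_mat_in_SL2[OF y, of x \<theta>]
  note K = poisson_integrable[OF SL]
  have y0: "complex_of_real y \<noteq> 0" using y by simp
  have z0: "z u \<noteq> 0" "cnj (z u) \<noteq> 0" for u unfolding z_def using Complex_ne_0[OF y] by simp_all
  have zc: "cnj (z u) = z u - 2 * \<i> * y" for u by (simp add: z_def complex_eq_iff)
  have e: "exp (2 * \<i> * of_real \<theta>) = cis (2 * \<theta>)" "exp (- 2 * \<i> * of_real \<theta>) = inverse (cis (2 * \<theta>))"
    by (simp_all add: cis_conv_exp mult_ac flip: exp_minus)
  have pR: "exp (2 * \<i> * of_real \<theta>) * (\<i> * y * fx u + y * fy u + m * poisson \<delta> l u ?M) = (d + m) * poisson \<delta> (l + 1) u ?M" for u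
  proof -
    have "\<i> * y * fx u + y * fy u + m * poisson \<delta> l u ?M = (d + m) * (poisson \<delta> l u ?M * (cnj (z u) / z u))"
      unfolding fx_def fy_def using z0[of u] y0 unfolding complex_cnj_divide complex_cnj_diff
      by (simp add: field_simps) (simp add: zc algebra_simps)?
    then show ?thesis
      unfolding poisson_Suc[OF SL] row_form_phase[OF y] e by (simp add: z_def mult_ac)
  qed
  have pL: "exp (- 2 * \<i> * of_real \<theta>) * (- \<i> * y * fx u + y * fy u - m * poisson \<delta> l u ?M) = (d - m) * poisson \<delta> (l - 1) u ?M" for u
  proof -
    have "- \<i> * y * fx u + y * fy u - m * poisson \<delta> l u ?M = (d - m) * (poisson \<delta> l u ?M * (z u / cnj (z u)))"
      unfolding fx_def fy_def using z0[of u] y0 unfolding complex_cnj_divide complex_cnj_diff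
      by (simp add: field_simps) (simp add: zc algebra_simps)?
    moreover have "row_form u ?M / cnj (row_form u ?M) = inverse (cis (2 * \<theta>)) * (z u / cnj (z u))"
      using arg_cong[OF row_form_phase[OF y, of u x \<theta>], of inverse]
      by (simp only: inverse_mult_distrib inverse_divide z_def)
    ultimately show ?thesis
      unfolding poisson_pred[OF SL] e by (simp add: mult_ac)
  qed
  have "(\<integral>u. exp (2 * \<i> * of_real \<theta>) * (\<i> * y * fx u + y * fy u + m * poisson \<delta> l u ?M) \<partial>\<mu>)
    = exp (2 * \<i> * of_real \<theta>) * (\<i> * y * (\<integral>u. fx u \<partial>\<mu>) + y * (\<integral>u. fy u \<partial>\<mu>) + m * (\<integral>u. poisson \<delta> l u ?M \<partial>\<mu>))"
    using X(2) Y(2) K by simp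
  moreover have "(\<integral>u. (d + m) * poisson \<delta> (l + 1) u ?M \<partial>\<mu>) = (d + m) * E (l + 1) ?M" by (simp add: poisson_integral_def)
  ultimately show ?R unfolding X(1) Y(1) T tt pR by (simp add: d_def m_def)
  have "(\<integral>u. exp (- 2 * \<i> * of_real \<theta>) * (- \<i> * y * fx u + y * fy u - m * poisson \<delta> l u ?M) \<partial>\<mu>)
    = exp (- 2 * \<i> * of_real \<theta>) * (- \<i> * y * (\<integral>u. fx u \<partial>\<mu>) + y * (\<integral>u. fy u \<partial>\<mu>) - m * (\<integral>u. poisson \<delta> l u ?M \<partial>\<mu>))"
    using X(2) Y(2) K by simp
  moreover have "(\<integral>u. (d - m) * poisson \<delta> (l - 1) u ?M \<partial>\<mu>) = (d - m) * E (l - 1) ?M" by (simp add: poisson_integral_def)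
  ultimately show ?L unfolding X(1) Y(1) T tt pL by (simp add: d_def m_def)
qed

text \<open>The operators only see \<open>f\<close> on the group, and at \<open>\<theta> = 0\<close> they also differentiate across the end of the
coordinate range; both are harmless because \<open>f\<close> is known on all matrices \<open>n\<^sub>x a\<^sub>y k\<^sub>\<theta>\<close> with \<open>y > 0\<close>.\<close>

lemma raising_weight_fun:
  assumes f: "\<And>g. g \<in> carrier PSL2 \<Longrightarrow> f g = c * F l g" and g: "g \<in> carrier PSL2"
  shows "raising f g = c * of_real (\<delta> + of_int l) * F (l + 1) g"
    and "lowering f g = c * of_real (\<delta> - of_int l) * F (l - 1) g"
proof -
  obtain x y \<theta> where y: "0 < y" and n: "g = nak x y \<theta>" "nak_coords g = (x, y, \<theta>)"
    using nak_coords_carrier[OF g] by blast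
  have eq: "f (nak a b t) = c * E l (nak_mat a b t)" if "0 < b" for a b t
    using f[OF nak_in_PSL2[OF that]] by (simp add: nak_eq_nak_mat weight_fun_psl)
  have dx: "vector_derivative (\<lambda>t. f (nak t y \<theta>)) (at x) = c * vector_derivative (\<lambda>t. E l (nak_mat t y \<theta>)) (at x)"
    using vector_derivative_cmult[OF poisson_integral_deriv_x(1)[OF y] eq[OF y] open_UNIV UNIV_I]
    by (simp only: vector_derivative_at[OF poisson_integral_deriv_x(1)[OF y]])
  have dy: "vector_derivative (\<lambda>t. f (nak x t \<theta>)) (at y) = c * vector_derivative (\<lambda>t. E l (nak_mat x t \<theta>)) (at y)"
    using vector_derivative_cmult[OF poisson_integral_deriv_y(1)[OF y], of "{0<..}" "\<lambda>t. f (nak x t \<theta>)" c] y eq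
    by (simp only: vector_derivative_at[OF poisson_integral_deriv_y(1)[OF y]]) simp
  have dt: "vector_derivative (\<lambda>t. f (nak x y t)) (at \<theta>) = c * vector_derivative (\<lambda>t. E l (nak_mat x y t)) (at \<theta>)"
    using vector_derivative_cmult[OF poisson_integral_deriv_\<theta> eq[OF y] open_UNIV UNIV_I]
    by (simp only: vector_derivative_at[OF poisson_integral_deriv_\<theta>])
  have Gn: "F k g = E k (nak_mat x y \<theta>)" for k by (simp add: n(1) nak_eq_nak_mat weight_fun_psl)
  have pull_R: "e * (a * (c * X) + b * (c * Y) + k * (c * Z)) = c * (e * (a * X + b * Y + k * Z))"
    and pull_L: "e * (a * (c * X) + b * (c * Y) - k * (c * Z)) = c * (e * (a * X + b * Y - k * Z))"
    for e a b k X Y Z :: complex by (simp_all add: algebra_simps)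
  show "raising f g = c * of_real (\<delta> + of_int l) * F (l + 1) g"
    unfolding raising_def n(2) case_prod_conv dx dy dt pull_R raising_lowering_poisson_integral(1)[OF y] Gn by (rule mult.assoc[symmetric])
  show "lowering f g = c * of_real (\<delta> - of_int l) * F (l - 1) g"
    unfolding lowering_def n(2) case_prod_conv dx dy dt pull_L raising_lowering_poisson_integral(2)[OF y] Gn by (rule mult.assoc[symmetric])
qed

section \<open>Continuity and growth of the weight functions\<close>

lemma poisson_integral_continuous: "continuous_on (carrier SL2) (E l)"
  unfolding continuous_on_sequentially
proof (intro ballI allI impI, elim conjE)
  fix A and X :: "nat \<Rightarrow> real^2^2" assume A: "A \<in> carrier SL2" and X: "\<forall>n. X n \<in> carrier SL2" "X \<longlonglongrightarrow> A"
  have lim: "(\<lambda>n. X n $ i $ j) \<longlonglongrightarrow> A $ i $ j" for i j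
    by (intro tendsto_vec_nth X(2))
  have "(\<lambda>n. entry_sumsq (X n)) \<longlonglongrightarrow> entry_sumsq A"
    unfolding entry_sumsq_def by (intro tendsto_intros lim)
  then have "Bseq (\<lambda>n. entry_sumsq (X n))" by (rule convergent_imp_Bseq[OF convergentI])
  then obtain B where B: "\<And>n. norm (entry_sumsq (X n)) \<le> B" by (rule BseqE) blast
  have "(\<lambda>n. \<integral>u. poisson \<delta> l u (X n) \<partial>\<mu>) \<longlonglongrightarrow> (\<integral>u. poisson \<delta> l u A \<partial>\<mu>)"
  proof (rule integral_dominated_convergence[where w = "\<lambda>_. B powr \<delta>"])
    show "(\<lambda>u. poisson \<delta> l u A) \<in> borel_measurable \<mu>" "(\<lambda>u. poisson \<delta> l u (X n)) \<in> borel_measurable \<mu>" for n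
      using A X by (auto intro: measurable_mu poisson_measurable)
    show "AE u in \<mu>. cmod (poisson \<delta> l u (X n)) \<le> B powr \<delta>" for n
    proof (rule AE_I2)
      fix u
      have "entry_sumsq (X n) powr \<delta> \<le> B powr \<delta>" using B[of n] delta_pos entry_sumsq_nonneg by (intro powr_mono2) auto
      then show "cmod (poisson \<delta> l u (X n)) \<le> B powr \<delta>"
        using cmod_poisson_le[of "X n" \<delta> l u] X(1) delta_pos by force
    qed
    show "AE u in \<mu>. (\<lambda>n. poisson \<delta> l u (X n)) \<longlonglongrightarrow> poisson \<delta> l u A"
    proof (rule AE_I2)
      fix u
      have q: "(\<lambda>n. row_form u (X n)) \<longlonglongrightarrow> row_form u A"
        unfolding row_form_def Complex_eq by (intro tendsto_intros lim)
      have nz: "row_form u A \<noteq> 0" by (rule row_form_nonzero[OF A])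
      have "(u\<^sup>2 + 1) / (cmod (row_form u A))\<^sup>2 \<noteq> 0" using nz sq_plus_one_pos[of u] by simp
      then show "(\<lambda>n. poisson \<delta> l u (X n)) \<longlonglongrightarrow> poisson \<delta> l u A"
        unfolding poisson_def poisson_form_def using nz by (intro tendsto_intros q) auto
    qed
  qed simp
  then show "(E l \<circ> X) \<longlonglongrightarrow> E l A" by (simp add: poisson_integral_def o_def)
qed

lemma weight_fun_measurable: "F l \<in> borel_measurable (borel_of PSL2_topology)"
  by (intro borel_of_continuous_map_euclidean continuous_map_PSL2I) (simp add: weight_fun_psl poisson_integral_continuous)

text \<open>The weight 0 function is real and nonnegative, since the Poisson kernel is.\<close>

definition majorant :: "(real^2^2) set \<Rightarrow> real" where "majorant g = Re (F 0 g)"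

lemma poisson_0: "A \<in> carrier SL2 \<Longrightarrow> poisson \<delta> 0 u A = of_real (cmod (poisson \<delta> 0 u A))"
  by (simp add: cmod_poisson) (simp add: poisson_def poisson_form_def)

lemma majorant_eq:
  assumes "A \<in> carrier SL2" shows "majorant (psl A) = (\<integral>u. cmod (poisson \<delta> 0 u A) \<partial>\<mu>)"
proof -
  have "E 0 A = (\<integral>u. complex_of_real (cmod (poisson \<delta> 0 u A)) \<partial>\<mu>)"
    unfolding poisson_integral_def by (rule Bochner_Integration.integral_cong[OF refl poisson_0[OF assms]])
  also have "\<dots> = complex_of_real (\<integral>u. cmod (poisson \<delta> 0 u A) \<partial>\<mu>)" by (rule integral_complex_of_real)
  finally show ?thesis by (simp add: majorant_def weight_fun_psl)
qed

lemma weight_fun_le_majorant: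
  assumes "g \<in> carrier PSL2" shows "cmod (F l g) \<le> majorant g"
proof -
  obtain A where A: "A \<in> carrier SL2" "g = psl A" using assms by (rule PSL2_cases)
  have "cmod (E l A) \<le> (\<integral>u. cmod (poisson \<delta> l u A) \<partial>\<mu>)"
    unfolding poisson_integral_def by (rule integral_norm_bound)
  also have "\<dots> = (\<integral>u. cmod (poisson \<delta> 0 u A) \<partial>\<mu>)" by (simp only: cmod_poisson[OF A(1)])
  finally show ?thesis by (simp add: A(2) weight_fun_psl majorant_eq[OF A(1)])
qed

lemma majorant_nonneg: "g \<in> carrier PSL2 \<Longrightarrow> 0 \<le> majorant g"
  using weight_fun_le_majorant[of g 0] norm_ge_zero order_trans by blast

text \<open>A Harnack inequality: \<open>|q|\<^sup>2\<close> shrinks at most by the factor \<open>e\<^sup>-\<^sup>2\<close> under \<open>diag_flow t\<close> with \<open>|t| \<le> 1\<close>.\<close>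

lemma majorant_flow:
  assumes "g \<in> carrier PSL2" "\<bar>t\<bar> \<le> 1"
  shows "majorant (g \<cdot> psl (diag_flow t)) \<le> exp (2 * \<delta>) * majorant g"
proof -
  obtain A where A: "A \<in> carrier SL2" "g = psl A" using assms(1) by (rule PSL2_cases)
  have SL: "A ** diag_flow t \<in> carrier SL2" by (rule mult_in_SL2[OF A(1) diag_flow_in_SL2])
  have pw: "cmod (poisson \<delta> 0 u (A ** diag_flow t)) \<le> exp (2 * \<delta>) * cmod (poisson \<delta> 0 u A)" for u
  proof -
    define p where "p = A$1$1 - u * A$2$1"
    define r where "r = A$1$2 - u * A$2$2"
    have q: "(cmod (row_form u A))\<^sup>2 = r\<^sup>2 + p\<^sup>2" by (simp add: row_form_def cmod_power2 p_def r_def)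
    have "(cmod (row_form u (A ** diag_flow t)))\<^sup>2 = (r * exp (- t))\<^sup>2 + (p * exp t)\<^sup>2"
      by (simp add: row_form_def cmod_power2 p_def r_def diag_flow_def mult_nth algebra_simps)
    also have "\<dots> = exp (- 2 * t) * r\<^sup>2 + exp (2 * t) * p\<^sup>2"
      by (simp add: power_mult_distrib mult.commute flip: exp_of_nat_mult)
    also have "\<dots> \<ge> exp (- 2) * r\<^sup>2 + exp (- 2) * p\<^sup>2"
      using assms(2) by (intro add_mono mult_right_mono) auto
    finally have ge: "exp (- 2) * (cmod (row_form u A))\<^sup>2 \<le> (cmod (row_form u (A ** diag_flow t)))\<^sup>2" by (simp add: q algebra_simps)
    have q0: "0 < (cmod (row_form u A))\<^sup>2" using row_form_nonzero[OF A(1)] by simp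
    have "(u\<^sup>2 + 1) / (cmod (row_form u (A ** diag_flow t)))\<^sup>2 \<le> (u\<^sup>2 + 1) / (exp (- 2) * (cmod (row_form u A))\<^sup>2)"
      using ge q0 sq_plus_one_pos[of u] by (intro divide_left_mono) (auto simp: zero_less_mult_iff row_form_nonzero[OF SL])
    also have "\<dots> = exp 2 * ((u\<^sup>2 + 1) / (cmod (row_form u A))\<^sup>2)" by (simp add: exp_minus field_simps)
    finally have "((u\<^sup>2 + 1) / (cmod (row_form u (A ** diag_flow t)))\<^sup>2) powr \<delta> \<le> (exp 2 * ((u\<^sup>2 + 1) / (cmod (row_form u A))\<^sup>2)) powr \<delta>"
      using delta_pos by (intro powr_mono2) auto
    also have "\<dots> = exp (2 * \<delta>) * ((u\<^sup>2 + 1) / (cmod (row_form u A))\<^sup>2) powr \<delta>"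
      by (subst powr_mult) (simp_all add: exp_powr_real)
    finally show ?thesis by (simp only: cmod_poisson[OF A(1)] cmod_poisson[OF SL])
  qed
  have "(\<integral>u. cmod (poisson \<delta> 0 u (A ** diag_flow t)) \<partial>\<mu>) \<le> (\<integral>u. exp (2 * \<delta>) * cmod (poisson \<delta> 0 u A) \<partial>\<mu>)"
    using pw poisson_integrable[OF A(1)] poisson_integrable[OF SL] by (intro integral_mono) auto
  then show ?thesis by (simp add: A(2) psl_mult majorant_eq A(1) SL)
qed

lemma weight_fun_flow:
  assumes "g \<in> carrier PSL2"
  shows "((\<lambda>t. F l (g \<cdot> psl (diag_flow t))) has_vector_derivative
    of_real (\<delta> + of_int l) * F (l + 1) (g \<cdot> psl (diag_flow t0))
    + of_real (\<delta> - of_int l) * F (l - 1) (g \<cdot> psl (diag_flow t0))) (at t0)"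
proof -
  obtain A where A: "A \<in> carrier SL2" "g = psl A" using assms by (rule PSL2_cases)
  show ?thesis unfolding A(2) psl_mult weight_fun_psl by (rule poisson_integral_flow[OF A(1)])
qed

end

section \<open>Norms on the quotient\<close>

lemma space_quotient_haar: "g \<in> space (quotient_haar \<Gamma>) \<Longrightarrow> g \<in> carrier PSL2"
  by (simp add: quotient_haar_def space_restrict_space space_haar)

lemma measurable_quotient_haar:
  fixes k :: "(real^2^2) set \<Rightarrow> 'b::topological_space"
  assumes "k \<in> borel_measurable (borel_of PSL2_topology)"
  shows "k \<in> borel_measurable (quotient_haar \<Gamma>)"
proof -
  have "k \<in> borel_measurable haar" using assms by (simp add: measurable_cong_sets[OF sets_haar refl])
  then show ?thesis unfolding quotient_haar_def by (rule measurable_restrict_space1)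
qed

text \<open>The complex version of \<open>nn_integral_quotient_haar_right\<close>, by splitting into the positive and negative
parts of the real and imaginary parts.\<close>

lemma integral_quotient_haar_right:
  fixes f :: "(real^2^2) set \<Rightarrow> complex"
  assumes disc: "discrete_subgroup \<Gamma>" and h: "h \<in> carrier PSL2"
    and f: "f \<in> borel_measurable (borel_of PSL2_topology)" and inv: "left_invariant \<Gamma> f"
    and int: "integrable (quotient_haar \<Gamma>) f"
  shows "(\<integral>g. f (g \<cdot> h) \<partial>quotient_haar \<Gamma>) = (\<integral>g. f g \<partial>quotient_haar \<Gamma>)"
proof -
  have rm: "(\<lambda>g. k (g \<cdot> h)) \<in> borel_measurable (borel_of PSL2_topology)"
    if "k \<in> borel_measurable (borel_of PSL2_topology)" for k :: "(real^2^2) set \<Rightarrow> 'b::topological_space"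
    using measurable_compose[OF borel_of_mult_right[OF h] that] .
  have pos: "integrable (quotient_haar \<Gamma>) (\<lambda>g. k (g \<cdot> h)) \<and>
      (\<integral>g. k (g \<cdot> h) \<partial>quotient_haar \<Gamma>) = (\<integral>g. k g \<partial>quotient_haar \<Gamma>)"
    if k: "k \<in> borel_measurable (borel_of PSL2_topology)" "left_invariant \<Gamma> k" "\<And>g. 0 \<le> k g"
      "integrable (quotient_haar \<Gamma>) k" for k :: "(real^2^2) set \<Rightarrow> real"
  proof -
    have km: "(\<lambda>g. ennreal (k g)) \<in> borel_measurable (borel_of PSL2_topology)" using k(1) by measurable
    have "left_invariant \<Gamma> (\<lambda>g. ennreal (k g))" using k(2) by (simp add: left_invariant_def)
    from nn_integral_quotient_haar_right[OF disc h km this]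
    have "(\<integral>\<^sup>+g. ennreal (k (g \<cdot> h)) \<partial>quotient_haar \<Gamma>) = ennreal (\<integral>g. k g \<partial>quotient_haar \<Gamma>)"
      using nn_integral_eq_integral[OF k(4)] k(3) by simp
    then show ?thesis
      using nn_integral_eq_integrable[of "\<lambda>g. k (g \<cdot> h)" "quotient_haar \<Gamma>" "\<integral>g. k g \<partial>quotient_haar \<Gamma>"]
        measurable_quotient_haar[OF rm[OF k(1)]] k(3) by (simp add: integral_nonneg_AE)
  qed
  have real: "integrable (quotient_haar \<Gamma>) (\<lambda>g. k (g \<cdot> h)) \<and>
      (\<integral>g. k (g \<cdot> h) \<partial>quotient_haar \<Gamma>) = (\<integral>g. k g \<partial>quotient_haar \<Gamma>)"
    if k: "k \<in> borel_measurable (borel_of PSL2_topology)" "left_invariant \<Gamma> k"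
      "integrable (quotient_haar \<Gamma>) k" for k :: "(real^2^2) set \<Rightarrow> real"
  proof -
    define k1 where "k1 g = max 0 (k g)" for g
    define k2 where "k2 g = max 0 (- k g)" for g
    have e: "k g = k1 g - k2 g" for g by (simp add: k1_def k2_def)
    have i: "integrable (quotient_haar \<Gamma>) k1" "integrable (quotient_haar \<Gamma>) k2"
      unfolding k1_def k2_def using k(3) by (intro integrable_max; simp)+
    have 1: "integrable (quotient_haar \<Gamma>) (\<lambda>g. k1 (g \<cdot> h)) \<and>
      (\<integral>g. k1 (g \<cdot> h) \<partial>quotient_haar \<Gamma>) = (\<integral>g. k1 g \<partial>quotient_haar \<Gamma>)"
    proof (rule pos[OF _ _ _ i(1)])
      show "k1 \<in> borel_measurable (borel_of PSL2_topology)" unfolding k1_def using k(1) by measurable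
    qed (use k(2) in \<open>auto simp: k1_def left_invariant_def\<close>)
    have 2: "integrable (quotient_haar \<Gamma>) (\<lambda>g. k2 (g \<cdot> h)) \<and>
      (\<integral>g. k2 (g \<cdot> h) \<partial>quotient_haar \<Gamma>) = (\<integral>g. k2 g \<partial>quotient_haar \<Gamma>)"
    proof (rule pos[OF _ _ _ i(2)])
      show "k2 \<in> borel_measurable (borel_of PSL2_topology)" unfolding k2_def using k(1) by measurable
    qed (use k(2) in \<open>auto simp: k2_def left_invariant_def\<close>)
    show ?thesis unfolding e using 1 2 i by simp
  qed
  have R: "integrable (quotient_haar \<Gamma>) (\<lambda>g. Re (f (g \<cdot> h))) \<and>
      (\<integral>g. Re (f (g \<cdot> h)) \<partial>quotient_haar \<Gamma>) = (\<integral>g. Re (f g) \<partial>quotient_haar \<Gamma>)"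
    using f inv int by (intro real[of "\<lambda>g. Re (f g)"]) (auto simp: left_invariant_def)
  have I: "integrable (quotient_haar \<Gamma>) (\<lambda>g. Im (f (g \<cdot> h))) \<and>
      (\<integral>g. Im (f (g \<cdot> h)) \<partial>quotient_haar \<Gamma>) = (\<integral>g. Im (f g) \<partial>quotient_haar \<Gamma>)"
    using f inv int by (intro real[of "\<lambda>g. Im (f g)"]) (auto simp: left_invariant_def)
  have "integrable (quotient_haar \<Gamma>) (\<lambda>g. f (g \<cdot> h))"
  proof -
    have "integrable (quotient_haar \<Gamma>) (\<lambda>g. complex_of_real (Re (f (g \<cdot> h))) + \<i> * complex_of_real (Im (f (g \<cdot> h))))"
      using R I by (intro Bochner_Integration.integrable_add integrable_mult_right integrable_of_real) auto
    then show ?thesis by (simp flip: complex_eq)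
  qed
  then show ?thesis using R I int by (simp add: complex_eq_iff)
qed

locale automorphic_kernel = boundary_measure +
  fixes \<Gamma> :: "(real^2^2) set set"
  assumes disc: "discrete_subgroup \<Gamma>"
    and inv0: "left_invariant \<Gamma> (F 0)"
    and L2: "integrable (quotient_haar \<Gamma>) (\<lambda>g. (cmod (F 0 g))\<^sup>2)"
begin

lemma majorant_integrable: "integrable (quotient_haar \<Gamma>) (\<lambda>g. (majorant g)\<^sup>2)"
proof (rule Bochner_Integration.integrable_bound[OF L2])
  show "(\<lambda>g. (majorant g)\<^sup>2) \<in> borel_measurable (quotient_haar \<Gamma>)"
    unfolding majorant_def using measurable_quotient_haar[OF weight_fun_measurable[of 0]] by measurable
  have "(Re z)\<^sup>2 \<le> (cmod z)\<^sup>2" for z by (simp add: cmod_power2)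
  then show "AE g in quotient_haar \<Gamma>. norm ((majorant g)\<^sup>2) \<le> norm ((cmod (F 0 g))\<^sup>2)"
    by (simp add: majorant_def)
qed

lemma weight_fun_minus: "g \<in> carrier PSL2 \<Longrightarrow> F (- l) g = cnj (F l g)"
  by (auto elim!: PSL2_cases simp: weight_fun_psl poisson_integral_minus)

lemma weight_fun_invariant_nat: "left_invariant \<Gamma> (F (int l))"
proof (induction l)
  case 0
  then show ?case using inv0 by simp
next
  case (Suc l)
  show ?case unfolding left_invariant_def
  proof (intro ballI)
    fix \<gamma> g assume \<gamma>: "\<gamma> \<in> \<Gamma>" and g: "g \<in> carrier PSL2"
    have "\<gamma> \<in> carrier PSL2"
      using subgroup.mem_carrier \<gamma> disc unfolding discrete_subgroup_def by metis
    then obtain B where B: "B \<in> carrier SL2" "\<gamma> = psl B" by (rule PSL2_cases)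
    obtain A where A: "A \<in> carrier SL2" "g = psl A" using g by (rule PSL2_cases)
    have "E (int l) (B ** C) = E (int l) C" if "C \<in> carrier SL2" for C
      using Suc.IH \<gamma> psl_in_PSL2[OF that] unfolding left_invariant_def B(2)
      by (metis psl_mult weight_fun_psl)
    from poisson_integral_invariant_Suc[OF B(1) this A(1)]
    show "F (int (Suc l)) (\<gamma> \<cdot> g) = F (int (Suc l)) g"
      by (simp only: A(2) B(2) psl_mult weight_fun_psl)
  qed
qed

lemma weight_fun_invariant: "left_invariant \<Gamma> (F l)"
proof (cases "0 \<le> l")
  case True
  then show ?thesis using weight_fun_invariant_nat[of "nat l"] by simp
next
  case False
  have "left_invariant \<Gamma> (F (- l))" using False weight_fun_invariant_nat[of "nat (- l)"] by simp
  moreover have "F l g = cnj (F (- l) g)" if "g \<in> carrier PSL2" for g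
    using weight_fun_minus[OF that, of "- l"] by simp
  moreover have "\<gamma> \<cdot> g \<in> carrier PSL2" if "\<gamma> \<in> \<Gamma>" "g \<in> carrier PSL2" for \<gamma> g
    using subgroup.mem_carrier that disc unfolding discrete_subgroup_def by (metis PSL2.m_closed)
  ultimately show ?thesis unfolding left_invariant_def by simp
qed

definition weight_inner :: "int \<Rightarrow> int \<Rightarrow> complex" where
  "weight_inner i j = (\<integral>g. F i g * cnj (F j g) \<partial>quotient_haar \<Gamma>)"

lemma weight_fun_prod_measurable: "(\<lambda>g. F i g * cnj (F j g)) \<in> borel_measurable (borel_of PSL2_topology)"
  using weight_fun_measurable[of i] measurable_compose[OF weight_fun_measurable[of j] cnj_measurable] by measurable

lemma weight_fun_prod_integrable: "integrable (quotient_haar \<Gamma>) (\<lambda>g. F i g * cnj (F j g))"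
proof (rule Bochner_Integration.integrable_bound[OF majorant_integrable])
  show "AE g in quotient_haar \<Gamma>. norm (F i g * cnj (F j g)) \<le> norm ((majorant g)\<^sup>2)"
  proof (rule AE_I2)
    fix g assume "g \<in> space (quotient_haar \<Gamma>)"
    then have g: "g \<in> carrier PSL2" by (rule space_quotient_haar)
    show "norm (F i g * cnj (F j g)) \<le> norm ((majorant g)\<^sup>2)"
      using mult_mono[OF weight_fun_le_majorant[OF g, of i] weight_fun_le_majorant[OF g, of j] majorant_nonneg[OF g]]
      by (simp add: norm_mult power2_eq_square)
  qed
qed (rule measurable_quotient_haar[OF weight_fun_prod_measurable])

lemma weight_inner_right:
  assumes "h \<in> carrier PSL2"
  shows "(\<integral>g. F i (g \<cdot> h) * cnj (F j (g \<cdot> h)) \<partial>quotient_haar \<Gamma>) = weight_inner i j"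
  unfolding weight_inner_def
  by (rule integral_quotient_haar_right[OF disc assms weight_fun_prod_measurable _ weight_fun_prod_integrable])
    (use weight_fun_invariant in \<open>simp add: left_invariant_def\<close>)

text \<open>Rotation by \<open>\<theta>\<close> multiplies the integrand by \<open>e\<close> to the power \<open>2 i (i - j) \<theta>\<close> but preserves the integral.\<close>

lemma weight_inner_orthogonal:
  assumes "i \<noteq> j" shows "weight_inner i j = 0"
proof -
  \<comment> \<open>For this angle the factor is \<open>- 1\<close>.\<close>
  define \<theta> where "\<theta> = pi / (2 * (of_int i - of_int j))"
  have ne: "real_of_int i - of_int j \<noteq> 0" using assms by simp
  have th: "2 * of_int i * \<theta> + - (2 * of_int j * \<theta>) = pi"
  proof -
    have "2 * of_int i * \<theta> + - (2 * of_int j * \<theta>) = 2 * (of_int i - of_int j) * \<theta>" by (simp add: algebra_simps)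
    also have "\<dots> = pi" using ne by (simp add: \<theta>_def)
    finally show ?thesis .
  qed
  have "weight_inner i j = (\<integral>g. F i (g \<cdot> psl (k_mat \<theta>)) * cnj (F j (g \<cdot> psl (k_mat \<theta>))) \<partial>quotient_haar \<Gamma>)"
    by (rule weight_inner_right[symmetric]) (simp add: psl_in_PSL2 k_in_SL2)
  also have "\<dots> = (\<integral>g. - (F i g * cnj (F j g)) \<partial>quotient_haar \<Gamma>)"
  proof (rule Bochner_Integration.integral_cong[OF refl])
    fix g assume "g \<in> space (quotient_haar \<Gamma>)"
    then obtain A where A: "A \<in> carrier SL2" "g = psl A" using space_quotient_haar PSL2_cases by blast
    have "cis (2 * of_int i * \<theta>) * cnj (cis (2 * of_int j * \<theta>)) = -1"
      unfolding cis_cnj cis_mult th by simp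
    then have "cis (2 * of_int i * \<theta>) * a * cnj (cis (2 * of_int j * \<theta>) * b) = - (a * cnj b)" for a b
      by (simp add: mult.assoc mult.left_commute[of a]) (metis mult.assoc mult_minus1)
    then show "F i (g \<cdot> psl (k_mat \<theta>)) * cnj (F j (g \<cdot> psl (k_mat \<theta>))) = - (F i g * cnj (F j g))"
      unfolding A(2) psl_mult weight_fun_psl poisson_integral_k .
  qed
  also have "\<dots> = - weight_inner i j" by (simp add: weight_inner_def)
  finally show ?thesis by simp
qed

text \<open>The inner product of the translates of the functions of weights \<open>l\<close> and \<open>l + 1\<close> by \<open>diag_flow t\<close> is
constant in \<open>t\<close>. Its derivative at 0 consists of four inner products, of which orthogonality leaves two: this
is the skew-symmetry of the generator of the flow.\<close>

lemma weight_inner_recursion: "of_real (\<delta> + of_int l) * weight_inner (l + 1) (l + 1) = of_real (1 - \<delta> + of_int l) * weight_inner l l"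
proof -
  define m where "m = l + 1"
  define a where "a t g = g \<cdot> psl (diag_flow t)" for t g
  \<comment> \<open>The derivative along the flow of the weight function \<open>j\<close>.\<close>
  define D where "D j g = of_real (\<delta> + of_int j) * F (j + 1) g + of_real (\<delta> - of_int j) * F (j - 1) g" for j g
  define f where "f t g = F l (a t g) * cnj (F m (a t g))" for t g
  define f' where "f' t g = F l (a t g) * cnj (D m (a t g)) + D l (a t g) * cnj (F m (a t g))" for t g
  define c where "c j = \<bar>\<delta> + of_int j\<bar> + \<bar>\<delta> - of_int j\<bar>" for j
  define K where "K = exp (2 * \<delta>)"
  have diag_flow_carrier: "psl (diag_flow t) \<in> carrier PSL2" for t by (simp add: psl_in_PSL2 diag_flow_in_SL2)
  have const: "(\<integral>g. f t g \<partial>quotient_haar \<Gamma>) = weight_inner l m" for t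
    unfolding f_def a_def by (rule weight_inner_right[OF diag_flow_carrier])
  have a0: "a 0 g = g" if "g \<in> carrier PSL2" for g
  proof -
    have "diag_flow 0 = mat 1" by (simp add: diag_flow_def matrix_eq_entries one_nth)
    then show ?thesis using that by (simp add: a_def flip: one_PSL2)
  qed
  define e where "e g = (of_real (\<delta> + of_int m) * (F l g * cnj (F (m + 1) g)) + of_real (\<delta> - of_int m) * (F l g * cnj (F (m - 1) g)))
    + (of_real (\<delta> + of_int l) * (F (l + 1) g * cnj (F m g)) + of_real (\<delta> - of_int l) * (F (l - 1) g * cnj (F m g)))" for g
  have f'0: "f' 0 g = e g"
    if "g \<in> carrier PSL2" for g
    unfolding f'_def a0[OF that] D_def e_def by (simp add: algebra_simps)
  have int0: "integrable (quotient_haar \<Gamma>) e"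
    unfolding e_def by (intro Bochner_Integration.integrable_add integrable_mult_right weight_fun_prod_integrable)
  have "((\<lambda>t. \<integral>g. f t g \<partial>quotient_haar \<Gamma>) has_vector_derivative (\<integral>g. f' 0 g \<partial>quotient_haar \<Gamma>)) (at 0)"
  proof (rule has_vector_derivative_integral[OF zero_less_one, where g = "\<lambda>g. K * K * (c l + c m) * (majorant g)\<^sup>2"])
    fix t g assume t: "t \<in> ball (0::real) 1" and "g \<in> space (quotient_haar \<Gamma>)"
    then have g: "g \<in> carrier PSL2" by (intro space_quotient_haar)
    have ag: "a t g \<in> carrier PSL2" using g diag_flow_carrier by (simp add: a_def)
    have b: "cmod (F j (a t g)) \<le> K * majorant g" for j
      using weight_fun_le_majorant[OF ag, of j] majorant_flow[OF g, of t] t by (simp add: a_def K_def)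
    have M: "0 \<le> K * majorant g" using majorant_nonneg[OF g] by (simp add: K_def)
    have bD: "cmod (D j (a t g)) \<le> c j * (K * majorant g)" for j
    proof -
      have "cmod (D j (a t g)) \<le> \<bar>\<delta> + of_int j\<bar> * cmod (F (j + 1) (a t g)) + \<bar>\<delta> - of_int j\<bar> * cmod (F (j - 1) (a t g))"
        unfolding D_def by (rule order_trans[OF norm_triangle_ineq]) (simp only: norm_mult norm_of_real order_refl)
      also have "\<dots> \<le> \<bar>\<delta> + of_int j\<bar> * (K * majorant g) + \<bar>\<delta> - of_int j\<bar> * (K * majorant g)"
        by (intro add_mono mult_left_mono b) auto
      finally show ?thesis by (simp only: c_def distrib_right)
    qed
    show "((\<lambda>s. f s g) has_vector_derivative f' t g) (at t)"
      unfolding f_def f'_def a_def D_def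
      by (intro has_vector_derivative_mult has_vector_derivative_cnj weight_fun_flow g)
    have "cmod (f' t g) \<le> cmod (F l (a t g)) * cmod (D m (a t g)) + cmod (D l (a t g)) * cmod (F m (a t g))"
      unfolding f'_def by (rule order_trans[OF norm_triangle_ineq]) (simp only: norm_mult complex_mod_cnj order_refl)
    also have "\<dots> \<le> (K * majorant g) * (c m * (K * majorant g)) + (c l * (K * majorant g)) * (K * majorant g)"
      using M by (intro add_mono mult_mono b bD) (auto simp: c_def)
    finally show "cmod (f' t g) \<le> K * K * (c l + c m) * (majorant g)\<^sup>2"
      by (simp add: algebra_simps power2_eq_square)
  next
    show "integrable (quotient_haar \<Gamma>) (\<lambda>g. K * K * (c l + c m) * (majorant g)\<^sup>2)"
      by (intro integrable_mult_right majorant_integrable)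
  next
    fix t assume t: "t \<in> ball (0::real) 1"
    show "integrable (quotient_haar \<Gamma>) (f t)"
    proof (rule Bochner_Integration.integrable_bound)
      show "integrable (quotient_haar \<Gamma>) (\<lambda>g. K * K * (majorant g)\<^sup>2)"
        by (intro integrable_mult_right majorant_integrable)
      show "f t \<in> borel_measurable (quotient_haar \<Gamma>)"
        unfolding f_def a_def
        by (rule measurable_quotient_haar[OF measurable_compose[OF borel_of_mult_right[OF diag_flow_carrier] weight_fun_prod_measurable]])
      show "AE g in quotient_haar \<Gamma>. norm (f t g) \<le> norm (K * K * (majorant g)\<^sup>2)"
      proof (rule AE_I2)
        fix g assume "g \<in> space (quotient_haar \<Gamma>)"
        then have g: "g \<in> carrier PSL2" by (intro space_quotient_haar)
        have ag: "a t g \<in> carrier PSL2" using g diag_flow_carrier by (simp add: a_def)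
        have b: "cmod (F j (a t g)) \<le> K * majorant g" for j
          using weight_fun_le_majorant[OF ag, of j] majorant_flow[OF g, of t] t by (simp add: a_def K_def)
        have "0 \<le> K * majorant g" using majorant_nonneg[OF g] by (simp add: K_def)
        from mult_mono[OF b[of l] b[of m] this]
        show "norm (f t g) \<le> norm (K * K * (majorant g)\<^sup>2)"
          by (simp add: f_def norm_mult power2_eq_square mult_ac K_def)
      qed
    qed
  next
    show "integrable (quotient_haar \<Gamma>) (f' 0)"
      using int0 by (rule Bochner_Integration.integrable_cong[OF refl, THEN iffD2, rotated]) (simp add: f'0 space_quotient_haar)
  qed
  then have "(\<integral>g. f' 0 g \<partial>quotient_haar \<Gamma>) = 0"
    unfolding const using vector_derivative_unique_at has_vector_derivative_const by blast
  moreover have "(\<integral>g. f' 0 g \<partial>quotient_haar \<Gamma>) = (of_real (\<delta> + of_int m) * weight_inner l (m + 1) + of_real (\<delta> - of_int m) * weight_inner l (m - 1))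
    + (of_real (\<delta> + of_int l) * weight_inner (l + 1) m + of_real (\<delta> - of_int l) * weight_inner (l - 1) m)"
  proof -
    have "(\<integral>g. f' 0 g \<partial>quotient_haar \<Gamma>) = (\<integral>g. e g \<partial>quotient_haar \<Gamma>)"
      by (rule Bochner_Integration.integral_cong[OF refl]) (simp add: f'0 space_quotient_haar)
    also have "\<dots> = (of_real (\<delta> + of_int m) * weight_inner l (m + 1) + of_real (\<delta> - of_int m) * weight_inner l (m - 1))
    + (of_real (\<delta> + of_int l) * weight_inner (l + 1) m + of_real (\<delta> - of_int l) * weight_inner (l - 1) m)"
      unfolding weight_inner_def e_def
      by (simp only: Bochner_Integration.integral_add Bochner_Integration.integrable_add integrable_mult_right weight_fun_prod_integrable integral_mult_right_zero)
    finally show ?thesis .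
  qed
  moreover have "weight_inner l (m + 1) = 0" "weight_inner (l - 1) m = 0" by (auto simp: m_def intro!: weight_inner_orthogonal)
  ultimately have "of_real (\<delta> - of_int m) * weight_inner l l + of_real (\<delta> + of_int l) * weight_inner m m = 0" by (simp add: m_def)
  then show ?thesis by (simp add: m_def algebra_simps)
qed

definition weight_norm_sq :: "int \<Rightarrow> real" where "weight_norm_sq l = (\<integral>g. (cmod (F l g))\<^sup>2 \<partial>quotient_haar \<Gamma>)"

lemma weight_inner_self: "weight_inner l l = of_real (weight_norm_sq l)"
  unfolding weight_inner_def weight_norm_sq_def complex_norm_square[symmetric] by (rule integral_complex_of_real)

text \<open>The recursion solved: the squared norm is the quotient of two Pochhammer symbols.\<close>

lemma weight_norm_sq_nat: "pochhammer \<delta> l * weight_norm_sq (int l) = pochhammer (1 - \<delta>) l * weight_norm_sq 0"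
proof (induction l)
  case (Suc l)
  have "complex_of_real ((\<delta> + l) * weight_norm_sq (int l + 1)) = of_real ((1 - \<delta> + l) * weight_norm_sq (int l))"
    using weight_inner_recursion[of "int l"] by (simp add: weight_inner_self)
  then have "(\<delta> + l) * weight_norm_sq (int l + 1) = (1 - \<delta> + l) * weight_norm_sq (int l)" by (simp only: of_real_eq_iff)
  then have "pochhammer \<delta> l * ((\<delta> + l) * weight_norm_sq (int l + 1)) = (1 - \<delta> + l) * (pochhammer \<delta> l * weight_norm_sq (int l))"
    by simp
  also have "\<dots> = (1 - \<delta> + l) * (pochhammer (1 - \<delta>) l * weight_norm_sq 0)" by (simp only: Suc)
  finally show ?case by (simp add: pochhammer_Suc mult_ac add.commute)
qed simp

lemma weight_norm_sq_minus: "weight_norm_sq (- l) = weight_norm_sq l"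
  unfolding weight_norm_sq_def by (rule Bochner_Integration.integral_cong[OF refl]) (simp add: weight_fun_minus space_quotient_haar)

end

section \<open>The boundary integral and the main result\<close>

definition real_line :: "complex option set" where "real_line = range (\<lambda>u::real. Some (complex_of_real u))"

text \<open>The restriction of the measure to the finite boundary points, as a Borel measure on the reals.\<close>

definition real_boundary :: "complex option measure \<Rightarrow> real measure" where
  "real_boundary \<nu> = distr (restrict_space \<nu> real_line) borel (\<lambda>p. Re (the p))"

lemma openin_H_bar:
  assumes "open W" shows "openin H_bar (Some ` (W \<inter> {z. 0 \<le> Im z}))"
proof -
  have "openin (Alexandroff_compactification euclidean) (Some ` W)"
    using assms by (auto simp: openin_Alexandroff_compactification)
  then have "openin H_bar (Some ` W \<inter> insert None (Some ` {z. 0 \<le> Im z}))"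
    unfolding H_bar_def by (rule openin_subtopology_Int)
  moreover have "Some ` W \<inter> insert None (Some ` {z. 0 \<le> Im z}) = Some ` (W \<inter> {z. 0 \<le> Im z})" by auto
  ultimately show ?thesis by simp
qed

text \<open>The real line is closed in the closed upper half plane, so a relatively open subset of it is a difference of
two open sets of the compactification.\<close>

lemma real_line_slice: "(\<lambda>u. Some (complex_of_real u)) ` S =
  Some ` ({z. Re z \<in> S} \<inter> {z. 0 \<le> Im z}) - Some ` ({z. 0 < Im z} \<inter> {z. 0 \<le> Im z})"
proof (intro equalityI subsetI)
  fix p assume "p \<in> Some ` ({z. Re z \<in> S} \<inter> {z. 0 \<le> Im z}) - Some ` ({z. 0 < Im z} \<inter> {z. 0 \<le> Im z})"
  then obtain z where z: "p = Some z" "Re z \<in> S" "Im z = 0" by force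
  then have "z = complex_of_real (Re z)" by (simp add: complex_eq_iff)
  then show "p \<in> (\<lambda>u. Some (complex_of_real u)) ` S" using z by (intro image_eqI[of _ _ "Re z"]) auto
qed auto

lemma real_line_slice_sets:
  assumes "open S" shows "(\<lambda>u. Some (complex_of_real u)) ` S \<in> sets (borel_of H_bar)"
proof -
  have "open {z. Re z \<in> S}" using assms open_vimage[of S Re] by (simp add: vimage_def continuous_intros)
  moreover have "open {z. 0 < Im z}" by (intro open_Collect_less continuous_intros)
  ultimately show ?thesis unfolding real_line_slice
    by (intro sets.Diff openin_in_borel_of openin_H_bar)
qed

lemma real_boundary:
  assumes fin: "finite_measure \<nu>" and s: "sets \<nu> = sets (borel_of H_bar)"
  shows "finite_measure (real_boundary \<nu>)" "sets (real_boundary \<nu>) = sets borel"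
    "f \<in> borel_measurable borel \<Longrightarrow> integral_real \<nu> f = (\<integral>u. f u \<partial>real_boundary \<nu>)"
proof -
  have R: "real_line \<in> sets \<nu>" unfolding real_line_def s by (rule real_line_slice_sets[OF open_UNIV])
  have Rsp: "real_line \<inter> space \<nu> \<in> sets \<nu>" using R by simp
  have m: "(\<lambda>p. Re (the p)) \<in> borel_measurable (restrict_space \<nu> real_line)"
  proof (rule borel_measurableI)
    fix S :: "real set" assume S: "open S"
    have "(\<lambda>p. Re (the p)) -` S \<inter> space (restrict_space \<nu> real_line) = (\<lambda>u. Some (complex_of_real u)) ` S"
      using sets.sets_into_space[OF R] by (auto simp: space_restrict_space real_line_def)
    also have "\<dots> \<in> sets (restrict_space \<nu> real_line)"
      using real_line_slice_sets[OF S] unfolding sets_restrict_space s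
      by (intro image_eqI[of _ _ "(\<lambda>u. Some (complex_of_real u)) ` S"]) (auto simp: real_line_def)
    finally show "(\<lambda>p. Re (the p)) -` S \<inter> space (restrict_space \<nu> real_line) \<in> sets (restrict_space \<nu> real_line)" .
  qed
  have "finite_measure (restrict_space \<nu> real_line)" using fin R by (intro finite_measure_restrict_space) auto
  then show "finite_measure (real_boundary \<nu>)" unfolding real_boundary_def by (rule finite_measure.finite_measure_distr[OF _ m])
  show "sets (real_boundary \<nu>) = sets borel" by (simp add: real_boundary_def)
  assume f: "f \<in> borel_measurable borel"
  have "integral_real \<nu> f = (\<integral>p. f (Re (the p)) \<partial>restrict_space \<nu> real_line)"
    unfolding integral_real_def set_lebesgue_integral_def real_line_def[symmetric]
    by (rule integral_restrict_space[OF Rsp, symmetric])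
  also have "\<dots> = (\<integral>u. f u \<partial>real_boundary \<nu>)"
    unfolding real_boundary_def by (rule integral_distr[OF m f, symmetric])
  finally show "integral_real \<nu> f = (\<integral>u. f u \<partial>real_boundary \<nu>)" .
qed

text \<open>This identifies the weight functions with the expressions in the theorem, apart from the normalisation.\<close>

lemma weight_fun_nak:
  assumes fin: "finite_measure \<nu>" and s: "sets \<nu> = sets (borel_of H_bar)" and y: "0 < y"
  shows "weight_fun (real_boundary \<nu>) \<delta> (int l) (nak x y \<theta>) = exp (2 * of_nat l * \<i> * of_real \<theta>) *
      integral_real \<nu> (\<lambda>u. of_real (((u\<^sup>2 + 1) * y / ((x - u)\<^sup>2 + y\<^sup>2)) powr \<delta>) *
        ((of_real (x - u) - \<i> * of_real y) / (of_real (x - u) + \<i> * of_real y)) ^ l)"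
    and "weight_fun (real_boundary \<nu>) \<delta> (- int l) (nak x y \<theta>) = exp (- 2 * of_nat l * \<i> * of_real \<theta>) *
      integral_real \<nu> (\<lambda>u. of_real (((u\<^sup>2 + 1) * y / ((x - u)\<^sup>2 + y\<^sup>2)) powr \<delta>) *
        ((of_real (x - u) + \<i> * of_real y) / (of_real (x - u) - \<i> * of_real y)) ^ l)"
proof -
  have C: "Complex (x - u) (- y) = of_real (x - u) - \<i> * of_real y" "Complex (x - u) y = of_real (x - u) + \<i> * of_real y" for u
    by (simp_all add: complex_eq_iff)
  have h: "of_real (((u\<^sup>2 + 1) * y / ((x - u)\<^sup>2 + y\<^sup>2)) powr \<delta>) *
      ((of_real (x - u) - \<i> * of_real y) / (of_real (x - u) + \<i> * of_real y)) powi k = poisson \<delta> k u (nak_mat x y 0)" for k u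
    using poisson_nak_mat[OF y, of \<delta> k u x 0] by (simp add: C)
  have I: "integral_real \<nu> (\<lambda>u. of_real (((u\<^sup>2 + 1) * y / ((x - u)\<^sup>2 + y\<^sup>2)) powr \<delta>) *
      ((of_real (x - u) - \<i> * of_real y) / (of_real (x - u) + \<i> * of_real y)) powi k) = poisson_integral (real_boundary \<nu>) \<delta> k (nak_mat x y 0)" for k
    unfolding h poisson_integral_def by (rule real_boundary(3)[OF fin s poisson_measurable[OF nak_mat_in_SL2[OF y]]])
  have rot: "weight_fun (real_boundary \<nu>) \<delta> k (nak x y \<theta>) = cis (2 * of_int k * \<theta>) * poisson_integral (real_boundary \<nu>) \<delta> k (nak_mat x y 0)" for k
    unfolding nak_eq_nak_mat weight_fun_psl by (subst nak_mat_rotate) (rule poisson_integral_k)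
  show "weight_fun (real_boundary \<nu>) \<delta> (int l) (nak x y \<theta>) = exp (2 * of_nat l * \<i> * of_real \<theta>) *
      integral_real \<nu> (\<lambda>u. of_real (((u\<^sup>2 + 1) * y / ((x - u)\<^sup>2 + y\<^sup>2)) powr \<delta>) *
        ((of_real (x - u) - \<i> * of_real y) / (of_real (x - u) + \<i> * of_real y)) ^ l)"
    using I[of "int l"] rot[of "int l"] by (simp add: cis_conv_exp mult_ac)
  have flip: "(a / b) powi (- int l) = (b / a) ^ l" for a b :: complex
    by (simp add: power_int_minus flip: power_inverse)
  show "weight_fun (real_boundary \<nu>) \<delta> (- int l) (nak x y \<theta>) = exp (- 2 * of_nat l * \<i> * of_real \<theta>) *
      integral_real \<nu> (\<lambda>u. of_real (((u\<^sup>2 + 1) * y / ((x - u)\<^sup>2 + y\<^sup>2)) powr \<delta>) *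
        ((of_real (x - u) + \<i> * of_real y) / (of_real (x - u) - \<i> * of_real y)) ^ l)"
    using I[of "- int l", unfolded flip] rot[of "- int l"] by (simp add: cis_conv_exp mult_ac)
qed

lemma phi0_weight_fun:
  assumes fin: "finite_measure \<nu>" and s: "sets \<nu> = sets (borel_of H_bar)" and g: "g \<in> carrier PSL2"
  shows "phi0 \<delta> \<nu> g = weight_fun (real_boundary \<nu>) \<delta> 0 g"
proof -
  obtain x y \<theta> where n: "0 < y" "g = nak x y \<theta>" "nak_coords g = (x, y, \<theta>)"
    using nak_coords_carrier[OF g] by blast
  show ?thesis unfolding phi0_def n(3) using weight_fun_nak(1)[OF fin s n(1), of \<delta> 0 x \<theta>] by (simp add: n(2))
qed

context automorphic_kernel
begin

lemma raising_power:
  assumes "\<And>g. g \<in> carrier PSL2 \<Longrightarrow> f g = F 0 g" "g \<in> carrier PSL2"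
  shows "(raising ^^ l) f g = of_real (pochhammer \<delta> l) * F (int l) g"
    and "(lowering ^^ l) f g = of_real (pochhammer \<delta> l) * F (- int l) g"
  using assms(2)
proof (induction l arbitrary: g)
  case (Suc l)
  { case 1
    have "raising ((raising ^^ l) f) g = of_real (pochhammer \<delta> l) * of_real (\<delta> + of_int (int l)) * F (int l + 1) g"
      by (rule raising_weight_fun(1)[OF Suc.IH(1) 1])
    then show ?case by (simp add: pochhammer_Suc add.commute) }
  { case 2
    have "lowering ((lowering ^^ l) f) g = of_real (pochhammer \<delta> l) * of_real (\<delta> - of_int (- int l)) * F (- int l - 1) g"
      by (rule raising_weight_fun(2)[OF Suc.IH(2) 2])
    then show ?case by (simp add: pochhammer_Suc) (metis add.commute diff_minus_eq_add minus_add_distrib uminus_add_conv_diff) }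
qed (use assms(1) in auto)

lemma L2_norm_multiple:
  assumes "\<And>g. g \<in> carrier PSL2 \<Longrightarrow> f g = of_real c * F l g" "0 \<le> c"
  shows "L2_norm \<Gamma> f = c * sqrt (weight_norm_sq l)"
proof -
  have "(\<integral>g. (cmod (f g))\<^sup>2 \<partial>quotient_haar \<Gamma>) = (\<integral>g. c\<^sup>2 * (cmod (F l g))\<^sup>2 \<partial>quotient_haar \<Gamma>)"
    by (rule Bochner_Integration.integral_cong[OF refl]) (simp add: assms(1) space_quotient_haar norm_mult power_mult_distrib)
  also have "\<dots> = c\<^sup>2 * weight_norm_sq l" by (simp add: weight_norm_sq_def)
  finally show ?thesis using assms(2) by (simp add: L2_norm_def real_sqrt_mult)
qed

end

theorem theorem2p3:
  fixes \<Gamma> :: "(real^2^2) set set"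
    and \<delta> :: real
    and \<nu> :: "complex option measure"
  assumes "discrete_subgroup \<Gamma>"
    and "torsion_free (PSL2\<lparr>carrier := \<Gamma>\<rparr>)"
    and "finitely_generated (PSL2\<lparr>carrier := \<Gamma>\<rparr>)"
    and "\<not> virtually_cyclic (PSL2\<lparr>carrier := \<Gamma>\<rparr>)"
    and "\<delta> = critical_exponent \<Gamma>"
    and "1 / 2 < \<delta>" and "\<delta> < 1"
    and "patterson_measure \<Gamma> \<nu>"
    and "phi0 \<delta> \<nu> \<in> L2_quotient \<Gamma>"
    and "L2_norm \<Gamma> (phi0 \<delta> \<nu>) = 1"
  shows "\<forall>(l::nat) (x::real) (y::real) (\<theta>::real). 0 < y \<longrightarrow> 0 \<le> \<theta> \<longrightarrow> \<theta> < pi \<longrightarrow>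
    phi \<Gamma> \<delta> \<nu> (int l) (nak x y \<theta>) =
      exp (2 * of_nat l * \<i> * of_real \<theta>) *
      of_real (sqrt (Gamma (\<delta> + real l) * Gamma (1 - \<delta>)) /
               sqrt (Gamma \<delta> * Gamma (1 - \<delta> + real l))) *
      integral_real \<nu> (\<lambda>u.
        of_real (((u\<^sup>2 + 1) * y / ((x - u)\<^sup>2 + y\<^sup>2)) powr \<delta>) *
        ((of_real (x - u) - \<i> * of_real y) / (of_real (x - u) + \<i> * of_real y)) ^ l) \<and>
    phi \<Gamma> \<delta> \<nu> (- int l) (nak x y \<theta>) =
      exp (- 2 * of_nat l * \<i> * of_real \<theta>) *
      of_real (sqrt (Gamma (\<delta> + real l) * Gamma (1 - \<delta>)) /
               sqrt (Gamma \<delta> * Gamma (1 - \<delta> + real l))) *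
      integral_real \<nu> (\<lambda>u.
        of_real (((u\<^sup>2 + 1) * y / ((x - u)\<^sup>2 + y\<^sup>2)) powr \<delta>) *
        ((of_real (x - u) + \<i> * of_real y) / (of_real (x - u) - \<i> * of_real y)) ^ l)"
proof -
  have fin: "finite_measure \<nu>" and s: "sets \<nu> = sets (borel_of H_bar)"
    using assms(8) by (simp_all add: patterson_measure_def)
  define \<mu> where "\<mu> = real_boundary \<nu>"
  have phi0: "phi0 \<delta> \<nu> g = weight_fun \<mu> \<delta> 0 g" if "g \<in> carrier PSL2" for g
    unfolding \<mu>_def by (rule phi0_weight_fun[OF fin s that])
  interpret boundary_measure \<mu> \<delta>
    unfolding boundary_measure_def boundary_measure_axioms_def \<mu>_def
    using real_boundary[OF fin s] assms(6) by simp
  interpret automorphic_kernel \<mu> \<delta> \<Gamma>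
  proof
    show "discrete_subgroup \<Gamma>" by (rule assms)
    have car: "\<gamma> \<cdot> g \<in> carrier PSL2" if "\<gamma> \<in> \<Gamma>" "g \<in> carrier PSL2" for \<gamma> g
      using subgroup.mem_carrier that assms(1) unfolding discrete_subgroup_def by (metis PSL2.m_closed)
    show "left_invariant \<Gamma> (F 0)"
      using assms(9) car by (simp add: left_invariant_def L2_quotient_def flip: phi0)
    have "integrable (quotient_haar \<Gamma>) (\<lambda>g. (cmod (phi0 \<delta> \<nu> g))\<^sup>2)"
      using assms(9) by (simp add: L2_quotient_def)
    then show "integrable (quotient_haar \<Gamma>) (\<lambda>g. (cmod (F 0 g))\<^sup>2)"
      by (rule Bochner_Integration.integrable_cong[OF refl, THEN iffD1, rotated])
        (simp add: phi0 space_quotient_haar)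
  qed
  define P where "P l = pochhammer \<delta> l" for l
  have P: "0 < P l" for l unfolding P_def using assms(6) by (intro pochhammer_pos) simp
  have N0: "weight_norm_sq 0 = 1"
    using L2_norm_multiple[of "phi0 \<delta> \<nu>" 1 0] phi0 assms(10) by simp
  have N: "weight_norm_sq (int l) = pochhammer (1 - \<delta>) l / P l" for l
    using weight_norm_sq_nat[of l] P[of l] by (simp add: N0 P_def field_simps)
  define C where "C l = sqrt (Gamma (\<delta> + real l) * Gamma (1 - \<delta>)) / sqrt (Gamma \<delta> * Gamma (1 - \<delta> + real l))" for l
  have C: "1 / sqrt (weight_norm_sq (int l)) = C l" for l
  proof -
    have nonpos: "z \<notin> \<int>\<^sub>\<le>\<^sub>0" if "0 < z" for z :: real
      using that by (auto elim!: nonpos_Ints_cases)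
    have "P l = Gamma (\<delta> + l) / Gamma \<delta>" "pochhammer (1 - \<delta>) l = Gamma (1 - \<delta> + l) / Gamma (1 - \<delta>)"
      unfolding P_def using assms(6,7) by (auto intro!: pochhammer_Gamma nonpos)
    then have "1 / weight_norm_sq (int l) = (Gamma (\<delta> + l) * Gamma (1 - \<delta>)) / (Gamma \<delta> * Gamma (1 - \<delta> + l))"
      unfolding N by (simp add: mult.commute)
    then have "sqrt (1 / weight_norm_sq (int l)) = C l" unfolding C_def by (simp only: real_sqrt_divide)
    then show ?thesis by (simp add: real_sqrt_divide)
  qed
  have norm: "of_real (P l) * z / of_real (P l * sqrt (weight_norm_sq (int l))) = of_real (C l) * z" for z :: complex and l
    unfolding C[symmetric] using P[of l] by simp
  have up: "phi \<Gamma> \<delta> \<nu> (int l) g = of_real (C l) * F (int l) g" if g: "g \<in> carrier PSL2" for l g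
  proof -
    have r: "(raising ^^ l) (phi0 \<delta> \<nu>) g = of_real (P l) * F (int l) g" if "g \<in> carrier PSL2" for g
      unfolding P_def by (rule raising_power(1)[OF phi0 that])
    have "L2_norm \<Gamma> ((raising ^^ l) (phi0 \<delta> \<nu>)) = P l * sqrt (weight_norm_sq (int l))"
      using r P[of l] by (intro L2_norm_multiple) auto
    then show ?thesis unfolding phi_def Let_def using r[OF g] norm by simp
  qed
  have down: "phi \<Gamma> \<delta> \<nu> (- int l) g = of_real (C l) * F (- int l) g" if g: "g \<in> carrier PSL2" for l g
  proof (cases "l = 0")
    case True
    then show ?thesis using up[OF g, of 0] by simp
  next
    case False
    have r: "(lowering ^^ l) (phi0 \<delta> \<nu>) g = of_real (P l) * F (- int l) g" if "g \<in> carrier PSL2" for g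
      unfolding P_def by (rule raising_power(2)[OF phi0 that])
    have "L2_norm \<Gamma> ((lowering ^^ l) (phi0 \<delta> \<nu>)) = P l * sqrt (weight_norm_sq (int l))"
      unfolding weight_norm_sq_minus[of "int l", symmetric] using r P[of l] by (intro L2_norm_multiple) auto
    then show ?thesis unfolding phi_def Let_def using r[OF g] norm False by simp
  qed
  show ?thesis
  proof (intro allI impI conjI, goal_cases)
    case (1 l x y \<theta>)
    show ?case
      unfolding up[OF nak_in_PSL2[OF 1(1)]] \<mu>_def weight_fun_nak(1)[OF fin s 1(1)] C_def by (simp only: mult_ac)
  next
    case (2 l x y \<theta>)
    show ?case
      unfolding down[OF nak_in_PSL2[OF 2(1)]] \<mu>_def weight_fun_nak(2)[OF fin s 2(1)] C_def by (simp only: mult_ac)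
  qed
qed

end
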